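(* Let $f\in L^{\infty}(\Omega)$ and let $(u,b)$ be a renormalized solution of the problem $$(E,f)\qquad \beta(u)-\operatorname{div}\big(a(x,Du)+F(u)\big)\ni f \ \text{ in } \Omega,\qquad u=0 \ \text{ on } \partial\Omega .$$ Then $u\in W^{1,\overrightarrow{p}}(\Omega)\cap L^{\infty}(\Omega)$ and thus, in particular, $(u,b)$ is a weak solution of $(E,f)$.
   Context: Setting. $\Omega\subset\mathbb{R}^N$ ($N\ge 1$) is a bounded domain, with Lipschitz boundary $\partial\Omega$ if $N\ge 2$. The exponents $p_1,\dots,p_N\in(1,\infty)$ are given, $\overrightarrow{p}=(p_1,\dots,p_N)$ and $p_i'=p_i/(p_i-1)$. The anisotropic Sobolev space is $W^{1,\overrightarrow{p}}(\Omega)=\{u\in W^{1,1}(\Omega):\partial_{x_i}u\in L^{p_i}(\Omega),\ i=1,\dots,N\}$ with norm $\|u\|_{L^1(\Omega)}+\sum_{i=1}^N\|\partial_{x_i}u\|_{L^{p_i}(\Omega)}$, and $W^{1,\overrightarrow{p}}_0(\Omega)$ is the closure of $C_0^\infty(\Omega)$ in this norm. The function $F:\mathbb{R}\to\mathbb{R}^N$ is locally Lipschitz continuous; $\beta:\mathbb{R}\to 2^{\mathbb{R}}$ is a set-valued maximal monotone mapping with $0\in\beta(0)$ and domain $D(\beta)=\{r:\beta(r)\neq\emptyset\}$; $a=(a_1,\dots,a_N):\Omega\times\mathbb{R}^N\to\mathbb{R}^N$ is a Carathéodory function such that, for a.e. $x\in\Omega$ and all $\xi,\eta\in\mathbb{R}^N$: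 (coerciveness) $\sum_{i=1}^N a_i(x,\xi)\xi_i\ge\lambda\sum_{i=1}^N|\xi_i|^{p_i}$ for a constant $\lambda>0$; (growth) $|a_i(x,\xi)|\le\gamma\,(d_i(x)+|\xi_i|^{p_i-1})$ for $i=1,\dots,N$, with a constant $\gamma>0$ and positive functions $d_i\in L^{p_i'}(\Omega)$; (monotonicity) $(a(x,\xi)-a(x,\eta))\cdot(\xi-\eta)\ge 0$. Truncation. For $k>0$, $T_k(r)=\max(-k,\min(r,k))$. If $u:\Omega\to\mathbb{R}$ is measurable with $T_k(u)\in W^{1,\overrightarrow{p}}_0(\Omega)$ for all $k>0$, then $Du$ denotes the generalized gradient, i.e. the measurable function with $DT_k(u)=Du\,\chi_{\{|u|<k\}}$ a.e. for all $k>0$. Renormalized solution of $(E,f)$: a pair $(u,b)$ such that (R1) $u:\Omega\to\mathbb{R}$ is measurable, $b\in L^1(\Omega)$, $u(x)\in D(\beta)$ and $b(x)\in\beta(u(x))$ for a.e. $x\in\Omega$; (R2) $T_k(u)\in W^{1,\overrightarrow{p}}_0(\Omega)$ for each $k>0$, and $$\int_\Omega b\,h(u)\phi+\int_\Omega (a(x,Du)+F(u))\cdot D(h(u)\phi)=\int_\Omega f\,h(u)\phi$$ for all $h\in C^1_c(\mathbb{R})$ and all $\phi\in W^{1,\overrightarrow{p}}_0(\Omega)\cap L^\infty(\Omega)$; (R3) $\int_{\{k<|u|<k+1\}}a(x,Du)\cdot Du\to 0$ as $k\to\infty$. Weak solution of $(E,f)$: a pair $(u,b)\in W^{1,\overrightarrow{p}}_0(\Omega)\times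 L^1(\Omega)$ such that $F(u)\in (L^1_{loc}(\Omega))^N$, $b\in\beta(u)$ a.e. in $\Omega$, and $b-\operatorname{div}(a(x,Du)+F(u))=f$ in $\mathcal{D}'(\Omega)$. *)

theory Defs
  imports "HOL-Analysis.Analysis"
begin

text \<open>
  Functions on a domain \<open>\<Omega>\<close> are total functions on \<open>real ^ 'n\<close> whose values outside \<open>\<Omega>\<close> are never
  used. Measurability, integrals and "almost everywhere" refer to \<open>lebesgue_on \<Omega>\<close>; elements of
  function spaces are functions, not classes of functions equal almost everywhere.
\<close>

section \<open>Domains\<close>

text \<open>
  Near each boundary point, \<open>\<Omega>\<close> is, in suitable Cartesian coordinates, the strict epigraph of a
  Lipschitz function of the first \<open>N - 1\<close> variables. The last coordinate axis has direction \<open>v\<close>,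
  and the other coordinates are the orthogonal projection to the hyperplane \<open>v\<^sup>\<bottom>\<close>.
\<close>

definition lipschitz_boundary :: "(real ^ 'n) set \<Rightarrow> bool" where
  "lipschitz_boundary \<Omega> \<longleftrightarrow>
     (\<forall>z \<in> frontier \<Omega>. \<exists>v r L g. norm v = 1 \<and> 0 < r \<and> L-lipschitz_on {y. y \<bullet> v = 0} g \<and>
        \<Omega> \<inter> ball z r = {y \<in> ball z r. (g (y - (y \<bullet> v) *\<^sub>R v) :: real) < y \<bullet> v})"

definition bounded_domain :: "(real ^ 'n) set \<Rightarrow> bool" where
  "bounded_domain \<Omega> \<longleftrightarrow> open \<Omega> \<and> connected \<Omega> \<and> \<Omega> \<noteq> {} \<and> bounded \<Omega>"

section \<open>Test functions\<close>

definition partial_deriv :: "'n \<Rightarrow> (real ^ 'n \<Rightarrow> real) \<Rightarrow> real ^ 'n \<Rightarrow> real" where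
  "partial_deriv i \<phi> x = frechet_derivative \<phi> (at x) (axis i 1)"

definition gradient :: "(real ^ 'n \<Rightarrow> real) \<Rightarrow> real ^ 'n \<Rightarrow> real ^ 'n" where
  "gradient \<phi> x = (\<chi> i. partial_deriv i \<phi> x)"

text \<open>
  A function is of class \<open>C\<^sup>\<infinity>\<close> iff its iterated partial derivatives of all orders, itself included,
  are differentiable everywhere (hence also continuous).
\<close>

definition smooth :: "(real ^ 'n \<Rightarrow> real) \<Rightarrow> bool" where
  "smooth \<phi> \<longleftrightarrow> (\<forall>is. foldr partial_deriv is \<phi> differentiable_on UNIV)"

definition test_functions :: "(real ^ 'n) set \<Rightarrow> (real ^ 'n \<Rightarrow> real) set" where
  "test_functions \<Omega> =
     {\<phi>. smooth \<phi> \<and> compact (closure {x. \<phi> x \<noteq> 0}) \<and> closure {x. \<phi> x \<noteq> 0} \<subseteq> \<Omega>}"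

section \<open>Lebesgue and Sobolev spaces\<close>

definition L_space :: "(real ^ 'n) set \<Rightarrow> real \<Rightarrow> (real ^ 'n \<Rightarrow> real) set" where
  "L_space \<Omega> q = {u \<in> borel_measurable (lebesgue_on \<Omega>).
                    integrable (lebesgue_on \<Omega>) (\<lambda>x. \<bar>u x\<bar> powr q)}"

definition L_norm :: "(real ^ 'n) set \<Rightarrow> real \<Rightarrow> (real ^ 'n \<Rightarrow> real) \<Rightarrow> real" where
  "L_norm \<Omega> q u = (\<integral>x. \<bar>u x\<bar> powr q \<partial>lebesgue_on \<Omega>) powr (1 / q)"

definition L_infinity :: "(real ^ 'n) set \<Rightarrow> (real ^ 'n \<Rightarrow> real) set" where
  "L_infinity \<Omega> = {u \<in> borel_measurable (lebesgue_on \<Omega>).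
                     \<exists>C. AE x in lebesgue_on \<Omega>. \<bar>u x\<bar> \<le> C}"

definition L1_loc :: "(real ^ 'n) set \<Rightarrow> (real ^ 'n \<Rightarrow> real) set" where
  "L1_loc \<Omega> = {u. \<forall>K. compact K \<and> K \<subseteq> \<Omega> \<longrightarrow> integrable (lebesgue_on K) u}"

definition is_weak_gradient ::
  "(real ^ 'n) set \<Rightarrow> (real ^ 'n \<Rightarrow> real) \<Rightarrow> (real ^ 'n \<Rightarrow> real ^ 'n) \<Rightarrow> bool" where
  "is_weak_gradient \<Omega> u G \<longleftrightarrow>
     u \<in> L1_loc \<Omega> \<and> (\<forall>i. (\<lambda>x. G x $ i) \<in> L1_loc \<Omega>) \<and>
     (\<forall>\<phi> \<in> test_functions \<Omega>. \<forall>i.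
        (\<integral>x. u x * partial_deriv i \<phi> x \<partial>lebesgue_on \<Omega>) =
        - (\<integral>x. G x $ i * \<phi> x \<partial>lebesgue_on \<Omega>))"

text \<open>
  The weak gradient is unique up to null sets; the following picks a representative, and is
  meaningful only for \<open>u\<close> that has a weak gradient. Likewise for \<open>generalized_gradient\<close> below.
\<close>

definition weak_gradient ::
  "(real ^ 'n) set \<Rightarrow> (real ^ 'n \<Rightarrow> real) \<Rightarrow> real ^ 'n \<Rightarrow> real ^ 'n" where
  "weak_gradient \<Omega> u = (SOME G. is_weak_gradient \<Omega> u G)"

definition W11 :: "(real ^ 'n) set \<Rightarrow> (real ^ 'n \<Rightarrow> real) set" where
  "W11 \<Omega> = {u. u \<in> L_space \<Omega> 1 \<and>
              (\<exists>G. is_weak_gradient \<Omega> u G \<and> (\<forall>i. (\<lambda>x. G x $ i) \<in> L_space \<Omega> 1))}"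

definition W1p :: "(real ^ 'n) set \<Rightarrow> ('n \<Rightarrow> real) \<Rightarrow> (real ^ 'n \<Rightarrow> real) set" where
  "W1p \<Omega> p = {u \<in> W11 \<Omega>. \<forall>i. (\<lambda>x. weak_gradient \<Omega> u x $ i) \<in> L_space \<Omega> (p i)}"

definition W1p_norm :: "(real ^ 'n) set \<Rightarrow> ('n \<Rightarrow> real) \<Rightarrow> (real ^ 'n \<Rightarrow> real) \<Rightarrow> real" where
  "W1p_norm \<Omega> p u =
     L_norm \<Omega> 1 u + (\<Sum>i\<in>UNIV. L_norm \<Omega> (p i) (\<lambda>x. weak_gradient \<Omega> u x $ i))"

definition W1p_0 :: "(real ^ 'n) set \<Rightarrow> ('n \<Rightarrow> real) \<Rightarrow> (real ^ 'n \<Rightarrow> real) set" where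
  "W1p_0 \<Omega> p =
     {u \<in> W1p \<Omega> p. \<forall>e>0. \<exists>\<phi> \<in> test_functions \<Omega>. W1p_norm \<Omega> p (\<lambda>x. u x - \<phi> x) < e}"

definition trunc :: "real \<Rightarrow> real \<Rightarrow> real" where
  "trunc k r = max (- k) (min r k)"

definition generalized_gradient ::
  "(real ^ 'n) set \<Rightarrow> (real ^ 'n \<Rightarrow> real) \<Rightarrow> real ^ 'n \<Rightarrow> real ^ 'n" where
  "generalized_gradient \<Omega> u =
     (SOME G. G \<in> borel_measurable (lebesgue_on \<Omega>) \<and>
        (\<forall>k>0. AE x in lebesgue_on \<Omega>.
           weak_gradient \<Omega> (\<lambda>y. trunc k (u y)) x = (if \<bar>u x\<bar> < k then G x else 0)))"

section \<open>The data of the problem\<close>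

definition locally_lipschitz :: "(real \<Rightarrow> real ^ 'n) \<Rightarrow> bool" where
  "locally_lipschitz F \<longleftrightarrow> (\<forall>r. \<exists>e>0. \<exists>L. L-lipschitz_on (cball r e) F)"

definition monotone_graph :: "(real \<Rightarrow> real set) \<Rightarrow> bool" where
  "monotone_graph \<beta> \<longleftrightarrow> (\<forall>r s. \<forall>x \<in> \<beta> r. \<forall>y \<in> \<beta> s. 0 \<le> (x - y) * (r - s))"

definition maximal_monotone :: "(real \<Rightarrow> real set) \<Rightarrow> bool" where
  "maximal_monotone \<beta> \<longleftrightarrow>
     monotone_graph \<beta> \<and> (\<forall>\<gamma>. monotone_graph \<gamma> \<and> (\<forall>r. \<beta> r \<subseteq> \<gamma> r) \<longrightarrow> \<gamma> = \<beta>)"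

definition dom_graph :: "(real \<Rightarrow> real set) \<Rightarrow> real set" where
  "dom_graph \<beta> = {r. \<beta> r \<noteq> {}}"

definition caratheodory ::
  "(real ^ 'n) set \<Rightarrow> (real ^ 'n \<Rightarrow> real ^ 'n \<Rightarrow> real ^ 'n) \<Rightarrow> bool" where
  "caratheodory \<Omega> a \<longleftrightarrow>
     (\<forall>\<xi>. (\<lambda>x. a x \<xi>) \<in> borel_measurable (lebesgue_on \<Omega>)) \<and>
     (AE x in lebesgue_on \<Omega>. continuous_on UNIV (a x))"

definition C1_compact :: "(real \<Rightarrow> real) set" where
  "C1_compact = {h. h C1_differentiable_on UNIV \<and> compact (closure {r. h r \<noteq> 0})}"

section \<open>Notions of solution of \<open>\<beta>(u) - div (a(x,Du) + F(u)) \<ni> f\<close>, \<open>u = 0\<close> on the boundary\<close>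

definition renormalized_solution ::
  "(real ^ 'n) set \<Rightarrow> ('n \<Rightarrow> real) \<Rightarrow> (real \<Rightarrow> real set) \<Rightarrow>
   (real ^ 'n \<Rightarrow> real ^ 'n \<Rightarrow> real ^ 'n) \<Rightarrow> (real \<Rightarrow> real ^ 'n) \<Rightarrow> (real ^ 'n \<Rightarrow> real) \<Rightarrow>
   (real ^ 'n \<Rightarrow> real) \<Rightarrow> (real ^ 'n \<Rightarrow> real) \<Rightarrow> bool" where
  "renormalized_solution \<Omega> p \<beta> a F f u b \<longleftrightarrow>
     u \<in> borel_measurable (lebesgue_on \<Omega>) \<and> b \<in> L_space \<Omega> 1 \<and>
     (AE x in lebesgue_on \<Omega>. u x \<in> dom_graph \<beta> \<and> b x \<in> \<beta> (u x)) \<and>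
     (\<forall>k>0. (\<lambda>x. trunc k (u x)) \<in> W1p_0 \<Omega> p) \<and>
     (\<forall>h \<in> C1_compact. \<forall>\<phi> \<in> W1p_0 \<Omega> p \<inter> L_infinity \<Omega>.
        (\<integral>x. b x * h (u x) * \<phi> x \<partial>lebesgue_on \<Omega>)
        + (\<integral>x. (a x (generalized_gradient \<Omega> u x) + F (u x)) \<bullet>
               weak_gradient \<Omega> (\<lambda>y. h (u y) * \<phi> y) x \<partial>lebesgue_on \<Omega>)
        = (\<integral>x. f x * h (u x) * \<phi> x \<partial>lebesgue_on \<Omega>)) \<and>
     ((\<lambda>k. LINT x : {x \<in> \<Omega>. k < \<bar>u x\<bar> \<and> \<bar>u x\<bar> < k + 1} | lebesgue_on \<Omega>.
             a x (generalized_gradient \<Omega> u x) \<bullet> generalized_gradient \<Omega> u x)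
        \<longlongrightarrow> 0) at_top"

definition weak_solution ::
  "(real ^ 'n) set \<Rightarrow> ('n \<Rightarrow> real) \<Rightarrow> (real \<Rightarrow> real set) \<Rightarrow>
   (real ^ 'n \<Rightarrow> real ^ 'n \<Rightarrow> real ^ 'n) \<Rightarrow> (real \<Rightarrow> real ^ 'n) \<Rightarrow> (real ^ 'n \<Rightarrow> real) \<Rightarrow>
   (real ^ 'n \<Rightarrow> real) \<Rightarrow> (real ^ 'n \<Rightarrow> real) \<Rightarrow> bool" where
  "weak_solution \<Omega> p \<beta> a F f u b \<longleftrightarrow>
     u \<in> W1p_0 \<Omega> p \<and> b \<in> L_space \<Omega> 1 \<and>
     (\<forall>i. (\<lambda>x. F (u x) $ i) \<in> L1_loc \<Omega>) \<and>
     (AE x in lebesgue_on \<Omega>. b x \<in> \<beta> (u x)) \<and>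
     (\<forall>\<phi> \<in> test_functions \<Omega>.
        (\<integral>x. b x * \<phi> x \<partial>lebesgue_on \<Omega>)
        + (\<integral>x. (a x (weak_gradient \<Omega> u x) + F (u x)) \<bullet> gradient \<phi> x \<partial>lebesgue_on \<Omega>)
        = (\<integral>x. f x * \<phi> x \<partial>lebesgue_on \<Omega>))"

end

theory Submission
  imports Defs "HOL-Computational_Algebra.Polynomial"
begin

text \<open>
  A renormalized solution \<open>u\<close> for bounded data \<open>f\<close> is bounded, and this is the whole content:
  once it is known, a cut-off \<open>h\<close> that equals 1 on the range of \<open>u\<close> turns the renormalized
  equation into the weak one, and \<open>u\<close> belongs to \<open>W1p_0 \<Omega> p\<close> because it is almost everywhere
  equal to its truncation at a high level.

  For the bound, the equation is tested with \<open>h = 1\<close> up to a level \<open>j\<close> and \<open>\<phi> = \<psi> \<circ> u\<close>, where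
  \<open>\<psi>\<close> is a smooth nondecreasing function that is constant near \<open>\<infinity>\<close> and near \<open>-\<infinity>\<close>, with
  \<open>\<psi> 0 = 0\<close>. The term with \<open>b\<close> is nonnegative by monotonicity of \<open>\<beta>\<close>. The convection term
  \<open>F \<circ> u\<close> integrates to 0, being a sum of partial derivatives of functions with zero boundary
  values. The term with \<open>h'\<close> is bounded by a multiple of the energy between the levels \<open>j\<close> and
  \<open>j + 1\<close>, which tends to 0 as \<open>j \<rightarrow> \<infinity>\<close>. What remains, by coercivity (\<open>gradient_estimate\<close>), is a
  bound of the \<open>p i\<close>-th power integrals of the gradient of \<open>\<psi> \<circ> u\<close> by a multiple of the
  integral of \<open>\<bar>\<psi> \<circ> u\<bar>\<close>. Now let \<open>\<psi>\<close> step up between two levels \<open>k < l\<close>. A Poincare inequality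
  whose constant \<open>\<delta>\<close> is of the order of the \<open>N\<close>-th root of the measure of \<open>{k < \<bar>u\<bar>}\<close>
  (\<open>W1p_0_gradient_poincare_small_support\<close>) gives, for \<open>k\<close> large, that \<open>l - k\<close> times the
  measure of \<open>{l < \<bar>u\<bar>}\<close> is at most a constant times \<open>\<delta>\<close> times the measure of \<open>{k < \<bar>u\<bar>}\<close>
  (\<open>level_decay\<close>). De Giorgi's iteration over levels that approach \<open>n0 + 1\<close> shows that
  \<open>\<bar>u\<bar> \<le> n0 + 1\<close> almost everywhere (\<open>u_bounded\<close>).

  All facts about \<open>W1p_0\<close> that this needs are proved for test functions and pass to the limit.
  The integral identities and estimates for test functions are consequences of the translation
  invariance of Lebesgue measure, applied to difference quotients: integration by parts, and
  the bound of the integral of \<open>\<bar>w (x + h) - w x\<bar>\<close> by the derivatives, from which the Poincare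
  inequality follows by averaging over \<open>h\<close> in a small cube. The chain rule is proved for smooth
  functions of one variable; truncations, which define the generalized gradient, are reached as
  limits (\<open>trunc_weak_gradient\<close>). Since weak gradients are selected by a choice operator, their
  uniqueness is needed throughout; it rests on the fundamental lemma of the calculus of
  variations.
\<close>

section \<open>Smooth functions of one variable\<close>

text \<open>
  A function is \<open>C\<^sup>\<infinity>\<close> iff it has a \<open>C\<^sup>\<infinity>\<close> derivative. Read coinductively, this determines the notion
  without mentioning derivatives of higher order: a family of functions that is closed under
  differentiation consists of smooth functions.
\<close>

coinductive smooth_real :: "(real \<Rightarrow> real) \<Rightarrow> bool" where
  smooth_realI: "(\<And>x. (g has_real_derivative g' x) (at x)) \<Longrightarrow> smooth_real g' \<Longrightarrow> smooth_real g"

lemma smooth_realE: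
  assumes "smooth_real g"
  obtains g' where "\<And>x. (g has_real_derivative g' x) (at x)" "smooth_real g'"
  using assms by cases (auto intro: that)

lemma smooth_real_deriv:
  assumes "smooth_real g" "\<And>x. (g has_real_derivative g' x) (at x)"
  shows "smooth_real g'"
proof -
  obtain k where k: "\<And>x. (g has_real_derivative k x) (at x)" "smooth_real k"
    using assms(1) by (rule smooth_realE) auto
  have "g' = k"
    using DERIV_unique[OF assms(2) k(1)] by auto
  then show ?thesis using k by simp
qed

text \<open>
  The derivative of a product is a sum of products and that of a composition a product of
  compositions, so that no single operation gives a family closed under differentiation. All three
  together do.
\<close>

inductive smooth_real_closure :: "(real \<Rightarrow> real) \<Rightarrow> bool" where
  base: "smooth_real f \<Longrightarrow> smooth_real_closure f"
| add: "smooth_real_closure f \<Longrightarrow> smooth_real_closure g \<Longrightarrow> smooth_real_closure (\<lambda>x. f x + g x)"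
| mult: "smooth_real_closure f \<Longrightarrow> smooth_real_closure g \<Longrightarrow> smooth_real_closure (\<lambda>x. f x * g x)"
| comp: "smooth_real f \<Longrightarrow> smooth_real_closure g \<Longrightarrow> smooth_real_closure (\<lambda>x. f (g x))"

lemma smooth_real_closure_derivative:
  assumes "smooth_real_closure f"
  shows "\<exists>f'. (\<forall>x. (f has_real_derivative f' x) (at x)) \<and> smooth_real_closure f'"
  using assms
proof induction
  case (base f)
  then show ?case by (meson smooth_realE smooth_real_closure.base)
next
  case (add f g)
  then obtain f' g' where "\<And>x. (f has_real_derivative f' x) (at x)" "smooth_real_closure f'"
     "\<And>x. (g has_real_derivative g' x) (at x)" "smooth_real_closure g'" by blast
  then show ?case
    by (intro exI[of _ "\<lambda>x. f' x + g' x"])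
      (auto intro!: derivative_intros smooth_real_closure.add)
next
  case (mult f g)
  then obtain f' g' where "\<And>x. (f has_real_derivative f' x) (at x)" "smooth_real_closure f'"
     "\<And>x. (g has_real_derivative g' x) (at x)" "smooth_real_closure g'" by blast
  with mult.hyps show ?case
    by (intro exI[of _ "\<lambda>x. f' x * g x + g' x * f x"])
      (auto intro!: derivative_eq_intros intro: smooth_real_closure.intros)
next
  case (comp f g)
  obtain f' where f': "\<And>x. (f has_real_derivative f' x) (at x)" "smooth_real f'"
    using comp.hyps(1) by (rule smooth_realE) auto
  obtain g' where g': "\<And>x. (g has_real_derivative g' x) (at x)" "smooth_real_closure g'"
    using comp by blast
  with comp.hyps f' show ?case
    using DERIV_chain2[of f "f' (g x)" g x "g' x" UNIV for x]
    by (intro exI[of _ "\<lambda>x. f' (g x) * g' x"]) (auto intro: smooth_real_closure.intros)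
qed

lemma smooth_real_closure_imp_smooth: "smooth_real_closure f \<Longrightarrow> smooth_real f"
proof (coinduction arbitrary: f rule: smooth_real.coinduct)
  case (smooth_real f)
  then show ?case using smooth_real_closure_derivative[of f] by blast
qed

lemma smooth_real_add: "smooth_real f \<Longrightarrow> smooth_real g \<Longrightarrow> smooth_real (\<lambda>x. f x + g x)"
  and smooth_real_mult: "smooth_real f \<Longrightarrow> smooth_real g \<Longrightarrow> smooth_real (\<lambda>x. f x * g x)"
  and smooth_real_compose: "smooth_real f \<Longrightarrow> smooth_real g \<Longrightarrow> smooth_real (\<lambda>x. f (g x))"
  by (auto intro!: smooth_real_closure_imp_smooth intro: smooth_real_closure.intros)

lemma smooth_real_const: "smooth_real (\<lambda>x. c)"
  by (coinduction arbitrary: c rule: smooth_real.coinduct) (auto intro!: exI[of _ "\<lambda>_. 0"])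

lemma smooth_real_ident: "smooth_real (\<lambda>x. x)"
  by (rule smooth_realI[of _ "\<lambda>_. 1"]) (auto intro: smooth_real_const)

lemma smooth_real_exp: "smooth_real exp"
  by (coinduction rule: smooth_real.coinduct) (auto intro!: exI[of _ exp])

lemma smooth_real_minus: "smooth_real f \<Longrightarrow> smooth_real (\<lambda>x. - f x)"
  using smooth_real_mult[OF smooth_real_const[of "-1"]] by simp

lemma smooth_real_diff: "smooth_real f \<Longrightarrow> smooth_real g \<Longrightarrow> smooth_real (\<lambda>x. f x - g x)"
  using smooth_real_add[OF _ smooth_real_minus] by simp

lemmas smooth_real_intros = smooth_real_const smooth_real_ident smooth_real_minus
  smooth_real_add smooth_real_diff smooth_real_mult

lemma smooth_real_antiderivative:
  assumes "\<And>x. isCont f x"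
  obtains g :: "real \<Rightarrow> real" where "\<And>x. (g has_real_derivative f x) (at x)" "g 0 = 0"
proof -
  obtain G where G: "\<And>x. (G has_vector_derivative f x) (at x)"
    using einterval_antiderivative[of "-\<infinity>" "\<infinity>" f] assms by auto
  have "((\<lambda>x. G x - G 0) has_real_derivative f x) (at x)" for x
    using G[of x] by (auto simp: has_real_derivative_iff_has_vector_derivative intro!: derivative_eq_intros)
  then show ?thesis using that[of "\<lambda>x. G x - G 0"] by simp
qed

lemma smooth_real_continuous: "smooth_real f \<Longrightarrow> continuous_on S f"
  by (metis DERIV_isCont continuous_at_imp_continuous_on smooth_realE)

text \<open>
  Cauchy's flat function \<open>exp (- 1 / x)\<close>, with a polynomial in \<open>1 / x\<close> as a factor: differentiation
  stays within this family, and that makes all its members smooth.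
\<close>

definition flat_with :: "real poly \<Rightarrow> real \<Rightarrow> real" where
  "flat_with P x = (if 0 < x then poly P (1 / x) * exp (- (1 / x)) else 0)"

lemma poly_over_exp_tendsto_0: "((\<lambda>x::real. poly P x * exp (- x)) \<longlongrightarrow> 0) at_top"
proof -
  have "((\<lambda>x. \<Sum>i\<le>degree P. coeff P i * (x ^ i / exp x)) \<longlongrightarrow> (\<Sum>i\<le>degree P. coeff P i * 0)) at_top"
    by (intro tendsto_sum tendsto_mult tendsto_const tendsto_power_div_exp_0)
  then show ?thesis
    by (simp add: poly_altdef sum_distrib_right exp_minus divide_inverse mult.assoc)
qed

lemma flat_with_deriv:
  "(flat_with P has_real_derivative flat_with ([:0, 0, 1:] * (P - pderiv P)) x) (at x)"
proof -
  consider "0 < x" | "x < 0" | "x = 0" by linarith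
  then show ?thesis
  proof cases
    case 1
    have inv: "((\<lambda>x. 1 / x) has_real_derivative - (1 / x\<^sup>2)) (at x)"
      using 1 by (auto intro!: derivative_eq_intros simp: power2_eq_square)
    have "((\<lambda>x. poly P (1 / x) * exp (- (1 / x))) has_real_derivative
        (poly (pderiv P) (1 / x) * - (1 / x\<^sup>2)) * exp (- (1 / x))
        + (exp (- (1 / x)) * - (- (1 / x\<^sup>2))) * poly P (1 / x)) (at x)"
      by (intro DERIV_mult DERIV_chain2[OF poly_DERIV inv]
          DERIV_chain2[OF DERIV_exp DERIV_minus[OF inv]])
    also have "(poly (pderiv P) (1 / x) * - (1 / x\<^sup>2)) * exp (- (1 / x))
        + (exp (- (1 / x)) * - (- (1 / x\<^sup>2))) * poly P (1 / x)
        = flat_with ([:0, 0, 1:] * (P - pderiv P)) x"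
      using 1 by (simp add: flat_with_def algebra_simps power2_eq_square)
    finally have "((\<lambda>x. poly P (1 / x) * exp (- (1 / x))) has_real_derivative
        flat_with ([:0, 0, 1:] * (P - pderiv P)) x) (at x)" .
    then show ?thesis
      by (rule has_field_derivative_transform_within_open[of _ _ _ "{0<..}"])
        (use 1 in \<open>auto simp: flat_with_def\<close>)
  next
    case 2
    have "((\<lambda>x. 0) has_real_derivative flat_with ([:0, 0, 1:] * (P - pderiv P)) x) (at x)"
      using 2 by (auto simp: flat_with_def)
    then show ?thesis
      by (rule has_field_derivative_transform_within_open[of _ _ _ "{..<0}"])
        (use 2 in \<open>auto simp: flat_with_def\<close>)
  next
    case 3
    have "((\<lambda>y. poly ([:0, 1:] * P) (1/y) * exp (- (1/y))) \<longlongrightarrow> 0) (at_right 0)"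
      by (rule filterlim_compose[OF poly_over_exp_tendsto_0])
        (simp add: filterlim_inverse_at_top_right inverse_eq_divide[symmetric])
    then have r: "((\<lambda>y. (flat_with P y - flat_with P 0) / (y - 0)) \<longlongrightarrow> 0) (at_right 0)"
      by (rule Lim_transform_eventually)
        (auto simp: eventually_at_filter flat_with_def)
    have l: "((\<lambda>y. (flat_with P y - flat_with P 0) / (y - 0)) \<longlongrightarrow> 0) (at_left 0)"
      by (rule Lim_transform_eventually[OF tendsto_const])
        (auto simp: eventually_at_filter flat_with_def)
    show ?thesis
      using filterlim_split_at[OF l r] 3
      by (simp add: has_field_derivative_iff flat_with_def)
  qed
qed

definition flat :: "real \<Rightarrow> real" where
  "flat x = (if 0 < x then exp (- (1 / x)) else 0)"

lemma smooth_real_flat: "smooth_real flat"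
proof -
  have "smooth_real (flat_with P)" for P
    by (coinduction arbitrary: P rule: smooth_real.coinduct) (use flat_with_deriv in blast)
  from this[of 1] show ?thesis
    by (simp add: flat_with_def[abs_def] flat_def[abs_def] cong: if_cong)
qed

lemma flat_pos_iff: "0 < flat x \<longleftrightarrow> 0 < x"
  and flat_nonneg: "0 \<le> flat x" and flat_le_1: "flat x \<le> 1"
  by (auto simp: flat_def)

text \<open>
  The source of all cut-offs below: an antiderivative of \<open>flat x * flat (1 - x)\<close>. Its height \<open>c\<close> is
  not normalized to 1, in order to have the bound 1 for the derivative.
\<close>

lemma smooth_step_exists:
  obtains S S' :: "real \<Rightarrow> real" and c :: real where
    "smooth_real S" "smooth_real S'" "\<And>x. (S has_real_derivative S' x) (at x)" "0 < c"
    "\<And>x. x \<le> 0 \<Longrightarrow> S x = 0" "\<And>x. 1 \<le> x \<Longrightarrow> S x = c" "\<And>x. 0 \<le> S x" "\<And>x. S x \<le> c"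
    "\<And>x. 0 \<le> S' x" "\<And>x. S' x \<le> 1" "\<And>x. x \<le> 0 \<or> 1 \<le> x \<Longrightarrow> S' x = 0"
proof -
  define S' where "S' x = flat x * flat (1 - x)" for x
  have smooth': "smooth_real S'"
    unfolding S'_def [abs_def]
    by (intro smooth_real_intros smooth_real_flat smooth_real_compose[OF smooth_real_flat])
  have "isCont S' x" for x
    using smooth_real_continuous[OF smooth', of UNIV] by (simp add: continuous_on_eq_continuous_at)
  then obtain S where S: "\<And>x. (S has_real_derivative S' x) (at x)" "S 0 = 0"
    using smooth_real_antiderivative by blast
  have pos: "0 \<le> S' x" "S' x \<le> 1" for x
    by (auto simp: S'_def flat_nonneg flat_le_1 intro: mult_le_one)
  have zero: "S' x = 0" if "x \<le> 0 \<or> 1 \<le> x" for x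
    using that by (auto simp: S'_def flat_def)
  have mono: "x \<le> y \<Longrightarrow> S x \<le> S y" for x y
    by (rule DERIV_nonneg_imp_nondecreasing) (use S pos in auto)
  have noninc: "S y \<le> S x" if "x \<le> y" "y \<le> 0 \<or> 1 \<le> x" for x y
    using that(1)
  proof (rule DERIV_nonpos_imp_nonincreasing)
    fix z assume "x \<le> z" "z \<le> y"
    then have "S' z = 0" using that by (intro zero) auto
    then show "\<exists>d. (S has_real_derivative d) (at z) \<and> d \<le> 0"
      using S(1)[of z] by auto
  qed
  have low: "S x = 0" if "x \<le> 0" for x
    using mono[of x 0] noninc[of x 0] that S(2) by auto
  have high: "S x = S 1" if "1 \<le> x" for x
    using mono[of 1 x] noninc[of 1 x] that by auto
  obtain z where z: "0 < z" "z < 1" "S 1 - S 0 = (1 - 0) * S' z"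
    using MVT2[of 0 1 S S'] S(1) by auto
  then have "0 < S 1"
    using S(2) by (simp add: S'_def flat_pos_iff)
  moreover have "0 \<le> S x" for x
    using mono[of 0 x] low[of x] S(2) by (cases "0 \<le> x") auto
  moreover have "S x \<le> S 1" for x
    using mono[of x 1] high[of x] by (cases "x \<le> 1") auto
  ultimately show ?thesis
    using smooth_realI[OF S(1) smooth'] smooth' S(1) pos low high zero
    by (intro that[of S S' "S 1"])
qed

section \<open>Smooth functions of several variables\<close>

lemma differentiable_on_UNIV_smooth: "smooth \<phi> \<Longrightarrow> \<phi> differentiable (at x)"
  unfolding smooth_def differentiable_on_def by (drule spec[of _ "[]"]) auto

lemma smooth_partial_deriv: "smooth \<phi> \<Longrightarrow> smooth (partial_deriv i \<phi>)"
  unfolding smooth_def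
proof
  fix js assume *: "\<forall>is. foldr partial_deriv is \<phi> differentiable_on UNIV"
  show "foldr partial_deriv js (partial_deriv i \<phi>) differentiable_on UNIV"
    using *[rule_format, of "js @ [i]"] by simp
qed

text \<open>
  As in one variable, smoothness follows from closure under differentiation.
\<close>

lemma smooth_coinduct:
  fixes \<phi> :: "real ^ 'n \<Rightarrow> real"
  assumes "X \<phi>"
    and "\<And>\<phi>. X \<phi> \<Longrightarrow> \<phi> differentiable_on UNIV \<and> (\<forall>i. X (partial_deriv i \<phi>))"
  shows "smooth \<phi>"
proof -
  have "foldr partial_deriv is \<phi> differentiable_on UNIV" if "X \<phi>" for "is" and \<phi> :: "real ^ 'n \<Rightarrow> real"
    using that by (induction "is" arbitrary: \<phi> rule: rev_induct) (use assms(2) in auto)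
  then show ?thesis using assms(1) unfolding smooth_def by blast
qed

lemma partial_deriv_eqI:
  "(\<phi> has_derivative \<phi>') (at x) \<Longrightarrow> partial_deriv i \<phi> x = \<phi>' (axis i 1)"
  unfolding partial_deriv_def by (metis frechet_derivative_at)

lemma smooth_has_derivative:
  "smooth \<phi> \<Longrightarrow> (\<phi> has_derivative frechet_derivative \<phi> (at x)) (at x)"
  using differentiable_on_UNIV_smooth frechet_derivative_works by blast

lemma partial_deriv_compose:
  assumes "\<phi> differentiable (at x)" "(g has_real_derivative g') (at (\<phi> x))"
  shows "partial_deriv i (\<lambda>x. g (\<phi> x)) x = g' * partial_deriv i \<phi> x"
proof -
  have "((\<lambda>x. g (\<phi> x)) has_derivative (\<lambda>h. g' * frechet_derivative \<phi> (at x) h)) (at x)"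
    using assms(2)[unfolded has_field_derivative_def] frechet_derivative_works[THEN iffD1, OF assms(1)]
    by (rule has_derivative_compose[rotated])
  from partial_deriv_eqI[OF this] show ?thesis by (simp add: partial_deriv_def)
qed

lemma partial_deriv_add:
  assumes "\<phi> differentiable (at x)" "\<psi> differentiable (at x)"
  shows "partial_deriv i (\<lambda>x. \<phi> x + \<psi> x) x = partial_deriv i \<phi> x + partial_deriv i \<psi> x"
  using assms by (subst partial_deriv_eqI[OF has_derivative_add])
    (auto simp: frechet_derivative_works partial_deriv_def)

lemma partial_deriv_mult:
  assumes "\<phi> differentiable (at x)" "\<psi> differentiable (at x)"
  shows "partial_deriv i (\<lambda>x. \<phi> x * \<psi> x) x = partial_deriv i \<phi> x * \<psi> x + \<phi> x * partial_deriv i \<psi> x"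
  using assms by (subst partial_deriv_eqI[OF has_derivative_mult])
    (auto simp: frechet_derivative_works partial_deriv_def)

inductive smooth_closure :: "(real ^ 'n \<Rightarrow> real) \<Rightarrow> bool" where
  base: "smooth \<phi> \<Longrightarrow> smooth_closure \<phi>"
| add: "smooth_closure \<phi> \<Longrightarrow> smooth_closure \<psi> \<Longrightarrow> smooth_closure (\<lambda>x. \<phi> x + \<psi> x)"
| mult: "smooth_closure \<phi> \<Longrightarrow> smooth_closure \<psi> \<Longrightarrow> smooth_closure (\<lambda>x. \<phi> x * \<psi> x)"
| comp: "smooth_real g \<Longrightarrow> smooth_closure \<phi> \<Longrightarrow> smooth_closure (\<lambda>x. g (\<phi> x))"

lemma smooth_closure_derivative:
  assumes "smooth_closure \<phi>"
  shows "\<phi> differentiable_on UNIV \<and> (\<forall>i. smooth_closure (partial_deriv i \<phi>))"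
  using assms
proof induction
  case (base \<phi>)
  then show ?case
    by (auto simp: differentiable_on_def differentiable_on_UNIV_smooth
        intro: smooth_closure.base smooth_partial_deriv)
next
  case (add \<phi> \<psi>)
  then have d: "\<phi> differentiable (at x)" "\<psi> differentiable (at x)" for x
    by (auto simp: differentiable_on_def)
  have "partial_deriv i (\<lambda>x. \<phi> x + \<psi> x) = (\<lambda>x. partial_deriv i \<phi> x + partial_deriv i \<psi> x)" for i
    using partial_deriv_add[OF d] by blast
  then show ?case
    using add d by (auto simp: differentiable_on_def intro: differentiable_add smooth_closure.add)
next
  case (mult \<phi> \<psi>)
  then have d: "\<phi> differentiable (at x)" "\<psi> differentiable (at x)" for x
    by (auto simp: differentiable_on_def)
  have "partial_deriv i (\<lambda>x. \<phi> x * \<psi> x)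
    = (\<lambda>x. partial_deriv i \<phi> x * \<psi> x + \<phi> x * partial_deriv i \<psi> x)" for i
    using partial_deriv_mult[OF d] by blast
  then show ?case
    using mult d
    by (auto simp: differentiable_on_def intro!: differentiable_mult smooth_closure.add smooth_closure.mult)
next
  case (comp g \<phi>)
  then have d: "\<phi> differentiable (at x)" for x
    by (auto simp: differentiable_on_def)
  obtain g' where g': "\<And>x. (g has_real_derivative g' x) (at x)" "smooth_real g'"
    using comp.hyps(1) by (rule smooth_realE) auto
  have "partial_deriv i (\<lambda>x. g (\<phi> x)) = (\<lambda>x. g' (\<phi> x) * partial_deriv i \<phi> x)" for i
    using partial_deriv_compose[OF d g'(1)] by blast
  moreover have "(\<lambda>x. g (\<phi> x)) differentiable (at x)" for x
    using frechet_derivative_works[THEN iffD1, OF d] g'(1)[unfolded has_field_derivative_def]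
    by (intro differentiableI[OF has_derivative_compose])
  ultimately show ?case
    using comp g' smooth_closure.comp[OF g'(2)]
    by (auto simp: differentiable_on_def intro!: smooth_closure.mult)
qed

lemma smooth_closure_imp_smooth: "smooth_closure \<phi> \<Longrightarrow> smooth \<phi>"
  by (rule smooth_coinduct[of smooth_closure]) (auto dest: smooth_closure_derivative)

lemma smooth_add: "smooth \<phi> \<Longrightarrow> smooth \<psi> \<Longrightarrow> smooth (\<lambda>x. \<phi> x + \<psi> x)"
  and smooth_mult: "smooth \<phi> \<Longrightarrow> smooth \<psi> \<Longrightarrow> smooth (\<lambda>x. \<phi> x * \<psi> x)"
  and smooth_compose: "smooth_real g \<Longrightarrow> smooth \<phi> \<Longrightarrow> smooth (\<lambda>x. g (\<phi> x))"
  by (auto intro!: smooth_closure_imp_smooth intro: smooth_closure.intros)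

lemma partial_deriv_const: "partial_deriv i (\<lambda>x. c) = (\<lambda>x. 0)"
  by (simp add: partial_deriv_def[abs_def])

lemma smooth_const: "smooth (\<lambda>x. c)"
  by (rule smooth_coinduct[of "\<lambda>\<phi>. \<exists>c. \<phi> = (\<lambda>x. c)"]) (auto simp: partial_deriv_const)

lemma smooth_component: "smooth (\<lambda>x. x $ i)"
proof (rule smooth_coinduct[of "\<lambda>\<phi>. \<phi> = (\<lambda>x. x $ i) \<or> (\<exists>c. \<phi> = (\<lambda>x. c))"])
  fix \<phi> :: "real ^ 'a \<Rightarrow> real"
  assume X: "\<phi> = (\<lambda>x. x $ i) \<or> (\<exists>c. \<phi> = (\<lambda>x. c))"
  have d: "((\<lambda>x. x $ i) has_derivative (\<lambda>x. x $ i)) (at x)" for x :: "real ^ 'a"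
    by (intro bounded_linear_imp_has_derivative bounded_linear_vec_nth)
  have p: "partial_deriv j (\<lambda>x::real ^ 'a. x $ i) = (\<lambda>x. axis j 1 $ i)" for j
    using partial_deriv_eqI[OF d] by blast
  have "(\<lambda>x::real ^ 'a. x $ i) differentiable_on UNIV"
    using d by (auto simp: differentiable_on_def intro: differentiableI)
  then show "\<phi> differentiable_on UNIV \<and>
      (\<forall>j. partial_deriv j \<phi> = (\<lambda>x. x $ i) \<or> (\<exists>c. partial_deriv j \<phi> = (\<lambda>x. c)))"
    using X p by (metis partial_deriv_const differentiable_on_const)
qed auto

lemma smooth_prod: "finite I \<Longrightarrow> (\<And>i. i \<in> I \<Longrightarrow> smooth (\<phi> i)) \<Longrightarrow> smooth (\<lambda>x. \<Prod>i\<in>I. \<phi> i x)"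
  by (induction I rule: finite_induct) (auto intro!: smooth_const smooth_mult)

lemma smooth_continuous_on: "smooth \<phi> \<Longrightarrow> continuous_on S \<phi>"
  by (meson continuous_at_imp_continuous_on differentiable_imp_continuous_within
      differentiable_on_UNIV_smooth)

subsection \<open>Test functions\<close>

lemma test_functionsI:
  assumes "smooth \<phi>" "compact K" "K \<subseteq> \<Omega>" "\<And>x. x \<notin> K \<Longrightarrow> \<phi> x = 0"
  shows "\<phi> \<in> test_functions \<Omega>"
proof -
  have "closure {x. \<phi> x \<noteq> 0} \<subseteq> K"
    using assms by (intro closure_minimal) (auto simp: compact_imp_closed)
  then show ?thesis
    using assms compact_Int_closed[OF assms(2) closed_closure, of "{x. \<phi> x \<noteq> 0}"]
    by (simp add: test_functions_def Int_absorb1)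
qed

lemma test_functionsE:
  assumes "\<phi> \<in> test_functions \<Omega>"
  obtains K where "compact K" "K \<subseteq> \<Omega>" "\<And>x. x \<notin> K \<Longrightarrow> \<phi> x = 0"
    "\<And>x i. x \<notin> K \<Longrightarrow> partial_deriv i \<phi> x = 0"
proof
  let ?K = "closure {x. \<phi> x \<noteq> 0}"
  show "compact ?K" "?K \<subseteq> \<Omega>" using assms by (auto simp: test_functions_def)
  show "\<phi> x = 0" if "x \<notin> ?K" for x
    using that closure_subset[of "{x. \<phi> x \<noteq> 0}"] by auto
  show "partial_deriv i \<phi> x = 0" if "x \<notin> ?K" for x i
  proof -
    have "((\<lambda>x. 0::real) has_derivative (\<lambda>x. 0)) (at x)" by simp
    then have "(\<phi> has_derivative (\<lambda>x. 0)) (at x)"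
      by (rule has_derivative_transform_within_open[of _ _ _ _ "- ?K"])
        (use that closure_subset[of "{x. \<phi> x \<noteq> 0}"] in \<open>auto simp del: closure_closure\<close>)
    then show ?thesis by (simp add: partial_deriv_eqI)
  qed
qed

lemma test_functions_smooth: "\<phi> \<in> test_functions \<Omega> \<Longrightarrow> smooth \<phi>"
  by (simp add: test_functions_def)

lemma test_functions_mult:
  assumes "\<phi> \<in> test_functions \<Omega>" "smooth \<psi>"
  shows "(\<lambda>x. \<phi> x * \<psi> x) \<in> test_functions \<Omega>"
proof -
  obtain K where "compact K" "K \<subseteq> \<Omega>" "\<And>x. x \<notin> K \<Longrightarrow> \<phi> x = 0"
    using test_functionsE[OF assms(1)] by metis
  then show ?thesis
    using assms smooth_mult[OF test_functions_smooth[OF assms(1)]]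
    by (intro test_functionsI[of _ K]) auto
qed

lemma test_functions_compose:
  assumes "\<phi> \<in> test_functions \<Omega>" "smooth_real g" "g 0 = 0"
  shows "(\<lambda>x. g (\<phi> x)) \<in> test_functions \<Omega>"
proof -
  obtain K where "compact K" "K \<subseteq> \<Omega>" "\<And>x. x \<notin> K \<Longrightarrow> \<phi> x = 0"
    using test_functionsE[OF assms(1)] by metis
  then show ?thesis
    using assms smooth_compose[OF _ test_functions_smooth[OF assms(1)]]
    by (intro test_functionsI[of _ K]) auto
qed

lemma test_functions_bounded:
  assumes "\<phi> \<in> test_functions \<Omega>"
  obtains M where "\<And>x. \<bar>\<phi> x\<bar> \<le> M" "\<And>x i. \<bar>partial_deriv i \<phi> x\<bar> \<le> M"
proof -
  have bd: "\<exists>M. \<forall>x. \<bar>g x\<bar> \<le> M" if "smooth g" "compact K" "\<And>x. x \<notin> K \<Longrightarrow> g x = 0"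
    for g :: "real ^ 'a \<Rightarrow> real" and K
  proof -
    have "compact (g ` K)"
      using that by (intro compact_continuous_image smooth_continuous_on)
    then obtain M where "\<And>x. x \<in> K \<Longrightarrow> \<bar>g x\<bar> \<le> M"
      by (meson compact_imp_bounded bounded_real imageI)
    then show ?thesis
      using that(3) by (metis abs_ge_zero abs_zero max.coboundedI1 max.coboundedI2)
  qed
  obtain K where K: "compact K" "\<And>x. x \<notin> K \<Longrightarrow> \<phi> x = 0"
    "\<And>x i. x \<notin> K \<Longrightarrow> partial_deriv i \<phi> x = 0"
    using assms by (rule test_functionsE) auto
  have s: "smooth \<phi>" using assms by (rule test_functions_smooth)
  obtain M0 where M0: "\<And>x. \<bar>\<phi> x\<bar> \<le> M0" using bd[OF s K(1,2)] by blast
  have "\<forall>i. \<exists>M. \<forall>x. \<bar>partial_deriv i \<phi> x\<bar> \<le> M"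
    using bd[OF smooth_partial_deriv[OF s] K(1,3)] by blast
  then obtain M1 where M1: "\<And>i x. \<bar>partial_deriv i \<phi> x\<bar> \<le> M1 i" by metis
  have nn: "0 \<le> M0" "0 \<le> M1 i" for i
    using M0[of 0] M1[of i 0] by linarith+
  have "M1 i \<le> (\<Sum>i\<in>UNIV. M1 i)" for i
    by (rule member_le_sum) (use nn in auto)
  moreover have "0 \<le> (\<Sum>i\<in>UNIV. M1 i)"
    using nn by (intro sum_nonneg)
  ultimately have "\<bar>\<phi> x\<bar> \<le> M0 + (\<Sum>i\<in>UNIV. M1 i)" "\<bar>partial_deriv i \<phi> x\<bar> \<le> M0 + (\<Sum>i\<in>UNIV. M1 i)"
    for i x
    using M0[of x] M1[of i x] nn by (smt (verit, best))+
  then show ?thesis using that by blast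
qed

lemma frechet_derivative_eq_sum_partial_deriv:
  fixes \<phi> :: "real ^ 'n \<Rightarrow> real"
  assumes "\<phi> differentiable (at x)"
  shows "frechet_derivative \<phi> (at x) h = (\<Sum>i\<in>UNIV. h $ i * partial_deriv i \<phi> x)"
proof -
  interpret linear "frechet_derivative \<phi> (at x)"
    using assms by (rule linear_frechet_derivative)
  have "frechet_derivative \<phi> (at x) h = frechet_derivative \<phi> (at x) (\<Sum>i\<in>UNIV. h $ i *\<^sub>R axis i 1)"
    by (subst basis_expansion[symmetric, of h]) (simp add: scalar_mult_eq_scaleR)
  also have "\<dots> = (\<Sum>i\<in>UNIV. h $ i * partial_deriv i \<phi> x)"
    by (simp add: sum scale partial_deriv_def)
  finally show ?thesis .
qed

lemma test_functions_lipschitz: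
  assumes "\<phi> \<in> test_functions \<Omega>"
  obtains L where "L-lipschitz_on UNIV \<phi>"
proof -
  obtain M where M: "\<And>x. \<bar>\<phi> x\<bar> \<le> M" "\<And>x i. \<bar>partial_deriv i \<phi> x\<bar> \<le> M"
    using test_functions_bounded[OF assms] by blast
  have M0: "0 \<le> M" using M(1)[of 0] by linarith
  have "norm (\<phi> x - \<phi> y) \<le> (real CARD('a) * M) * norm (x - y)" for x y
  proof (rule differentiable_bound[of UNIV])
    show "(\<phi> has_derivative frechet_derivative \<phi> (at x)) (at x within UNIV)" for x
      using smooth_has_derivative[OF test_functions_smooth[OF assms]] by simp
    show "onorm (frechet_derivative \<phi> (at x)) \<le> real CARD('a) * M" for x
    proof (rule onorm_le)
      fix h
      have "norm (frechet_derivative \<phi> (at x) h) = \<bar>\<Sum>i\<in>UNIV. h $ i * partial_deriv i \<phi> x\<bar>"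
        by (simp add: frechet_derivative_eq_sum_partial_deriv
            differentiable_on_UNIV_smooth[OF test_functions_smooth[OF assms]])
      also have "\<dots> \<le> (\<Sum>i\<in>(UNIV::'a set). norm h * M)"
        by (rule order_trans[OF sum_abs sum_mono])
          (auto simp: abs_mult M component_le_norm_cart intro!: mult_mono)
      finally show "norm (frechet_derivative \<phi> (at x) h) \<le> real CARD('a) * M * norm h"
        by (simp add: algebra_simps)
    qed
  qed auto
  then have "(real CARD('a) * M)-lipschitz_on UNIV \<phi>"
    by (intro lipschitz_onI) (auto simp: dist_norm M0)
  then show ?thesis by (rule that)
qed

text \<open>
  A product of flat functions of the \<open>2 N\<close> distances to the sides.
\<close>

lemma box_bump_exists:
  fixes a b :: "real ^ 'n"
  obtains \<beta> where "smooth \<beta>" "\<And>x. 0 \<le> \<beta> x" "\<And>x. 0 < \<beta> x \<longleftrightarrow> x \<in> box a b"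
proof
  let ?\<beta> = "\<lambda>x. \<Prod>i\<in>UNIV. flat (x $ i + - a $ i) * flat (b $ i + - 1 * x $ i)"
  show "smooth ?\<beta>"
    by (intro smooth_prod smooth_mult smooth_compose[OF smooth_real_flat]
        smooth_add smooth_component smooth_const) simp
  show "0 \<le> ?\<beta> x" for x
    by (intro prod_nonneg mult_nonneg_nonneg flat_nonneg) 
  show "0 < ?\<beta> x \<longleftrightarrow> x \<in> box a b" for x
  proof
    assume "0 < ?\<beta> x"
    have "flat (x $ i + - a $ i) * flat (b $ i + - 1 * x $ i) \<noteq> 0" for i
    proof
      assume "flat (x $ i + - a $ i) * flat (b $ i + - 1 * x $ i) = 0"
      then have "?\<beta> x = 0"
        by (intro prod_zero bexI[of _ i]) auto
      with \<open>0 < ?\<beta> x\<close> show False by linarith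
    qed
    then have "0 < flat (x $ i + - a $ i)" "0 < flat (b $ i + - 1 * x $ i)" for i
      using flat_nonneg[of "x $ i + - a $ i"] flat_nonneg[of "b $ i + - 1 * x $ i"]
      by (metis mult_eq_0_iff order_less_le)+
    then show "x \<in> box a b"
      unfolding mem_box_cart flat_pos_iff by simp
  next
    assume "x \<in> box a b"
    then show "0 < ?\<beta> x"
      by (intro prod_pos) (auto simp: mem_box_cart flat_pos_iff)
  qed
qed

section \<open>Integration on a domain\<close>

lemma borel_measurable_cong_AE_lebesgue_on:
  fixes f g :: "'a::euclidean_space \<Rightarrow> real"
  assumes "S \<in> sets lebesgue" "AE x in lebesgue_on S. f x = g x" "f \<in> borel_measurable (lebesgue_on S)"
  shows "g \<in> borel_measurable (lebesgue_on S)"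
proof -
  have "AE x in lebesgue. x \<in> S \<longrightarrow> f x = g x"
    using assms by (simp add: AE_restrict_space_iff)
  then have ae: "AE x in lebesgue. (if x \<in> S then f x else 0) = (if x \<in> S then g x else 0)"
    by (rule AE_mp) auto
  have "(\<lambda>x. if x \<in> S then f x else 0) \<in> borel_measurable lebesgue"
    using assms by (simp add: borel_measurable_if)
  from borel_measurable_AE[OF this ae]
  have "(\<lambda>x. if x \<in> S then g x else 0) \<in> borel_measurable lebesgue" .
  then show ?thesis
    using assms(1) by (simp add: borel_measurable_if)
qed

text \<open>
  Lebesgue measure is complete, so that either both functions are measurable or both integrals are 0
  by convention. This form is made for weak gradients, about whose measurability the choice
  operator that picks them says nothing.
\<close>

lemma integrable_integral_cong_AE_lebesgue_on:
  fixes f g :: "'a::euclidean_space \<Rightarrow> real"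
  assumes S: "S \<in> sets lebesgue" and ae: "AE x in lebesgue_on S. f x = g x"
  shows "integrable (lebesgue_on S) f \<longleftrightarrow> integrable (lebesgue_on S) g"
    and "(\<integral>x. f x \<partial>lebesgue_on S) = (\<integral>x. g x \<partial>lebesgue_on S)"
proof -
  have ae': "AE x in lebesgue_on S. g x = f x" using ae by auto
  show 1: "integrable (lebesgue_on S) f \<longleftrightarrow> integrable (lebesgue_on S) g"
  proof
    assume "integrable (lebesgue_on S) f"
    then show "integrable (lebesgue_on S) g"
      using borel_measurable_cong_AE_lebesgue_on[OF S ae] ae by (auto intro: integrable_cong_AE_imp)
  next
    assume "integrable (lebesgue_on S) g"
    then show "integrable (lebesgue_on S) f"
      using borel_measurable_cong_AE_lebesgue_on[OF S ae'] ae' by (auto intro: integrable_cong_AE_imp)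
  qed
  show "(\<integral>x. f x \<partial>lebesgue_on S) = (\<integral>x. g x \<partial>lebesgue_on S)"
  proof (cases "integrable (lebesgue_on S) f")
    case True
    with 1 ae show ?thesis by (intro integral_cong_AE) auto
  next
    case False
    with 1 show ?thesis by (simp add: not_integrable_integral_eq)
  qed
qed

lemma lebesgue_on_vanishing_outside:
  fixes g :: "'a::euclidean_space \<Rightarrow> real"
  assumes "S \<in> sets lebesgue" "g \<in> borel_measurable borel" "\<And>x. x \<notin> S \<Longrightarrow> g x = 0"
  shows "integrable (lebesgue_on S) g \<longleftrightarrow> integrable lborel g"
    and "(\<integral>x. g x \<partial>lebesgue_on S) = (\<integral>x. g x \<partial>lborel)"
proof -
  have eq: "(\<lambda>x. if x \<in> S then g x else 0) = g" using assms(3) by auto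
  show "integrable (lebesgue_on S) g \<longleftrightarrow> integrable lborel g"
    using Lebesgue_Measure.integrable_restrict_UNIV[OF assms(1), of g, unfolded eq]
      integrable_completion[of g lborel] assms(2) by simp
  show "(\<integral>x. g x \<partial>lebesgue_on S) = (\<integral>x. g x \<partial>lborel)"
    using Lebesgue_Measure.integral_restrict_UNIV[OF assms(1), of g, unfolded eq]
      integral_completion[of g lborel] assms(2) by simp
qed

lemma lborel_translation:
  fixes f :: "'a::euclidean_space \<Rightarrow> real"
  assumes [measurable]: "f \<in> borel_measurable borel"
  shows "integrable lborel (\<lambda>x. f (x + h)) \<longleftrightarrow> integrable lborel f"
    and "(\<integral>x. f (x + h) \<partial>lborel) = (\<integral>x. f x \<partial>lborel)"
proof -
  have "integrable (distr lborel borel ((+) h)) f \<longleftrightarrow> integrable lborel (\<lambda>x. f (h + x))"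
    by (rule integrable_distr_eq) auto
  then show "integrable lborel (\<lambda>x. f (x + h)) \<longleftrightarrow> integrable lborel f"
    by (simp add: lborel_distr_plus add.commute)
  have "(\<integral>x. f x \<partial>distr lborel borel ((+) h)) = (\<integral>x. f (h + x) \<partial>lborel)"
    by (rule integral_distr) auto
  then show "(\<integral>x. f (x + h) \<partial>lborel) = (\<integral>x. f x \<partial>lborel)"
    by (simp add: lborel_distr_plus add.commute)
qed

subsection \<open>Difference quotients\<close>

lemma difference_quotient_tendsto:
  fixes w :: "real ^ 'n \<Rightarrow> real"
  assumes "w differentiable (at x)" "0 < t"
  shows "(\<lambda>n. (w (x + (t / Suc n) *\<^sub>R axis i 1) - w x) / (t / Suc n)) \<longlonglongrightarrow> partial_deriv i w x"
proof -
  let ?e = "axis i 1 :: real ^ 'n"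
  have line: "((\<lambda>s. x + s *\<^sub>R ?e) has_derivative (\<lambda>s. s *\<^sub>R ?e)) (at 0)"
    by (auto intro!: derivative_eq_intros)
  have "(w has_derivative frechet_derivative w (at x)) (at (x + 0 *\<^sub>R ?e))"
    using frechet_derivative_works[THEN iffD1, OF assms(1)] by simp
  from has_derivative_compose[OF line this]
  have "((\<lambda>s. w (x + s *\<^sub>R ?e)) has_derivative
      (\<lambda>s. frechet_derivative w (at x) (s *\<^sub>R ?e))) (at 0)" .
  moreover have "frechet_derivative w (at x) (s *\<^sub>R ?e) = partial_deriv i w x * s" for s
    using linear_scale[OF linear_frechet_derivative[OF assms(1)]] by (simp add: partial_deriv_def)
  ultimately have "((\<lambda>s. w (x + s *\<^sub>R ?e)) has_real_derivative partial_deriv i w x) (at 0)"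
    by (simp add: has_field_derivative_def)
  then have "((\<lambda>s. (w (x + s *\<^sub>R ?e) - w x) / s) \<longlongrightarrow> partial_deriv i w x) (at 0)"
    by (simp add: has_field_derivative_iff)
  moreover have "filterlim (\<lambda>n. t / Suc n) (at 0) sequentially"
    using assms(2) LIMSEQ_Suc[OF lim_const_over_n[of t]] by (auto simp: filterlim_at)
  ultimately show ?thesis
    by (rule filterlim_compose)
qed

text \<open>
  For these functions the difference quotients in a fixed direction are bounded and supported in a
  fixed ball. By dominated convergence, statements about differences of translates, for which the
  translation invariance of Lebesgue measure is at hand, turn into statements about derivatives.
\<close>

locale lipschitz_compact_support =
  fixes w :: "real ^ 'n \<Rightarrow> real" and L :: real and K :: "(real ^ 'n) set"
  assumes differentiable: "\<And>x. w differentiable (at x)"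
    and lipschitz: "L-lipschitz_on UNIV w"
    and compact: "compact K"
    and vanish: "\<And>x. x \<notin> K \<Longrightarrow> w x = 0"
begin

lemma cont: "continuous_on S w"
  by (meson continuous_on_subset lipschitz lipschitz_on_continuous_on subset_UNIV)

lemma borel [measurable]: "w \<in> borel_measurable borel"
  using cont by (rule borel_measurable_continuous_onI)

lemma integrable_w: "integrable lborel w"
proof -
  have "(\<lambda>x. indicator K x *\<^sub>R w x) = w"
  proof
    fix x show "indicator K x *\<^sub>R w x = w x"
      using vanish[of x] by (cases "x \<in> K") auto
  qed
  then show ?thesis
    using borel_integrable_compact[OF compact cont] by simp
qed

lemma integrable_shift: "integrable lborel (\<lambda>x. w (x + h))"
  using lborel_translation(1)[of w h] integrable_w by simp

lemma difference_quotient_dominated: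
  assumes "0 < t"
  obtains g where "integrable lborel g"
    "\<And>n x. \<bar>(w (x + (t / Suc n) *\<^sub>R axis i 1) - w x) / (t / Suc n)\<bar> \<le> g x"
proof -
  obtain R where R: "\<And>x. x \<in> K \<Longrightarrow> norm x \<le> R"
    using compact_imp_bounded[OF compact] by (auto simp: bounded_iff)
  let ?g = "\<lambda>x. indicator (cball 0 (R + t)) x *\<^sub>R L"
  have gi: "integrable lborel ?g"
    by (rule borel_integrable_compact) auto
  have L: "0 \<le> L" using lipschitz by (rule lipschitz_on_nonneg)
  have "\<bar>(w (x + (t / Suc n) *\<^sub>R axis i 1) - w x) / (t / Suc n)\<bar> \<le> ?g x" for n x
  proof -
    define \<delta> where "\<delta> = t / Suc n"
    have \<delta>: "0 < \<delta>" "\<delta> \<le> t" using assms by (auto simp: \<delta>_def divide_le_eq)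
    have "\<bar>(w (x + \<delta> *\<^sub>R axis i 1) - w x) / \<delta>\<bar> \<le> ?g x"
    proof (cases "x \<in> cball 0 (R + t)")
      case True
      have "\<bar>w (x + \<delta> *\<^sub>R axis i 1) - w x\<bar> \<le> L * \<delta>"
        using lipschitz_onD[OF lipschitz, of "x + \<delta> *\<^sub>R axis i 1" x] \<delta>
        by (simp add: dist_norm)
      then show ?thesis
        using True \<delta> by (simp add: pos_divide_le_eq abs_divide)
    next
      case False
      then have n: "R + t < norm x" by simp
      have "norm x \<le> norm (x + \<delta> *\<^sub>R axis i 1) + \<delta>"
        using norm_triangle_ineq4[of "x + \<delta> *\<^sub>R axis i 1" "\<delta> *\<^sub>R axis i 1"] \<delta> by simp
      then have "x \<notin> K" "x + \<delta> *\<^sub>R axis i 1 \<notin> K"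
        using n \<delta> R[of x] R[of "x + \<delta> *\<^sub>R axis i 1"] by linarith+
      then show ?thesis using False by (simp add: vanish)
    qed
    then show ?thesis unfolding \<delta>_def .
  qed
  with gi show ?thesis by (rule that)
qed

text \<open>
  The integral of every difference quotient is 0, as \<open>w\<close> and its translates have the same integral.
\<close>

lemma integral_partial_deriv:
  shows "integrable lborel (partial_deriv i w)" "(\<integral>x. partial_deriv i w x \<partial>lborel) = 0"
    and "partial_deriv i w \<in> borel_measurable borel"
    and "0 < t \<Longrightarrow> (\<lambda>n. \<integral>x. \<bar>(w (x + (t / Suc n) *\<^sub>R axis i 1) - w x) / (t / Suc n)\<bar> \<partial>lborel)
        \<longlonglongrightarrow> (\<integral>x. \<bar>partial_deriv i w x\<bar> \<partial>lborel)"
proof -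
  define q where "q t n x = (w (x + (t / Suc n) *\<^sub>R axis i 1) - w x) / (t / Suc n)" for t n x
  have q[measurable]: "q t n \<in> borel_measurable borel" for t n
    unfolding q_def[abs_def] by measurable
  have lim: "(\<lambda>n. q t n x) \<longlonglongrightarrow> partial_deriv i w x" if "0 < t" for x t
    unfolding q_def by (intro difference_quotient_tendsto differentiable that)
  show meas[measurable]: "partial_deriv i w \<in> borel_measurable borel"
    by (rule borel_measurable_LIMSEQ_metric[of "q 1"]) (use lim in auto)
  have ex: "\<exists>g. integrable lborel g \<and> (\<forall>n x. \<bar>q t n x\<bar> \<le> g x)" if "0 < t" for t
    unfolding q_def by (rule difference_quotient_dominated[OF that, of i]) blast
  obtain g where g: "integrable lborel g" "\<And>n x. \<bar>q 1 n x\<bar> \<le> g x"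
    using ex[of 1] by auto
  have gae: "AE x in lborel. norm (q 1 n x) \<le> g x" for n using g(2) by simp
  have lae: "AE x in lborel. (\<lambda>n. q 1 n x) \<longlonglongrightarrow> partial_deriv i w x" using lim by simp
  have qm: "q 1 n \<in> borel_measurable lborel" "partial_deriv i w \<in> borel_measurable lborel" for n
    using q meas by auto
  show "integrable lborel (partial_deriv i w)"
    by (rule integrable_dominated_convergence[OF qm(2,1) g(1) lae gae])
  have dc: "(\<lambda>n. integral\<^sup>L lborel (q 1 n)) \<longlonglongrightarrow> (\<integral>x. partial_deriv i w x \<partial>lborel)"
    by (rule integral_dominated_convergence[OF qm(2,1) g(1) lae gae])
  have "integral\<^sup>L lborel (q 1 n) = 0" for n
  proof -
    define \<delta> where "\<delta> = 1 / real (Suc n)"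
    have "integral\<^sup>L lborel (q 1 n) = (\<integral>x. (w (x + \<delta> *\<^sub>R axis i 1) - w x) / \<delta> \<partial>lborel)"
      unfolding q_def \<delta>_def ..
    also have "\<dots> = (\<integral>x. w (x + \<delta> *\<^sub>R axis i 1) - w x \<partial>lborel) / \<delta>"
      by (rule integral_divide_zero)
    also have "(\<integral>x. w (x + \<delta> *\<^sub>R axis i 1) - w x \<partial>lborel) = 0"
      using Bochner_Integration.integral_diff[OF integrable_shift integrable_w]
        lborel_translation(2)[OF borel] by simp
    finally show ?thesis by simp
  qed
  with dc show "(\<integral>x. partial_deriv i w x \<partial>lborel) = 0"
    by (simp add: LIMSEQ_const_iff)
  assume t: "0 < t"
  obtain g where g: "integrable lborel g" "\<And>n x. \<bar>q t n x\<bar> \<le> g x"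
    using ex[OF t] by auto
  have "(\<lambda>n. \<integral>x. \<bar>q t n x\<bar> \<partial>lborel) \<longlonglongrightarrow> (\<integral>x. \<bar>partial_deriv i w x\<bar> \<partial>lborel)"
    using lim[OF t] g by (intro integral_dominated_convergence[of _ lborel _ g] AE_I2 tendsto_rabs) auto
  then show "(\<lambda>n. \<integral>x. \<bar>(w (x + (t / Suc n) *\<^sub>R axis i 1) - w x) / (t / Suc n)\<bar> \<partial>lborel)
        \<longlonglongrightarrow> (\<integral>x. \<bar>partial_deriv i w x\<bar> \<partial>lborel)"
    unfolding q_def .
qed

text \<open>
  By translation invariance, the left side is a subadditive function \<open>G\<close> of \<open>t\<close>. Hence
  \<open>G t \<le> n * G (t / n)\<close>, and the right side is the limit of this bound as \<open>n \<rightarrow> \<infinity>\<close>.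
\<close>

lemma integral_translation_le:
  assumes "0 \<le> t"
  shows "(\<integral>x. \<bar>w (x + t *\<^sub>R axis i 1) - w x\<bar> \<partial>lborel) \<le> t * (\<integral>x. \<bar>partial_deriv i w x\<bar> \<partial>lborel)"
proof (cases "t = 0")
  case False
  with assms have t: "0 < t" by simp
  let ?e = "axis i 1 :: real ^ 'n"
  define G where "G s = (\<integral>x. \<bar>w (x + s *\<^sub>R ?e) - w x\<bar> \<partial>lborel)" for s
  have int: "integrable lborel (\<lambda>x. \<bar>w (x + h) - w (x + k)\<bar>)" for h k
    by (intro integrable_abs Bochner_Integration.integrable_diff integrable_shift)
  have int0: "integrable lborel (\<lambda>x. \<bar>w (x + h) - w x\<bar>)" for h
    using int[of h 0] by simp
  have add: "G (s + r) \<le> G s + G r" for s r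
  proof -
    have int2: "integrable lborel (\<lambda>x. \<bar>w (x + r *\<^sub>R ?e + s *\<^sub>R ?e) - w (x + r *\<^sub>R ?e)\<bar>)"
      using int[of "r *\<^sub>R ?e + s *\<^sub>R ?e" "r *\<^sub>R ?e"] by (simp add: add.assoc)
    have "G (s + r) \<le> (\<integral>x. \<bar>w (x + r *\<^sub>R ?e + s *\<^sub>R ?e) - w (x + r *\<^sub>R ?e)\<bar>
        + \<bar>w (x + r *\<^sub>R ?e) - w x\<bar> \<partial>lborel)"
      unfolding G_def
    proof (rule integral_mono[OF int0 Bochner_Integration.integrable_add[OF int2 int0]])
      show "\<bar>w (x + (s + r) *\<^sub>R ?e) - w x\<bar>
        \<le> \<bar>w (x + r *\<^sub>R ?e + s *\<^sub>R ?e) - w (x + r *\<^sub>R ?e)\<bar> + \<bar>w (x + r *\<^sub>R ?e) - w x\<bar>" for x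
        by (simp add: scaleR_add_left add.assoc add.commute[of "s *\<^sub>R ?e"])
    qed
    also have "\<dots> = (\<integral>x. \<bar>w (x + r *\<^sub>R ?e + s *\<^sub>R ?e) - w (x + r *\<^sub>R ?e)\<bar> \<partial>lborel) + G r"
      unfolding G_def by (rule Bochner_Integration.integral_add[OF int2 int0])
    also have "(\<integral>x. \<bar>w (x + r *\<^sub>R ?e + s *\<^sub>R ?e) - w (x + r *\<^sub>R ?e)\<bar> \<partial>lborel) = G s"
      unfolding G_def
      using lborel_translation(2)[of "\<lambda>x. \<bar>w (x + s *\<^sub>R ?e) - w x\<bar>" "r *\<^sub>R ?e"] by simp
    finally show ?thesis .
  qed
  have G0: "G 0 = 0" by (simp add: G_def)
  have mult: "G (real m * s) \<le> real m * G s" for m s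
  proof (induction m)
    case (Suc m)
    then show ?case using add[of "real m * s" s] by (simp add: algebra_simps)
  qed (simp add: G0)
  have "G t \<le> t * (\<integral>x. \<bar>(w (x + (t / Suc n) *\<^sub>R ?e) - w x) / (t / Suc n)\<bar> \<partial>lborel)" for n
  proof -
    define \<delta> where "\<delta> = t / Suc n"
    have \<delta>: "0 < \<delta>" "t = real (Suc n) * \<delta>" using t by (auto simp: \<delta>_def)
    have "G t \<le> real (Suc n) * G \<delta>"
      using mult[of "Suc n" \<delta>] \<delta>(2) by simp
    also have "\<dots> = t * (G \<delta> / \<delta>)" using \<delta> by simp
    also have "G \<delta> / \<delta> = (\<integral>x. \<bar>w (x + \<delta> *\<^sub>R ?e) - w x\<bar> / \<delta> \<partial>lborel)"
      unfolding G_def by (rule integral_divide_zero[symmetric])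
    also have "\<dots> = (\<integral>x. \<bar>(w (x + \<delta> *\<^sub>R ?e) - w x) / \<delta>\<bar> \<partial>lborel)"
      using \<delta> by (simp add: abs_divide)
    finally show ?thesis unfolding \<delta>_def .
  qed
  moreover have "(\<lambda>n. t * (\<integral>x. \<bar>(w (x + (t / Suc n) *\<^sub>R ?e) - w x) / (t / Suc n)\<bar> \<partial>lborel))
    \<longlonglongrightarrow> t * (\<integral>x. \<bar>partial_deriv i w x\<bar> \<partial>lborel)"
    by (intro tendsto_mult tendsto_const integral_partial_deriv(4) t)
  ultimately have "G t \<le> t * (\<integral>x. \<bar>partial_deriv i w x\<bar> \<partial>lborel)"
    by (intro LIMSEQ_le_const) auto
  then show ?thesis by (simp add: G_def)
qed simp

end

lemma test_functions_lipschitz_compact_support: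
  assumes "\<phi> \<in> test_functions \<Omega>"
  obtains L K where "lipschitz_compact_support \<phi> L K" "K \<subseteq> \<Omega>"
proof -
  obtain L where "L-lipschitz_on UNIV \<phi>"
    using test_functions_lipschitz[OF assms] by blast
  moreover obtain K where "compact K" "K \<subseteq> \<Omega>" "\<And>x. x \<notin> K \<Longrightarrow> \<phi> x = 0"
    using test_functionsE[OF assms] by metis
  ultimately show ?thesis
    using that[of L K] differentiable_on_UNIV_smooth[OF test_functions_smooth[OF assms]]
    by (simp add: lipschitz_compact_support_def)
qed

lemma test_functions_vanish:
  assumes "\<phi> \<in> test_functions \<Omega>" "x \<notin> \<Omega>"
  shows "\<phi> x = 0" "partial_deriv i \<phi> x = 0"
  using test_functionsE[OF assms(1)] assms(2) by (metis subsetD)+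

lemma test_functions_borel:
  assumes "\<phi> \<in> test_functions \<Omega>"
  shows "\<phi> \<in> borel_measurable borel" "partial_deriv i \<phi> \<in> borel_measurable borel"
  using smooth_continuous_on[OF test_functions_smooth[OF assms]]
    smooth_continuous_on[OF smooth_partial_deriv[OF test_functions_smooth[OF assms]]]
  by (auto intro: borel_measurable_continuous_onI)

lemma borel_measurable_lebesgue_on:
  "f \<in> borel_measurable borel \<Longrightarrow> f \<in> borel_measurable (lebesgue_on S)"
  by (simp add: borel_measurable_if_D measurable_restrict_space1 measurable_completion)

lemma L1_locI:
  assumes "\<Omega> \<in> sets lebesgue" "integrable (lebesgue_on \<Omega>) g"
  shows "g \<in> L1_loc \<Omega>"
  unfolding L1_loc_def
proof clarify
  fix K assume K: "compact K" "K \<subseteq> \<Omega>"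
  then have Ks: "K \<in> sets lebesgue" by (simp add: fmeasurableD lmeasurable_compact)
  have "integrable lebesgue (\<lambda>x. indicator K x *\<^sub>R (if x \<in> \<Omega> then g x else 0))"
    using assms by (intro integrable_mult_indicator Ks) (simp add: Lebesgue_Measure.integrable_restrict_UNIV)
  also have "(\<lambda>x. indicator K x *\<^sub>R (if x \<in> \<Omega> then g x else 0)) = (\<lambda>x. if x \<in> K then g x else 0)"
    using K by (auto simp: fun_eq_iff split: split_indicator)
  finally show "integrable (lebesgue_on K) g"
    using Ks by (simp add: Lebesgue_Measure.integrable_restrict_UNIV)
qed

lemma L1_loc_times_integrable:
  fixes \<phi> :: "real ^ 'n \<Rightarrow> real"
  assumes g: "g \<in> L1_loc \<Omega>" and \<Omega>: "\<Omega> \<in> sets lebesgue"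
    and K: "compact K" "K \<subseteq> \<Omega>" "\<And>x. x \<notin> K \<Longrightarrow> \<phi> x = 0"
    and \<phi>: "\<phi> \<in> borel_measurable borel" "\<And>x. \<bar>\<phi> x\<bar> \<le> M"
  shows "integrable (lebesgue_on \<Omega>) (\<lambda>x. g x * \<phi> x)"
proof -
  have Ks: "K \<in> sets lebesgue" using K(1) by (simp add: fmeasurableD lmeasurable_compact)
  have gi: "integrable (lebesgue_on K) g" using g K by (auto simp: L1_loc_def)
  have [measurable]: "\<phi> \<in> borel_measurable (lebesgue_on K)"
    using \<phi>(1) by (rule borel_measurable_lebesgue_on)
  have M: "0 \<le> M" using \<phi>(2)[of 0] by linarith
  have "integrable (lebesgue_on K) (\<lambda>x. g x * \<phi> x)"
  proof (rule Bochner_Integration.integrable_bound)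
    show "integrable (lebesgue_on K) (\<lambda>x. g x * M)" using gi by simp
    show "AE x in lebesgue_on K. norm (g x * \<phi> x) \<le> norm (g x * M)"
      using \<phi>(2) M by (intro AE_I2) (auto simp: abs_mult intro!: mult_left_mono)
  qed (use gi in measurable)
  then have "integrable lebesgue (\<lambda>x. if x \<in> K then g x * \<phi> x else 0)"
    using Ks by (simp add: Lebesgue_Measure.integrable_restrict_UNIV)
  also have "(\<lambda>x. if x \<in> K then g x * \<phi> x else 0) = (\<lambda>x. if x \<in> \<Omega> then g x * \<phi> x else 0)"
    using K by force
  finally show ?thesis
    using \<Omega> by (simp add: Lebesgue_Measure.integrable_restrict_UNIV)
qed

lemma L1_loc_times_test_integrable:
  assumes "g \<in> L1_loc \<Omega>" "\<Omega> \<in> sets lebesgue" "\<phi> \<in> test_functions \<Omega>"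
  shows "integrable (lebesgue_on \<Omega>) (\<lambda>x. g x * \<phi> x)"
    and "integrable (lebesgue_on \<Omega>) (\<lambda>x. g x * partial_deriv i \<phi> x)"
proof -
  obtain K where K: "compact K" "K \<subseteq> \<Omega>" "\<And>x. x \<notin> K \<Longrightarrow> \<phi> x = 0"
    "\<And>x i. x \<notin> K \<Longrightarrow> partial_deriv i \<phi> x = 0"
    by (rule test_functionsE[OF assms(3)]) blast
  obtain M where M: "\<And>x. \<bar>\<phi> x\<bar> \<le> M" "\<And>x i. \<bar>partial_deriv i \<phi> x\<bar> \<le> M"
    using test_functions_bounded[OF assms(3)] by blast
  show "integrable (lebesgue_on \<Omega>) (\<lambda>x. g x * \<phi> x)"
    and "integrable (lebesgue_on \<Omega>) (\<lambda>x. g x * partial_deriv i \<phi> x)"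
    using test_functions_borel[OF assms(3)] K M
    by (auto intro!: L1_loc_times_integrable[OF assms(1,2) K(1,2)])
qed

lemma test_functions_integrable:
  assumes "\<Omega> \<in> sets lebesgue" "\<phi> \<in> test_functions \<Omega>"
  shows "integrable (lebesgue_on \<Omega>) \<phi>" "integrable (lebesgue_on \<Omega>) (partial_deriv i \<phi>)"
proof -
  obtain L K where "lipschitz_compact_support \<phi> L K"
    using test_functions_lipschitz_compact_support[OF assms(2)] by blast
  then interpret lipschitz_compact_support \<phi> L K .
  show "integrable (lebesgue_on \<Omega>) \<phi>" "integrable (lebesgue_on \<Omega>) (partial_deriv i \<phi>)"
    using integrable_w integral_partial_deriv(1)[of i] assms test_functions_vanish[OF assms(2)]
      test_functions_borel[OF assms(2)]
    by (auto simp: lebesgue_on_vanishing_outside)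
qed

text \<open>
  The integral of the derivative of the product is 0.
\<close>

lemma test_functions_integration_by_parts:
  assumes \<Omega>: "\<Omega> \<in> sets lebesgue" and \<phi>: "\<phi> \<in> test_functions \<Omega>" and \<eta>: "\<eta> \<in> test_functions \<Omega>"
  shows "(\<integral>x. \<phi> x * partial_deriv i \<eta> x \<partial>lebesgue_on \<Omega>)
       = - (\<integral>x. partial_deriv i \<phi> x * \<eta> x \<partial>lebesgue_on \<Omega>)"
proof -
  have prod: "(\<lambda>x. \<phi> x * \<eta> x) \<in> test_functions \<Omega>"
    by (intro test_functions_mult \<phi> test_functions_smooth[OF \<eta>])
  then obtain L K where "lipschitz_compact_support (\<lambda>x. \<phi> x * \<eta> x) L K"
    using test_functions_lipschitz_compact_support by blast
  then interpret lipschitz_compact_support "\<lambda>x. \<phi> x * \<eta> x" L K .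
  have d: "\<phi> differentiable (at x)" "\<eta> differentiable (at x)" for x
    using differentiable_on_UNIV_smooth test_functions_smooth \<phi> \<eta> by blast+
  have int: "integrable (lebesgue_on \<Omega>) (\<lambda>x. partial_deriv i \<phi> x * \<eta> x)"
    "integrable (lebesgue_on \<Omega>) (\<lambda>x. \<phi> x * partial_deriv i \<eta> x)"
    using L1_loc_times_test_integrable(1)[OF _ \<Omega> \<eta>] L1_loc_times_test_integrable(2)[OF _ \<Omega> \<eta>]
      test_functions_integrable[OF \<Omega> \<phi>] L1_locI[OF \<Omega>] by auto
  have "0 = (\<integral>x. partial_deriv i (\<lambda>x. \<phi> x * \<eta> x) x \<partial>lebesgue_on \<Omega>)"
    using integral_partial_deriv(2)[of i] lebesgue_on_vanishing_outside(2)[OF \<Omega>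
        test_functions_borel(2)[OF prod] test_functions_vanish(2)[OF prod]] by simp
  also have "\<dots> = (\<integral>x. partial_deriv i \<phi> x * \<eta> x + \<phi> x * partial_deriv i \<eta> x \<partial>lebesgue_on \<Omega>)"
    by (simp add: partial_deriv_mult d)
  also have "\<dots> = (\<integral>x. partial_deriv i \<phi> x * \<eta> x \<partial>lebesgue_on \<Omega>)
      + (\<integral>x. \<phi> x * partial_deriv i \<eta> x \<partial>lebesgue_on \<Omega>)"
    by (rule Bochner_Integration.integral_add[OF int])
  finally show ?thesis by simp
qed

section \<open>Uniqueness of weak gradients\<close>

text \<open>
  If \<open>\<beta>\<close> is smooth and positive exactly on the box, then the test functions \<open>1 - exp (- m \<beta>)\<close>
  increase to the indicator function of the box.
\<close>

lemma integral_box_eq_0: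
  fixes g :: "real ^ 'n \<Rightarrow> real"
  assumes \<Omega>: "\<Omega> \<in> sets lebesgue" and g: "g \<in> L1_loc \<Omega>"
    and orth: "\<And>\<phi>. \<phi> \<in> test_functions \<Omega> \<Longrightarrow> (\<integral>x. g x * \<phi> x \<partial>lebesgue_on \<Omega>) = 0"
    and box: "box a b \<subseteq> cbox c d" "cbox c d \<subseteq> \<Omega>"
  shows "(\<integral>x. indicator (box a b) x * g x \<partial>lebesgue) = 0"
proof -
  obtain \<beta> where \<beta>: "smooth \<beta>" "\<And>x. 0 \<le> \<beta> x" "\<And>x. 0 < \<beta> x \<longleftrightarrow> x \<in> box a b"
    by (rule box_bump_exists) blast
  have \<beta>0: "\<beta> x = 0" if "x \<notin> box a b" for x
    using \<beta>(2,3)[of x] that by linarith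
  have \<beta>t: "\<beta> \<in> test_functions \<Omega>"
    using \<beta>0 box by (intro test_functionsI[OF \<beta>(1), of "cbox c d"]) auto
  define \<phi> where "\<phi> m x = 1 - exp (- (real m * \<beta> x))" for m x
  have "smooth_real (\<lambda>y. 1 - exp (- (real m * y)))" for m
    by (intro smooth_real_diff smooth_real_const smooth_real_compose[OF smooth_real_exp]
        smooth_real_minus smooth_real_mult smooth_real_ident)
  then have \<phi>t: "\<phi> m \<in> test_functions \<Omega>" for m
    unfolding \<phi>_def[abs_def] by (intro test_functions_compose[OF \<beta>t]) auto
  have \<phi>0: "\<phi> m x = 0" if "x \<notin> box a b" for m x
    using \<beta>0[OF that] by (simp add: \<phi>_def)
  have \<phi>1: "0 \<le> \<phi> m x" "\<phi> m x \<le> 1" for m x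
    using \<beta>(2) by (auto simp: \<phi>_def)
  have \<phi>lim: "(\<lambda>m. \<phi> m x) \<longlonglongrightarrow> indicator (box a b) x" for x
  proof (cases "x \<in> box a b")
    case True
    then have "0 < \<beta> x" using \<beta>(3) by simp
    then have "filterlim (\<lambda>m. real m * \<beta> x) at_top sequentially"
      by (intro filterlim_at_top_mult_tendsto_pos[OF tendsto_const _ filterlim_real_sequentially])
    then have "(\<lambda>m. exp (- (real m * \<beta> x))) \<longlonglongrightarrow> 0"
      by (intro filterlim_compose[OF exp_at_bot]) (simp add: filterlim_uminus_at_bot)
    from tendsto_diff[OF tendsto_const[of 1] this] show ?thesis
      using True by (simp add: \<phi>_def)
  qed (simp add: \<phi>0)
  let ?g = "\<lambda>x. if x \<in> cbox c d then g x else 0"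
  have "integrable (lebesgue_on (cbox c d)) g"
    using g box by (auto simp: L1_loc_def)
  then have gi: "integrable lebesgue ?g"
    by (simp add: Lebesgue_Measure.integrable_restrict_UNIV)
  have [measurable]: "\<phi> m \<in> borel_measurable lebesgue" for m
    using test_functions_borel(1)[OF \<phi>t] by (simp add: measurable_completion)
  have "(\<lambda>m. \<integral>x. ?g x * \<phi> m x \<partial>lebesgue) \<longlonglongrightarrow> (\<integral>x. ?g x * indicator (box a b) x \<partial>lebesgue)"
  proof (rule integral_dominated_convergence[where w = "\<lambda>x. \<bar>?g x\<bar>"])
    show "AE x in lebesgue. (\<lambda>m. ?g x * \<phi> m x) \<longlonglongrightarrow> ?g x * indicator (box a b) x"
      by (intro AE_I2 tendsto_mult tendsto_const \<phi>lim)
    show "AE x in lebesgue. norm (?g x * \<phi> m x) \<le> \<bar>?g x\<bar>" for m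
    proof (intro AE_I2)
      fix x show "norm (?g x * \<phi> m x) \<le> \<bar>?g x\<bar>"
        using mult_left_mono[of "\<bar>\<phi> m x\<bar>" 1 "\<bar>?g x\<bar>"] \<phi>1[of m x] by (simp add: abs_mult)
    qed
    show "(\<lambda>x. ?g x * indicator (box a b) x) \<in> borel_measurable lebesgue"
      using gi by (intro borel_measurable_times borel_measurable_indicator) auto
    show "(\<lambda>x. ?g x * \<phi> m x) \<in> borel_measurable lebesgue" for m
      using gi by (intro borel_measurable_times) auto
    show "integrable lebesgue (\<lambda>x. \<bar>?g x\<bar>)" using gi by (rule integrable_abs)
  qed
  moreover have "(\<integral>x. ?g x * \<phi> m x \<partial>lebesgue) = 0" for m
  proof -
    have "(\<lambda>x. ?g x * \<phi> m x) = (\<lambda>x. if x \<in> \<Omega> then g x * \<phi> m x else 0)"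
    proof
      fix x show "?g x * \<phi> m x = (if x \<in> \<Omega> then g x * \<phi> m x else 0)"
        using \<phi>0[of x m] box by (cases "x \<in> box a b") auto
    qed
    then show ?thesis
      using orth[OF \<phi>t] Lebesgue_Measure.integral_restrict_UNIV[OF \<Omega>, of "\<lambda>x. g x * \<phi> m x"] by simp
  qed
  ultimately have "(\<integral>x. ?g x * indicator (box a b) x \<partial>lebesgue) = 0"
    by (simp add: LIMSEQ_const_iff)
  moreover have "(\<lambda>x. ?g x * indicator (box a b) x) = (\<lambda>x. indicator (box a b) x * g x)"
    using box by (auto simp: fun_eq_iff split: split_indicator)
  ultimately show ?thesis by simp
qed

text \<open>
  Boxes form a generator of the Borel sets that is stable under intersection, so the set integrals of
  \<open>h\<close> vanish for all Borel sets and then for all Lebesgue sets.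
\<close>

lemma integrable_AE_eq_0_if_box_integrals_eq_0:
  fixes h :: "'a::euclidean_space \<Rightarrow> real"
  assumes h: "integrable lebesgue h"
    and box: "\<And>a b. (\<integral>x. indicator (box a b) x * h x \<partial>lebesgue) = 0"
    and total: "(\<integral>x. h x \<partial>lebesgue) = 0"
  shows "AE x in lebesgue. h x = 0"
proof -
  have si: "set_integrable lebesgue A h" if "A \<in> sets lebesgue" for A
    using that h unfolding set_integrable_def by (rule integrable_mult_indicator)
  have gen: "sets (borel :: 'a measure) = sigma_sets UNIV (range (\<lambda>(a, b). box a b))"
    by (subst borel_eq_box) (simp add: sets_measure_of)
  have borel0: "(LINT x:A|lebesgue. h x) = 0" if "A \<in> sets borel" for A
  proof -
    have A: "A \<in> sigma_sets UNIV (range (\<lambda>(a, b). box a b))"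
      using that gen by simp
    have "Int_stable (range (\<lambda>(a, b). box a b :: 'a set))"
      by (auto simp: Int_stable_def box_Int_box)
    moreover have "range (\<lambda>(a, b). box a b :: 'a set) \<subseteq> Pow UNIV" by simp
    ultimately show ?thesis using A
    proof (induction rule: sigma_sets_induct_disjoint)
      case (compl A)
      then have A: "A \<in> sets lebesgue" by (simp add: gen[symmetric])
      have "(\<integral>x. h x \<partial>lebesgue) = (LINT x:A \<union> (UNIV - A)|lebesgue. h x)"
        by (simp add: set_lebesgue_integral_def)
      also have "\<dots> = (LINT x:A|lebesgue. h x) + (LINT x:UNIV - A|lebesgue. h x)"
        using A by (intro set_integral_Un si) auto
      finally show ?case using compl.IH total by simp
    next
      case (union A)
      then have A: "A i \<in> sets lebesgue" for i by (auto simp: gen[symmetric])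
      have "(LINT x:(\<Union>i. A i)|lebesgue. h x) = (\<Sum>i. LINT x:A i|lebesgue. h x)"
      proof (rule lebesgue_integral_countable_add)
        show "A i \<inter> A j = {}" if "i \<noteq> j" for i j
          using union.hyps(1) that by (auto simp: disjoint_family_on_def)
      qed (use A in \<open>auto intro!: si\<close>)
      then show ?case using union.IH by simp
    qed (use box in \<open>auto simp: set_lebesgue_integral_def\<close>)
  qed
  have "(LINT x:A|lebesgue. h x) = 0" if A: "A \<in> sets lebesgue" for A
  proof -
    obtain S N N' where S: "A = S \<union> N" "N \<subseteq> N'" "N' \<in> null_sets lborel" "S \<in> sets lborel"
      using A by (rule sets_completionE)
    have "AE x in lebesgue. x \<notin> N'"
      using S(3) by (intro AE_not_in null_sets_completionI)
    then have "AE x in lebesgue. x \<in> A \<longleftrightarrow> x \<in> S"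
      by (rule AE_mp) (use S in auto)
    then have "(LINT x:A|lebesgue. h x) = (LINT x:S|lebesgue. h x)"
      unfolding set_lebesgue_integral_def
    proof (intro integral_cong_AE borel_measurable_scaleR borel_measurable_indicator)
      show "AE x in lebesgue. indicator A x *\<^sub>R h x = indicator S x *\<^sub>R h x"
        using \<open>AE x in lebesgue. x \<in> A \<longleftrightarrow> x \<in> S\<close> by (rule AE_mp) (auto simp: indicator_def)
    qed (use S(4) A h in auto)
    also have "\<dots> = 0" using S(4) by (intro borel0) simp
    finally show ?thesis .
  qed
  then show ?thesis
    using density_unique_real[OF h, of "\<lambda>x. 0"] by simp
qed

text \<open>
  An open set is a countable union of open boxes whose closures it contains, and \<open>g\<close> is integrable
  on each of these.
\<close>

lemma fundamental_lemma_calculus_of_variations: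
  fixes g :: "real ^ 'n \<Rightarrow> real"
  assumes op: "open \<Omega>" and g: "g \<in> L1_loc \<Omega>"
    and orth: "\<And>\<phi>. \<phi> \<in> test_functions \<Omega> \<Longrightarrow> (\<integral>x. g x * \<phi> x \<partial>lebesgue_on \<Omega>) = 0"
  shows "AE x in lebesgue_on \<Omega>. g x = 0"
proof -
  have \<Omega>: "\<Omega> \<in> sets lebesgue" using op by simp
  have local: "AE x in lebesgue. x \<in> box u v \<longrightarrow> g x = 0" if uv: "cbox u v \<subseteq> \<Omega>" for u v
  proof -
    let ?h = "\<lambda>x. indicator (box u v) x * g x"
    have "integrable (lebesgue_on (cbox u v)) g"
      using g uv by (auto simp: L1_loc_def)
    then have "integrable lebesgue (\<lambda>x. if x \<in> cbox u v then g x else 0)"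
      by (simp add: Lebesgue_Measure.integrable_restrict_UNIV)
    then have "integrable lebesgue (\<lambda>x. indicator (box u v) x *\<^sub>R (if x \<in> cbox u v then g x else 0))"
      by (intro integrable_mult_indicator) auto
    also have "(\<lambda>x. indicator (box u v) x *\<^sub>R (if x \<in> cbox u v then g x else 0)) = ?h"
      using box_subset_cbox[of u v] by (auto simp: fun_eq_iff split: split_indicator)
    finally have hi: "integrable lebesgue ?h" .
    have "(\<integral>x. indicator (box a b) x * ?h x \<partial>lebesgue) = 0" for a b
    proof -
      obtain a' b' where ab: "box a b \<inter> box u v = box a' b'"
        using box_Int_box by blast
      have "(\<lambda>x. indicator (box a b) x * ?h x) = (\<lambda>x. indicator (box a' b') x * g x)"
        unfolding ab[symmetric] by (auto simp: fun_eq_iff split: split_indicator)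
      moreover have "box a' b' \<subseteq> cbox u v"
        using ab box_subset_cbox[of u v] by blast
      ultimately show ?thesis
        using integral_box_eq_0[OF \<Omega> g orth _ uv] by simp
    qed
    moreover have "(\<integral>x. ?h x \<partial>lebesgue) = 0"
      using integral_box_eq_0[OF \<Omega> g orth box_subset_cbox uv] by simp
    ultimately have "AE x in lebesgue. ?h x = 0"
      using integrable_AE_eq_0_if_box_integrals_eq_0[OF hi] by blast
    then show ?thesis by (rule AE_mp) auto
  qed
  define \<B> where "\<B> = {box u v |u v. cbox u v \<subseteq> \<Omega>}"
  obtain \<B>' where \<B>': "\<B>' \<subseteq> \<B>" "countable \<B>'" "\<Union>\<B>' = \<Union>\<B>"
    by (rule Lindelof[of \<B>]) (auto simp: \<B>_def open_box)
  have "\<Omega> \<subseteq> \<Union>\<B>"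
  proof
    fix x assume "x \<in> \<Omega>"
    then obtain u v where "cbox u v \<subseteq> \<Omega>" "x \<in> box u v"
      using open_contains_cbox[OF op] by metis
    then show "x \<in> \<Union>\<B>" unfolding \<B>_def by blast
  qed
  moreover have "AE x in lebesgue. \<forall>B\<in>\<B>'. x \<in> B \<longrightarrow> g x = 0"
  proof (subst AE_ball_countable[OF \<B>'(2)], intro ballI)
    fix B assume "B \<in> \<B>'"
    then obtain u v where "B = box u v" "cbox u v \<subseteq> \<Omega>" using \<B>'(1) by (auto simp: \<B>_def)
    then show "AE x in lebesgue. x \<in> B \<longrightarrow> g x = 0" using local by simp
  qed
  ultimately have "AE x in lebesgue. x \<in> \<Omega> \<longrightarrow> g x = 0"
    using \<B>'(3) by (elim AE_mp) (auto intro!: AE_I2)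
  then show ?thesis using \<Omega> by (simp add: AE_restrict_space_iff)
qed

lemma L1_loc_cong_AE:
  assumes "\<Omega> \<in> sets lebesgue" "AE x in lebesgue_on \<Omega>. u x = v x" "u \<in> L1_loc \<Omega>"
  shows "v \<in> L1_loc \<Omega>"
  unfolding L1_loc_def
proof clarify
  fix K assume K: "compact K" "K \<subseteq> \<Omega>"
  then have Ks: "K \<in> sets lebesgue" by (simp add: fmeasurableD lmeasurable_compact)
  have "AE x in lebesgue. x \<in> \<Omega> \<longrightarrow> u x = v x"
    using assms by (simp add: AE_restrict_space_iff)
  then have "AE x in lebesgue_on K. u x = v x"
    using Ks K by (auto simp: AE_restrict_space_iff elim!: AE_mp)
  then show "integrable (lebesgue_on K) v"
    using integrable_integral_cong_AE_lebesgue_on(1)[OF Ks] assms(3) K by (auto simp: L1_loc_def)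
qed

lemma is_weak_gradient_cong_AE:
  assumes \<Omega>: "\<Omega> \<in> sets lebesgue"
    and u: "AE x in lebesgue_on \<Omega>. u x = v x" and G: "AE x in lebesgue_on \<Omega>. G x = H x"
    and wg: "is_weak_gradient \<Omega> u G"
  shows "is_weak_gradient \<Omega> v H"
  unfolding is_weak_gradient_def
proof (intro conjI allI ballI)
  have Gi: "AE x in lebesgue_on \<Omega>. G x $ i = H x $ i" for i
    using G by (rule AE_mp) auto
  show "v \<in> L1_loc \<Omega>"
    using wg by (intro L1_loc_cong_AE[OF \<Omega> u]) (simp add: is_weak_gradient_def)
  show "(\<lambda>x. H x $ i) \<in> L1_loc \<Omega>" for i
    using wg by (intro L1_loc_cong_AE[OF \<Omega> Gi]) (simp add: is_weak_gradient_def)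
  fix \<phi> i assume \<phi>: "\<phi> \<in> test_functions \<Omega>"
  have "(\<integral>x. v x * partial_deriv i \<phi> x \<partial>lebesgue_on \<Omega>) = (\<integral>x. u x * partial_deriv i \<phi> x \<partial>lebesgue_on \<Omega>)"
    by (rule integrable_integral_cong_AE_lebesgue_on(2)[OF \<Omega>]) (use u in \<open>auto elim!: AE_mp\<close>)
  moreover have "(\<integral>x. H x $ i * \<phi> x \<partial>lebesgue_on \<Omega>) = (\<integral>x. G x $ i * \<phi> x \<partial>lebesgue_on \<Omega>)"
    by (rule integrable_integral_cong_AE_lebesgue_on(2)[OF \<Omega>]) (use G in \<open>auto elim!: AE_mp\<close>)
  ultimately show "(\<integral>x. v x * partial_deriv i \<phi> x \<partial>lebesgue_on \<Omega>) = - (\<integral>x. H x $ i * \<phi> x \<partial>lebesgue_on \<Omega>)"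
    using wg \<phi> by (simp add: is_weak_gradient_def)
qed

lemma L1_loc_diff:
  "u \<in> L1_loc \<Omega> \<Longrightarrow> v \<in> L1_loc \<Omega> \<Longrightarrow> (\<lambda>x. u x - v x) \<in> L1_loc \<Omega>"
  by (auto simp: L1_loc_def)

lemma is_weak_gradient_diff:
  assumes \<Omega>: "\<Omega> \<in> sets lebesgue"
    and u: "is_weak_gradient \<Omega> u G" and v: "is_weak_gradient \<Omega> v H"
  shows "is_weak_gradient \<Omega> (\<lambda>x. u x - v x) (\<lambda>x. G x - H x)"
  unfolding is_weak_gradient_def
proof (intro conjI allI ballI)
  show "(\<lambda>x. u x - v x) \<in> L1_loc \<Omega>"
    using u v by (intro L1_loc_diff) (auto simp: is_weak_gradient_def)
  show "(\<lambda>x. (G x - H x) $ i) \<in> L1_loc \<Omega>" for i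
    using u v L1_loc_diff[of "\<lambda>x. G x $ i" \<Omega> "\<lambda>x. H x $ i"] by (auto simp: is_weak_gradient_def)
  fix \<phi> i assume \<phi>: "\<phi> \<in> test_functions \<Omega>"
  have int: "integrable (lebesgue_on \<Omega>) (\<lambda>x. u x * partial_deriv i \<phi> x)"
    "integrable (lebesgue_on \<Omega>) (\<lambda>x. v x * partial_deriv i \<phi> x)"
    "integrable (lebesgue_on \<Omega>) (\<lambda>x. G x $ i * \<phi> x)"
    "integrable (lebesgue_on \<Omega>) (\<lambda>x. H x $ i * \<phi> x)"
    using u v L1_loc_times_test_integrable[OF _ \<Omega> \<phi>] by (auto simp: is_weak_gradient_def)
  have "(\<integral>x. u x * partial_deriv i \<phi> x \<partial>lebesgue_on \<Omega>) = - (\<integral>x. G x $ i * \<phi> x \<partial>lebesgue_on \<Omega>)"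
    "(\<integral>x. v x * partial_deriv i \<phi> x \<partial>lebesgue_on \<Omega>) = - (\<integral>x. H x $ i * \<phi> x \<partial>lebesgue_on \<Omega>)"
    using u v \<phi> by (auto simp: is_weak_gradient_def)
  then show "(\<integral>x. (u x - v x) * partial_deriv i \<phi> x \<partial>lebesgue_on \<Omega>)
      = - (\<integral>x. (G x - H x) $ i * \<phi> x \<partial>lebesgue_on \<Omega>)"
    using int by (simp add: left_diff_distrib)
qed

lemma is_weak_gradient_unique:
  assumes "open \<Omega>" "is_weak_gradient \<Omega> u G" "is_weak_gradient \<Omega> u H"
  shows "AE x in lebesgue_on \<Omega>. G x = H x"
proof -
  have \<Omega>: "\<Omega> \<in> sets lebesgue" using assms(1) by simp
  have "is_weak_gradient \<Omega> (\<lambda>x. u x - u x) (\<lambda>x. G x - H x)"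
    by (rule is_weak_gradient_diff[OF \<Omega> assms(2,3)])
  then have "AE x in lebesgue_on \<Omega>. (G x - H x) $ i = 0" for i
    by (intro fundamental_lemma_calculus_of_variations[OF assms(1)]) (auto simp: is_weak_gradient_def)
  then have "AE x in lebesgue_on \<Omega>. \<forall>i\<in>UNIV. (G x - H x) $ i = 0"
    by (intro AE_finite_allI) auto
  then show ?thesis
    by (rule AE_mp) (auto simp: vec_eq_iff)
qed

lemma weak_gradient_is_weak_gradient:
  "is_weak_gradient \<Omega> u G \<Longrightarrow> is_weak_gradient \<Omega> u (weak_gradient \<Omega> u)"
  unfolding weak_gradient_def by (rule someI[of "is_weak_gradient \<Omega> u"])

lemma weak_gradient_AE_eq:
  assumes "open \<Omega>" "is_weak_gradient \<Omega> u G"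
  shows "AE x in lebesgue_on \<Omega>. weak_gradient \<Omega> u x = G x"
  using is_weak_gradient_unique[OF assms(1) weak_gradient_is_weak_gradient[OF assms(2)] assms(2)] .

lemma test_functions_weak_gradient:
  assumes \<Omega>: "\<Omega> \<in> sets lebesgue" and \<phi>: "\<phi> \<in> test_functions \<Omega>"
  shows "is_weak_gradient \<Omega> \<phi> (gradient \<phi>)"
  unfolding is_weak_gradient_def
  using test_functions_integrable[OF \<Omega> \<phi>] test_functions_integration_by_parts[OF \<Omega> \<phi>]
  by (auto simp: gradient_def intro!: L1_locI[OF \<Omega>])

section \<open>The space of functions with zero boundary values\<close>

text \<open>
  A substitute for the Hoelder inequality on sets of finite measure: the free parameter \<open>\<tau>\<close>
  balances the two summands after integration.
\<close>

lemma abs_le_add_powr: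
  fixes t \<tau> q :: real
  assumes "0 < \<tau>" "1 \<le> q"
  shows "\<bar>t\<bar> \<le> \<tau> + \<tau> powr (1 - q) * \<bar>t\<bar> powr q"
proof (cases "\<bar>t\<bar> \<le> \<tau>")
  case True
  then show ?thesis using powr_ge_zero by (simp add: add_increasing2)
next
  case False
  then have t: "0 < \<bar>t\<bar>" "\<tau> \<le> \<bar>t\<bar>" using assms by linarith+
  have "\<bar>t\<bar> = \<bar>t\<bar> powr (1 - q) * \<bar>t\<bar> powr q"
    using t by (simp add: powr_add[symmetric])
  also have "\<dots> \<le> \<tau> powr (1 - q) * \<bar>t\<bar> powr q"
    using assms t by (intro mult_right_mono powr_mono2') auto
  finally show ?thesis using assms by linarith
qed

lemma abs_add_powr_le:
  fixes x y q :: real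
  assumes "0 \<le> q"
  shows "\<bar>x + y\<bar> powr q \<le> 2 powr q * (\<bar>x\<bar> powr q + \<bar>y\<bar> powr q)"
proof -
  have *: "\<bar>a + b\<bar> powr q \<le> 2 powr q * \<bar>a\<bar> powr q" if "\<bar>b\<bar> \<le> \<bar>a\<bar>" for a b :: real
  proof -
    have "\<bar>a + b\<bar> powr q \<le> (2 * \<bar>a\<bar>) powr q"
      using that assms by (intro powr_mono2) auto
    then show ?thesis by (simp add: powr_mult)
  qed
  show ?thesis
  proof (cases "\<bar>y\<bar> \<le> \<bar>x\<bar>")
    case True
    from *[OF this] show ?thesis by (simp add: distrib_left add_increasing2)
  next
    case False
    then have "\<bar>x\<bar> \<le> \<bar>y\<bar>" by simp
    from *[OF this] show ?thesis by (simp add: distrib_left add_increasing add.commute)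
  qed
qed

lemma tendsto_0_le:
  fixes f g :: "nat \<Rightarrow> real"
  assumes "\<And>n. 0 \<le> f n" "\<And>n. f n \<le> g n" "g \<longlonglongrightarrow> 0"
  shows "f \<longlonglongrightarrow> 0"
  by (rule tendsto_sandwich[OF _ _ tendsto_const assms(3)]) (use assms in auto)

lemma integral_mult_tendsto:
  fixes f :: "nat \<Rightarrow> 'a \<Rightarrow> real"
  assumes f: "\<And>n. integrable M (f n)" "integrable M g" "(\<lambda>n. \<integral>x. \<bar>f n x - g x\<bar> \<partial>M) \<longlonglongrightarrow> 0"
    and h: "h \<in> borel_measurable M" "\<And>x. x \<in> space M \<Longrightarrow> \<bar>h x\<bar> \<le> C"
  shows "(\<lambda>n. \<integral>x. f n x * h x \<partial>M) \<longlonglongrightarrow> (\<integral>x. g x * h x \<partial>M)"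
proof -
  have int: "integrable M (\<lambda>x. k x * h x)" if "integrable M k" for k
  proof (rule Bochner_Integration.integrable_bound)
    show "integrable M (\<lambda>x. k x * C)" using that by simp
    show "AE x in M. norm (k x * h x) \<le> norm (k x * C)"
    proof (rule AE_I2)
      fix x assume "x \<in> space M"
      then have "\<bar>h x\<bar> \<le> \<bar>C\<bar>" using h(2)[of x] by linarith
      then show "norm (k x * h x) \<le> norm (k x * C)"
        by (auto simp: abs_mult intro!: mult_left_mono)
    qed
  qed (use that h in auto)
  have "(\<lambda>n. (\<integral>x. f n x * h x \<partial>M) - (\<integral>x. g x * h x \<partial>M)) \<longlonglongrightarrow> 0"
  proof (rule Lim_null_comparison[OF always_eventually], rule allI)
    fix n
    have "norm ((\<integral>x. f n x * h x \<partial>M) - (\<integral>x. g x * h x \<partial>M)) = norm (\<integral>x. (f n x - g x) * h x \<partial>M)"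
      using int f by (simp add: left_diff_distrib)
    also have "\<dots> \<le> (\<integral>x. norm ((f n x - g x) * h x) \<partial>M)"
      by (rule integral_norm_bound)
    also have "\<dots> \<le> (\<integral>x. \<bar>f n x - g x\<bar> * C \<partial>M)"
    proof (rule integral_mono_AE')
      show "AE x in M. norm ((f n x - g x) * h x) \<le> \<bar>f n x - g x\<bar> * C"
        using h(2) by (intro AE_I2) (auto simp: abs_mult intro!: mult_left_mono)
      show "AE x in M. 0 \<le> \<bar>f n x - g x\<bar> * C"
        using order_trans[OF abs_ge_zero h(2)] by (intro AE_I2 mult_nonneg_nonneg) auto
    qed (use f in auto)
    finally show "norm ((\<integral>x. f n x * h x \<partial>M) - (\<integral>x. g x * h x \<partial>M))
        \<le> (\<integral>x. \<bar>f n x - g x\<bar> \<partial>M) * C" by simp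
    show "(\<lambda>n. (\<integral>x. \<bar>f n x - g x\<bar> \<partial>M) * C) \<longlonglongrightarrow> 0"
      using tendsto_mult[OF f(3) tendsto_const[of C]] by simp
  qed
  then show ?thesis by (rule LIM_zero_cancel)
qed

lemma (in finite_measure) integrable_if_powr_integrable:
  fixes g :: "'a \<Rightarrow> real"
  assumes "g \<in> borel_measurable M" "integrable M (\<lambda>x. \<bar>g x\<bar> powr q)" "1 \<le> q"
  shows "integrable M g"
proof (rule Bochner_Integration.integrable_bound)
  show "integrable M (\<lambda>x. 1 + \<bar>g x\<bar> powr q)" using assms by simp
  show "AE x in M. norm (g x) \<le> norm (1 + \<bar>g x\<bar> powr q)"
    using abs_le_add_powr[of 1 q] assms(3) by (intro AE_I2) (simp add: add_nonneg_nonneg)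
qed (rule assms)

lemma (in finite_measure) integral_abs_le_powr:
  fixes g :: "'a \<Rightarrow> real"
  assumes "g \<in> borel_measurable M" "integrable M (\<lambda>x. \<bar>g x\<bar> powr q)" "1 \<le> q" "0 < \<tau>"
  shows "(\<integral>x. \<bar>g x\<bar> \<partial>M) \<le> \<tau> * measure M (space M) + \<tau> powr (1 - q) * (\<integral>x. \<bar>g x\<bar> powr q \<partial>M)"
proof -
  have "(\<integral>x. \<bar>g x\<bar> \<partial>M) \<le> (\<integral>x. \<tau> + \<tau> powr (1 - q) * \<bar>g x\<bar> powr q \<partial>M)"
    using integrable_if_powr_integrable[OF assms(1-3)] assms abs_le_add_powr
    by (intro integral_mono) auto
  also have "\<dots> = \<tau> * measure M (space M) + \<tau> powr (1 - q) * (\<integral>x. \<bar>g x\<bar> powr q \<partial>M)"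
    using assms by (subst Bochner_Integration.integral_add) auto
  finally show ?thesis .
qed

lemma (in finite_measure) integral_abs_tendsto_0_if_powr:
  fixes g :: "nat \<Rightarrow> 'a \<Rightarrow> real"
  assumes g: "\<And>n. g n \<in> borel_measurable M" "\<And>n. integrable M (\<lambda>x. \<bar>g n x\<bar> powr q)"
    and lim: "(\<lambda>n. \<integral>x. \<bar>g n x\<bar> powr q \<partial>M) \<longlonglongrightarrow> 0" and q: "1 \<le> q"
  shows "(\<lambda>n. \<integral>x. \<bar>g n x\<bar> \<partial>M) \<longlonglongrightarrow> 0"
proof (rule order_tendstoI)
  fix e :: real assume e: "0 < e"
  define m where "m = measure M (space M) + 1"
  have m: "0 < m" "measure M (space M) < m"
    using measure_nonneg[of M "space M"] by (simp_all add: m_def add_nonneg_pos)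
  define \<tau> where "\<tau> = e / (2 * m)"
  have \<tau>: "0 < \<tau>" "\<tau> * measure M (space M) < e / 2"
    using m e by (auto simp: \<tau>_def field_simps)
  have "(\<lambda>n. \<tau> powr (1 - q) * (\<integral>x. \<bar>g n x\<bar> powr q \<partial>M)) \<longlonglongrightarrow> \<tau> powr (1 - q) * 0"
    by (intro tendsto_mult tendsto_const lim)
  then have "\<forall>\<^sub>F n in sequentially. \<tau> powr (1 - q) * (\<integral>x. \<bar>g n x\<bar> powr q \<partial>M) < e / 2"
    using e by (intro order_tendstoD) auto
  then show "\<forall>\<^sub>F n in sequentially. (\<integral>x. \<bar>g n x\<bar> \<partial>M) < e"
  proof eventually_elim
    case (elim n)
    then show ?case using integral_abs_le_powr[OF g q \<tau>(1), of n] \<tau>(2) by linarith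
  qed
next
  fix e :: real assume "e < 0"
  then have "e < (\<integral>x. \<bar>g n x\<bar> \<partial>M)" for n
    by (rule less_le_trans) (simp add: integral_nonneg)
  then show "\<forall>\<^sub>F n in sequentially. e < (\<integral>x. \<bar>g n x\<bar> \<partial>M)" by simp
qed

text \<open>
  \<open>v\<close> lies in \<open>W1p_0 \<Omega> p\<close> and \<open>G\<close> is its gradient, expressed by an approximating sequence of test
  functions instead of norms and weak gradients. The lemmas \<open>W1p_0_imp_W1p_0_gradient\<close>,
  \<open>W1p_0_gradient_imp_W1p_0\<close> and \<open>W1p_0_gradient_weak_gradient\<close> show that this agrees with the
  definition of \<open>W1p_0\<close>. In this form properties of test functions pass directly to the limit;
  convergence almost everywhere, which costs a subsequence, is included because limits inside a
  nonlinear function need it.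
\<close>

definition W1p_0_gradient ::
  "(real ^ 'n) set \<Rightarrow> ('n \<Rightarrow> real) \<Rightarrow> (real ^ 'n \<Rightarrow> real) \<Rightarrow> (real ^ 'n \<Rightarrow> real ^ 'n) \<Rightarrow> bool" where
  "W1p_0_gradient \<Omega> p v G \<longleftrightarrow>
     v \<in> L_space \<Omega> 1 \<and> (\<forall>i. (\<lambda>x. G x $ i) \<in> L_space \<Omega> (p i)) \<and>
     (\<exists>\<phi>. (\<forall>n. \<phi> n \<in> test_functions \<Omega>) \<and>
        (AE x in lebesgue_on \<Omega>. (\<lambda>n. \<phi> n x) \<longlonglongrightarrow> v x) \<and>
        (\<lambda>n. \<integral>x. \<bar>\<phi> n x - v x\<bar> \<partial>lebesgue_on \<Omega>) \<longlonglongrightarrow> 0 \<and>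
        (\<forall>i. (\<lambda>n. \<integral>x. \<bar>partial_deriv i (\<phi> n) x - G x $ i\<bar> powr p i \<partial>lebesgue_on \<Omega>) \<longlonglongrightarrow> 0))"

locale anisotropic_space =
  fixes \<Omega> :: "(real ^ 'n) set" and p :: "'n \<Rightarrow> real"
  assumes bounded_domain: "bounded_domain \<Omega>" and exponent: "\<And>i. 1 < p i"
begin

abbreviation M where "M \<equiv> lebesgue_on \<Omega>"

lemma open_\<Omega>: "open \<Omega>" and sets_\<Omega>: "\<Omega> \<in> sets lebesgue" and lmeasurable_\<Omega>: "\<Omega> \<in> lmeasurable"
  using bounded_domain by (auto simp: bounded_domain_def intro: lmeasurable_open)

sublocale finite_measure M
  by (rule finite_measure_lebesgue_on[OF lmeasurable_\<Omega>])

lemma L_space_1_iff: "g \<in> L_space \<Omega> 1 \<longleftrightarrow> integrable M g"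
  by (auto simp: L_space_def integrable_abs_iff)

lemma L_space_integrable: "g \<in> L_space \<Omega> q \<Longrightarrow> 1 \<le> q \<Longrightarrow> integrable M g"
  by (auto simp: L_space_def intro: integrable_if_powr_integrable)

lemma L_space_cong_AE:
  assumes "AE x in M. g x = h x" "g \<in> L_space \<Omega> q"
  shows "h \<in> L_space \<Omega> q"
proof -
  have "h \<in> borel_measurable M"
    using borel_measurable_cong_AE_lebesgue_on[OF sets_\<Omega> assms(1)] assms(2) by (simp add: L_space_def)
  moreover have "AE x in M. \<bar>g x\<bar> powr q = \<bar>h x\<bar> powr q"
    using assms(1) by (rule AE_mp) auto
  ultimately show ?thesis
    using integrable_integral_cong_AE_lebesgue_on(1)[OF sets_\<Omega>] assms(2) by (auto simp: L_space_def)
qed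

lemma L_space_bound:
  assumes "g \<in> L_space \<Omega> q" "h \<in> borel_measurable M" "AE x in M. \<bar>h x\<bar> \<le> C * \<bar>g x\<bar>" "0 \<le> q" "0 \<le> C"
  shows "h \<in> L_space \<Omega> q"
proof -
  have "integrable M (\<lambda>x. \<bar>h x\<bar> powr q)"
  proof (rule Bochner_Integration.integrable_bound)
    show "integrable M (\<lambda>x. C powr q * \<bar>g x\<bar> powr q)" using assms by (simp add: L_space_def)
    show "AE x in M. norm (\<bar>h x\<bar> powr q) \<le> norm (C powr q * \<bar>g x\<bar> powr q)"
      using assms(3)
    proof (rule AE_mp, intro AE_I2 impI)
      fix x assume "\<bar>h x\<bar> \<le> C * \<bar>g x\<bar>"
      then have "\<bar>h x\<bar> powr q \<le> (C * \<bar>g x\<bar>) powr q"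
        using assms(4) by (intro powr_mono2) auto
      then show "norm (\<bar>h x\<bar> powr q) \<le> norm (C powr q * \<bar>g x\<bar> powr q)"
        using assms(5) by (simp add: powr_mult)
    qed
  qed (use assms(2) in measurable)
  then show ?thesis using assms(2) by (simp add: L_space_def)
qed

lemma L_space_diff:
  assumes "g \<in> L_space \<Omega> q" "h \<in> L_space \<Omega> q" "0 \<le> q"
  shows "(\<lambda>x. g x - h x) \<in> L_space \<Omega> q"
proof -
  have [measurable]: "g \<in> borel_measurable M" "h \<in> borel_measurable M"
    using assms by (auto simp: L_space_def)
  have "integrable M (\<lambda>x. \<bar>g x - h x\<bar> powr q)"
  proof (rule Bochner_Integration.integrable_bound)
    show "integrable M (\<lambda>x. 2 powr q * (\<bar>g x\<bar> powr q + \<bar>h x\<bar> powr q))"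
      using assms by (simp add: L_space_def)
    show "AE x in M. norm (\<bar>g x - h x\<bar> powr q) \<le> norm (2 powr q * (\<bar>g x\<bar> powr q + \<bar>h x\<bar> powr q))"
      using abs_add_powr_le[OF assms(3), of "g x" "- h x" for x] by (intro AE_I2) simp
  qed measurable
  then show ?thesis by (simp add: L_space_def)
qed

lemma test_functions_L_space:
  assumes "\<phi> \<in> test_functions \<Omega>" "0 \<le> q"
  shows "\<phi> \<in> L_space \<Omega> q" "partial_deriv i \<phi> \<in> L_space \<Omega> q"
proof -
  have *: "g \<in> L_space \<Omega> q" if "g \<in> borel_measurable borel" "\<And>x. \<bar>g x\<bar> \<le> C" for g C
  proof -
    have [measurable]: "g \<in> borel_measurable M" using that(1) by (rule borel_measurable_lebesgue_on)
    have "integrable M (\<lambda>x. \<bar>g x\<bar> powr q)"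
    proof (rule integrable_const_bound[where B = "C powr q"])
      show "AE x in M. norm (\<bar>g x\<bar> powr q) \<le> C powr q"
        using that(2) assms(2) by (intro AE_I2) (auto intro!: powr_mono2)
    qed measurable
    then show ?thesis by (simp add: L_space_def)
  qed
  obtain C where "\<And>x. \<bar>\<phi> x\<bar> \<le> C" "\<And>x i. \<bar>partial_deriv i \<phi> x\<bar> \<le> C"
    using test_functions_bounded[OF assms(1)] by blast
  then show "\<phi> \<in> L_space \<Omega> q" "partial_deriv i \<phi> \<in> L_space \<Omega> q"
    using test_functions_borel[OF assms(1)] by (auto intro!: *)
qed

lemma W1p_0_gradientE:
  assumes "W1p_0_gradient \<Omega> p v G"
  obtains \<phi> where "\<And>n. \<phi> n \<in> test_functions \<Omega>"
    "AE x in M. (\<lambda>n. \<phi> n x) \<longlonglongrightarrow> v x"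
    "(\<lambda>n. \<integral>x. \<bar>\<phi> n x - v x\<bar> \<partial>M) \<longlonglongrightarrow> 0"
    "\<And>i. (\<lambda>n. \<integral>x. \<bar>partial_deriv i (\<phi> n) x - G x $ i\<bar> powr p i \<partial>M) \<longlonglongrightarrow> 0"
    "\<And>i. (\<lambda>n. \<integral>x. \<bar>partial_deriv i (\<phi> n) x - G x $ i\<bar> \<partial>M) \<longlonglongrightarrow> 0"
proof -
  obtain \<phi> where \<phi>: "\<And>n. \<phi> n \<in> test_functions \<Omega>"
    "AE x in M. (\<lambda>n. \<phi> n x) \<longlonglongrightarrow> v x"
    "(\<lambda>n. \<integral>x. \<bar>\<phi> n x - v x\<bar> \<partial>M) \<longlonglongrightarrow> 0"
    "\<And>i. (\<lambda>n. \<integral>x. \<bar>partial_deriv i (\<phi> n) x - G x $ i\<bar> powr p i \<partial>M) \<longlonglongrightarrow> 0"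
    using assms by (auto simp: W1p_0_gradient_def)
  have "(\<lambda>n. \<integral>x. \<bar>partial_deriv i (\<phi> n) x - G x $ i\<bar> \<partial>M) \<longlonglongrightarrow> 0" for i
  proof (rule integral_abs_tendsto_0_if_powr[OF _ _ \<phi>(4)[of i]])
    have "(\<lambda>x. partial_deriv i (\<phi> n) x - G x $ i) \<in> L_space \<Omega> (p i)" for n
      using assms exponent[of i]
      by (intro L_space_diff test_functions_L_space[OF \<phi>(1)]) (auto simp: W1p_0_gradient_def)
    then show "(\<lambda>x. partial_deriv i (\<phi> n) x - G x $ i) \<in> borel_measurable M"
      "integrable M (\<lambda>x. \<bar>partial_deriv i (\<phi> n) x - G x $ i\<bar> powr p i)" for n
      by (auto simp: L_space_def)
    show "1 \<le> p i" using exponent[of i] by simp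
  qed
  with \<phi> show ?thesis by (rule that)
qed

lemma W1p_0_gradient_integrable:
  assumes "W1p_0_gradient \<Omega> p v G"
  shows "integrable M v" "integrable M (\<lambda>x. G x $ i)"
  using assms L_space_integrable[of _ "p i"] exponent[of i]
  by (auto simp: W1p_0_gradient_def L_space_1_iff intro: less_imp_le)

lemma is_weak_gradient_limit:
  assumes g: "\<And>n. is_weak_gradient \<Omega> (\<phi> n) (G n)"
    "\<And>n. integrable M (\<phi> n)" "\<And>n i. integrable M (\<lambda>x. G n x $ i)"
    and v: "integrable M v" "\<And>i. integrable M (\<lambda>x. H x $ i)"
    and lim: "(\<lambda>n. \<integral>x. \<bar>\<phi> n x - v x\<bar> \<partial>M) \<longlonglongrightarrow> 0"
      "\<And>i. (\<lambda>n. \<integral>x. \<bar>G n x $ i - H x $ i\<bar> \<partial>M) \<longlonglongrightarrow> 0"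
  shows "is_weak_gradient \<Omega> v H"
  unfolding is_weak_gradient_def
proof (intro conjI allI ballI)
  show "v \<in> L1_loc \<Omega>" "(\<lambda>x. H x $ i) \<in> L1_loc \<Omega>" for i
    using v by (auto intro: L1_locI[OF sets_\<Omega>])
  fix \<eta> i assume \<eta>: "\<eta> \<in> test_functions \<Omega>"
  obtain C where C: "\<And>x. \<bar>\<eta> x\<bar> \<le> C" "\<And>x i. \<bar>partial_deriv i \<eta> x\<bar> \<le> C"
    using test_functions_bounded[OF \<eta>] by blast
  have "(\<lambda>n. \<integral>x. \<phi> n x * partial_deriv i \<eta> x \<partial>M) \<longlonglongrightarrow> (\<integral>x. v x * partial_deriv i \<eta> x \<partial>M)"
    using C by (intro integral_mult_tendsto[where C = C] g v lim borel_measurable_lebesgue_on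
        test_functions_borel[OF \<eta>])
  moreover have "(\<lambda>n. - (\<integral>x. G n x $ i * \<eta> x \<partial>M)) \<longlonglongrightarrow> - (\<integral>x. H x $ i * \<eta> x \<partial>M)"
    using C by (intro tendsto_minus integral_mult_tendsto[where C = C] g v lim borel_measurable_lebesgue_on
        test_functions_borel[OF \<eta>])
  moreover have "(\<integral>x. \<phi> n x * partial_deriv i \<eta> x \<partial>M) = - (\<integral>x. G n x $ i * \<eta> x \<partial>M)" for n
    using g(1)[of n] \<eta> by (simp add: is_weak_gradient_def)
  ultimately show "(\<integral>x. v x * partial_deriv i \<eta> x \<partial>M) = - (\<integral>x. H x $ i * \<eta> x \<partial>M)"
    using LIMSEQ_unique by auto
qed

lemma W1p_0_gradient_weak_gradient:
  assumes "W1p_0_gradient \<Omega> p v G"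
  shows "is_weak_gradient \<Omega> v G" "AE x in M. weak_gradient \<Omega> v x = G x"
proof -
  obtain \<phi> where \<phi>: "\<And>n. \<phi> n \<in> test_functions \<Omega>"
    "(\<lambda>n. \<integral>x. \<bar>\<phi> n x - v x\<bar> \<partial>M) \<longlonglongrightarrow> 0"
    "\<And>i. (\<lambda>n. \<integral>x. \<bar>partial_deriv i (\<phi> n) x - G x $ i\<bar> \<partial>M) \<longlonglongrightarrow> 0"
    using assms by (rule W1p_0_gradientE) blast
  show 1: "is_weak_gradient \<Omega> v G"
    using \<phi> W1p_0_gradient_integrable[OF assms] test_functions_integrable[OF sets_\<Omega> \<phi>(1)]
    by (intro is_weak_gradient_limit[OF test_functions_weak_gradient[OF sets_\<Omega> \<phi>(1)]])
      (auto simp: gradient_def)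
  show "AE x in M. weak_gradient \<Omega> v x = G x"
    by (rule weak_gradient_AE_eq[OF open_\<Omega> 1])
qed

lemma W1p_norm_eq:
  assumes "is_weak_gradient \<Omega> v G"
  shows "W1p_norm \<Omega> p v = (\<integral>x. \<bar>v x\<bar> \<partial>M) + (\<Sum>i\<in>UNIV. (\<integral>x. \<bar>G x $ i\<bar> powr p i \<partial>M) powr (1 / p i))"
proof -
  have ae: "AE x in M. weak_gradient \<Omega> v x = G x"
    by (rule weak_gradient_AE_eq[OF open_\<Omega> assms])
  have "(\<integral>x. \<bar>weak_gradient \<Omega> v x $ i\<bar> powr p i \<partial>M) = (\<integral>x. \<bar>G x $ i\<bar> powr p i \<partial>M)" for i
    by (rule integrable_integral_cong_AE_lebesgue_on(2)[OF sets_\<Omega>]) (use ae in \<open>auto elim!: AE_mp\<close>)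
  then show ?thesis
    by (simp add: W1p_norm_def L_norm_def integral_nonneg)
qed

lemma W1p_0_gradient_imp_W1p_0:
  assumes "W1p_0_gradient \<Omega> p v G"
  shows "v \<in> W1p_0 \<Omega> p"
proof -
  note wg = W1p_0_gradient_weak_gradient[OF assms]
  have "\<exists>G. is_weak_gradient \<Omega> v G \<and> (\<forall>i. (\<lambda>x. G x $ i) \<in> L_space \<Omega> 1)"
    using wg(1) W1p_0_gradient_integrable(2)[OF assms] by (auto simp: L_space_1_iff)
  moreover have "(\<lambda>x. weak_gradient \<Omega> v x $ i) \<in> L_space \<Omega> (p i)" for i
  proof (rule L_space_cong_AE)
    show "(\<lambda>x. G x $ i) \<in> L_space \<Omega> (p i)" using assms by (simp add: W1p_0_gradient_def)
    show "AE x in M. G x $ i = weak_gradient \<Omega> v x $ i" using wg(2) by (rule AE_mp) auto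
  qed
  ultimately have W: "v \<in> W1p \<Omega> p"
    using assms by (auto simp: W1p_def W11_def W1p_0_gradient_def)
  obtain \<phi> where \<phi>: "\<And>n. \<phi> n \<in> test_functions \<Omega>"
    "(\<lambda>n. \<integral>x. \<bar>\<phi> n x - v x\<bar> \<partial>M) \<longlonglongrightarrow> 0"
    "\<And>i. (\<lambda>n. \<integral>x. \<bar>partial_deriv i (\<phi> n) x - G x $ i\<bar> powr p i \<partial>M) \<longlonglongrightarrow> 0"
    using assms by (rule W1p_0_gradientE) blast
  have "W1p_norm \<Omega> p (\<lambda>x. v x - \<phi> n x) = (\<integral>x. \<bar>\<phi> n x - v x\<bar> \<partial>M)
     + (\<Sum>i\<in>UNIV. (\<integral>x. \<bar>partial_deriv i (\<phi> n) x - G x $ i\<bar> powr p i \<partial>M) powr (1 / p i))" for n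
    by (subst W1p_norm_eq[OF is_weak_gradient_diff[OF sets_\<Omega> wg(1)
            test_functions_weak_gradient[OF sets_\<Omega> \<phi>(1)]]])
      (simp add: gradient_def abs_minus_commute)
  moreover have "(\<lambda>n. (\<integral>x. \<bar>\<phi> n x - v x\<bar> \<partial>M)
     + (\<Sum>i\<in>UNIV. (\<integral>x. \<bar>partial_deriv i (\<phi> n) x - G x $ i\<bar> powr p i \<partial>M) powr (1 / p i)))
     \<longlonglongrightarrow> 0 + (\<Sum>i\<in>(UNIV::'n set). 0)"
  proof (intro tendsto_add tendsto_sum \<phi>(2))
    fix i
    show "(\<lambda>n. (\<integral>x. \<bar>partial_deriv i (\<phi> n) x - G x $ i\<bar> powr p i \<partial>M) powr (1 / p i)) \<longlonglongrightarrow> 0"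
      using exponent[of i]
      by (intro tendsto_zero_powrI[OF \<phi>(3)] tendsto_const always_eventually)
        (auto simp: integral_nonneg)
  qed
  ultimately have lim: "(\<lambda>n. W1p_norm \<Omega> p (\<lambda>x. v x - \<phi> n x)) \<longlonglongrightarrow> 0" by simp
  have "\<exists>\<phi>\<in>test_functions \<Omega>. W1p_norm \<Omega> p (\<lambda>x. v x - \<phi> x) < e" if "0 < e" for e
    using order_tendstoD(2)[OF lim that] \<phi>(1) by (auto simp: eventually_sequentially)
  with W show ?thesis by (simp add: W1p_0_def)
qed

lemma W1p_0_imp_W1p_0_gradient:
  assumes "v \<in> W1p_0 \<Omega> p"
  shows "W1p_0_gradient \<Omega> p v (weak_gradient \<Omega> v)"
proof -
  let ?G = "weak_gradient \<Omega> v"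
  have W: "v \<in> W1p \<Omega> p" using assms by (simp add: W1p_0_def)
  then have wg: "is_weak_gradient \<Omega> v ?G"
    by (auto simp: W1p_def W11_def intro: weak_gradient_is_weak_gradient)
  have Lv: "v \<in> L_space \<Omega> 1" and LG: "(\<lambda>x. ?G x $ i) \<in> L_space \<Omega> (p i)" for i
    using W by (auto simp: W1p_def W11_def)
  have "\<forall>n. \<exists>\<phi>\<in>test_functions \<Omega>. W1p_norm \<Omega> p (\<lambda>x. v x - \<phi> x) < inverse (real (Suc n))"
    using assms by (simp add: W1p_0_def)
  then obtain \<phi> where \<phi>: "\<And>n. \<phi> n \<in> test_functions \<Omega>"
    "\<And>n. W1p_norm \<Omega> p (\<lambda>x. v x - \<phi> n x) < inverse (real (Suc n))"
    by metis
  have norm: "W1p_norm \<Omega> p (\<lambda>x. v x - \<phi> n x) = (\<integral>x. \<bar>\<phi> n x - v x\<bar> \<partial>M)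
     + (\<Sum>i\<in>UNIV. (\<integral>x. \<bar>partial_deriv i (\<phi> n) x - ?G x $ i\<bar> powr p i \<partial>M) powr (1 / p i))" for n
    by (subst W1p_norm_eq[OF is_weak_gradient_diff[OF sets_\<Omega> wg
            test_functions_weak_gradient[OF sets_\<Omega> \<phi>(1)]]])
      (simp add: gradient_def abs_minus_commute)
  have small: "(\<integral>x. \<bar>\<phi> n x - v x\<bar> \<partial>M) \<le> inverse (real (Suc n))"
    "(\<integral>x. \<bar>partial_deriv i (\<phi> n) x - ?G x $ i\<bar> powr p i \<partial>M) \<le> inverse (real (Suc n))" for n i
  proof -
    let ?I = "\<lambda>i. \<integral>x. \<bar>partial_deriv i (\<phi> n) x - ?G x $ i\<bar> powr p i \<partial>M"
    have I: "0 \<le> ?I i" "0 \<le> ?I i powr (1 / p i)" for i by (simp_all add: integral_nonneg)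
    have v0: "0 \<le> (\<integral>x. \<bar>\<phi> n x - v x\<bar> \<partial>M)" by (simp add: integral_nonneg)
    have lt: "(\<integral>x. \<bar>\<phi> n x - v x\<bar> \<partial>M) + (\<Sum>i\<in>UNIV. ?I i powr (1 / p i)) < inverse (real (Suc n))"
      using \<phi>(2)[of n] norm[of n] by simp
    have s0: "0 \<le> (\<Sum>i\<in>UNIV. ?I i powr (1 / p i))"
      by (intro sum_nonneg I)
    show "(\<integral>x. \<bar>\<phi> n x - v x\<bar> \<partial>M) \<le> inverse (real (Suc n))"
      using lt s0 by linarith
    have "?I i powr (1 / p i) \<le> (\<Sum>i\<in>UNIV. ?I i powr (1 / p i))"
      by (rule member_le_sum) (use I in auto)
    then have le: "?I i powr (1 / p i) \<le> inverse (real (Suc n))" using lt v0 by linarith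
    have "?I i = (?I i powr (1 / p i)) powr p i"
      using I exponent[of i] by (simp add: powr_powr)
    also have "\<dots> \<le> inverse (real (Suc n)) powr p i"
      using le I exponent[of i] by (intro powr_mono2) auto
    also have "\<dots> \<le> inverse (real (Suc n)) powr 1"
      using exponent[of i] by (intro powr_mono') (auto simp: field_simps)
    finally show "?I i \<le> inverse (real (Suc n))" by simp
  qed
  have lim1: "(\<lambda>n. \<integral>x. \<bar>\<phi> n x - v x\<bar> \<partial>M) \<longlonglongrightarrow> 0"
    by (rule tendsto_0_le[OF _ small(1) LIMSEQ_inverse_real_of_nat]) (simp add: integral_nonneg)
  have lim2: "(\<lambda>n. \<integral>x. \<bar>partial_deriv i (\<phi> n) x - ?G x $ i\<bar> powr p i \<partial>M) \<longlonglongrightarrow> 0" for i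
    by (rule tendsto_0_le[OF _ small(2) LIMSEQ_inverse_real_of_nat]) (simp add: integral_nonneg)
  obtain r where r: "strict_mono r" "AE x in M. (\<lambda>n. \<phi> (r n) x - v x) \<longlonglongrightarrow> 0"
    using tendsto_L1_AE_subseq[of M "\<lambda>n x. \<phi> n x - v x"] lim1 Lv
      test_functions_integrable(1)[OF sets_\<Omega> \<phi>(1)]
    by (auto simp: L_space_1_iff)
  have "AE x in M. (\<lambda>n. \<phi> (r n) x) \<longlonglongrightarrow> v x"
    using r(2) by (rule AE_mp) (auto intro: LIM_zero_cancel)
  moreover have "(\<lambda>n. \<integral>x. \<bar>\<phi> (r n) x - v x\<bar> \<partial>M) \<longlonglongrightarrow> 0"
    using LIMSEQ_subseq_LIMSEQ[OF lim1 r(1)] by (simp add: o_def)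
  moreover have "(\<lambda>n. \<integral>x. \<bar>partial_deriv i (\<phi> (r n)) x - ?G x $ i\<bar> powr p i \<partial>M) \<longlonglongrightarrow> 0" for i
    using LIMSEQ_subseq_LIMSEQ[OF lim2 r(1)] by (simp add: o_def)
  ultimately show ?thesis
    unfolding W1p_0_gradient_def using Lv LG \<phi>(1) by (intro conjI allI exI[of _ "\<lambda>n. \<phi> (r n)"]) auto
qed

lemma test_functions_W1p_0_gradient:
  assumes "\<phi> \<in> test_functions \<Omega>"
  shows "W1p_0_gradient \<Omega> p \<phi> (gradient \<phi>)"
  unfolding W1p_0_gradient_def
  using assms exponent[THEN less_trans[OF zero_less_one], THEN less_imp_le]
  by (intro conjI exI[of _ "\<lambda>_. \<phi>"]) (auto simp: gradient_def test_functions_L_space)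

end

section \<open>A Poincare inequality for small supports\<close>

text \<open>
  Translation along one coordinate axis after the other.
\<close>

lemma (in lipschitz_compact_support) integral_translation_le_sum:
  assumes "\<And>i. 0 \<le> h $ i"
  shows "(\<integral>x. \<bar>w (x + h) - w x\<bar> \<partial>lborel) \<le> (\<Sum>i\<in>UNIV. h $ i * (\<integral>x. \<bar>partial_deriv i w x\<bar> \<partial>lborel))"
proof -
  have int: "integrable lborel (\<lambda>x. \<bar>w (x + k + l) - w (x + l)\<bar>)" for k l
    using integrable_shift[of "k + l"] integrable_shift[of l] by (auto simp: add.assoc)
  have int0: "integrable lborel (\<lambda>x. \<bar>w (x + l) - w x\<bar>)" for l
    using int[of l 0] by simp
  have "(\<integral>x. \<bar>w (x + (\<Sum>i\<in>I. h $ i *\<^sub>R axis i 1)) - w x\<bar> \<partial>lborel)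
      \<le> (\<Sum>i\<in>I. h $ i * (\<integral>x. \<bar>partial_deriv i w x\<bar> \<partial>lborel))" if "finite I" for I
    using that
  proof (induction I rule: finite_induct)
    case (insert i I)
    let ?k = "h $ i *\<^sub>R axis i 1" and ?l = "\<Sum>i\<in>I. h $ i *\<^sub>R axis i 1 :: real ^ 'n"
    have "(\<integral>x. \<bar>w (x + (?k + ?l)) - w x\<bar> \<partial>lborel)
        \<le> (\<integral>x. \<bar>w (x + ?l + ?k) - w (x + ?l)\<bar> + \<bar>w (x + ?l) - w x\<bar> \<partial>lborel)"
    proof (rule integral_mono[OF int0])
      have "integrable lborel (\<lambda>x. \<bar>w (x + ?l + ?k) - w (x + ?l)\<bar>)"
        using int[of ?k ?l] by (simp add: add.assoc add.commute[of ?k])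
      then show "integrable lborel (\<lambda>x. \<bar>w (x + ?l + ?k) - w (x + ?l)\<bar> + \<bar>w (x + ?l) - w x\<bar>)"
        using int0 by (rule Bochner_Integration.integrable_add)
      show "\<bar>w (x + (?k + ?l)) - w x\<bar> \<le> \<bar>w (x + ?l + ?k) - w (x + ?l)\<bar> + \<bar>w (x + ?l) - w x\<bar>" for x
        by (simp add: add.assoc add.commute[of ?k])
    qed
    also have "\<dots> = (\<integral>x. \<bar>w (x + ?l + ?k) - w (x + ?l)\<bar> \<partial>lborel) + (\<integral>x. \<bar>w (x + ?l) - w x\<bar> \<partial>lborel)"
      using int[of ?k ?l] by (intro Bochner_Integration.integral_add int0)
        (simp add: add.assoc add.commute[of ?k])
    also have "(\<integral>x. \<bar>w (x + ?l + ?k) - w (x + ?l)\<bar> \<partial>lborel) = (\<integral>x. \<bar>w (x + ?k) - w x\<bar> \<partial>lborel)"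
      using lborel_translation(2)[of "\<lambda>x. \<bar>w (x + ?k) - w x\<bar>" ?l] by simp
    also have "\<dots> \<le> h $ i * (\<integral>x. \<bar>partial_deriv i w x\<bar> \<partial>lborel)"
      by (rule integral_translation_le) (rule assms)
    finally show ?case using insert by simp
  qed simp
  from this[of UNIV] show ?thesis
    using basis_expansion[of h] by (simp add: scalar_mult_eq_scaleR)
qed

text \<open>
  For every \<open>h\<close> in the cube \<open>Q\<close> of side \<open>\<delta>\<close>, the integral of \<open>\<bar>w\<bar>\<close> over \<open>A\<close> is at most the integral of
  \<open>\<bar>w (x + h) - w x\<bar>\<close>, which the derivatives control, plus the integral of \<open>\<bar>w (x + h)\<bar>\<close> over \<open>A\<close>.
  Integration over \<open>h \<in> Q\<close> and Tonelli's theorem bound the latter by the measure of \<open>A\<close> times the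
  full integral of \<open>\<bar>w\<bar>\<close>.
\<close>

lemma (in lipschitz_compact_support) integral_over_set_le:
  assumes A: "A \<in> sets borel" "emeasure lborel A < \<infinity>" and \<delta>: "0 < \<delta>"
  shows "\<delta> ^ CARD('n) * (\<integral>x. indicator A x * \<bar>w x\<bar> \<partial>lborel)
     \<le> \<delta> ^ CARD('n) * (\<delta> * (\<Sum>i\<in>UNIV. \<integral>x. \<bar>partial_deriv i w x\<bar> \<partial>lborel))
        + measure lborel A * (\<integral>x. \<bar>w x\<bar> \<partial>lborel)"
proof -
  note [measurable] = A(1)
  define Q :: "(real ^ 'n) set" where "Q = cbox 0 (\<chi> i. \<delta>)"
  have Q: "h \<in> Q \<longleftrightarrow> (\<forall>i. 0 \<le> h $ i \<and> h $ i \<le> \<delta>)" for h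
    by (simp add: Q_def mem_box_cart)
  have "measure lborel Q = \<delta> ^ CARD('n)"
    unfolding Q_def using \<delta> by (subst content_cbox_cart) (auto simp: interval_ne_empty_cart)
  moreover have "emeasure lborel Q \<noteq> \<infinity>"
    using emeasure_bounded_finite[of Q] by (simp add: Q_def less_top[symmetric])
  ultimately have emQ: "emeasure lborel Q = ennreal (\<delta> ^ CARD('n))"
    by (simp add: emeasure_eq_ennreal_measure)
  have [measurable]: "Q \<in> sets borel" by (simp add: Q_def)
  define D where "D = \<delta> * (\<Sum>i\<in>UNIV. \<integral>x. \<bar>partial_deriv i w x\<bar> \<partial>lborel)"
  define R where "R h = (\<integral>\<^sup>+x. indicator A x * ennreal \<bar>w (x + h)\<bar> \<partial>lborel)" for h
  define P where "P = (\<integral>\<^sup>+x. indicator A x * ennreal \<bar>w x\<bar> \<partial>lborel)"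
  have D0: "0 \<le> D" unfolding D_def using \<delta> by (intro mult_nonneg_nonneg sum_nonneg) (auto simp: integral_nonneg)
  have PR: "P \<le> ennreal D + R h" if h: "h \<in> Q" for h
  proof -
    have int: "integrable lborel (\<lambda>x. \<bar>w (x + h) - w x\<bar>)"
      using integrable_shift[of h] integrable_w by auto
    have "P \<le> (\<integral>\<^sup>+x. ennreal \<bar>w (x + h) - w x\<bar> + indicator A x * ennreal \<bar>w (x + h)\<bar> \<partial>lborel)"
      unfolding P_def
    proof (rule nn_integral_mono)
      fix x
      have "ennreal \<bar>w x\<bar> \<le> ennreal (\<bar>w (x + h) - w x\<bar> + \<bar>w (x + h)\<bar>)"
        by (rule ennreal_leI) linarith
      then show "indicator A x * ennreal \<bar>w x\<bar>
          \<le> ennreal \<bar>w (x + h) - w x\<bar> + indicator A x * ennreal \<bar>w (x + h)\<bar>"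
        by (cases "x \<in> A") (auto simp: ennreal_plus)
    qed
    also have "\<dots> = (\<integral>\<^sup>+x. ennreal \<bar>w (x + h) - w x\<bar> \<partial>lborel) + R h"
      unfolding R_def by (intro nn_integral_add) measurable
    also have "(\<integral>\<^sup>+x. ennreal \<bar>w (x + h) - w x\<bar> \<partial>lborel) = ennreal (\<integral>x. \<bar>w (x + h) - w x\<bar> \<partial>lborel)"
      by (intro nn_integral_eq_integral int) auto
    also have "\<dots> \<le> ennreal D"
    proof (rule ennreal_leI)
      have "(\<integral>x. \<bar>w (x + h) - w x\<bar> \<partial>lborel) \<le> (\<Sum>i\<in>UNIV. h $ i * (\<integral>x. \<bar>partial_deriv i w x\<bar> \<partial>lborel))"
        using h Q by (intro integral_translation_le_sum) auto
      also have "\<dots> \<le> (\<Sum>i\<in>UNIV. \<delta> * (\<integral>x. \<bar>partial_deriv i w x\<bar> \<partial>lborel))"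
        using h Q by (intro sum_mono mult_right_mono) (auto simp: integral_nonneg)
      finally show "(\<integral>x. \<bar>w (x + h) - w x\<bar> \<partial>lborel) \<le> D"
        by (simp add: D_def sum_distrib_left)
    qed
    finally show ?thesis by (simp add: add_right_mono)
  qed
  have wi: "(\<integral>\<^sup>+x. ennreal \<bar>w x\<bar> \<partial>lborel) = ennreal (\<integral>x. \<bar>w x\<bar> \<partial>lborel)"
    using integrable_w by (intro nn_integral_eq_integral) auto
  have [measurable]: "R \<in> borel_measurable lborel"
    unfolding R_def[abs_def] by (intro lborel.borel_measurable_nn_integral) measurable
  have "ennreal (\<delta> ^ CARD('n)) * P = (\<integral>\<^sup>+h. indicator Q h * P \<partial>lborel)"
    by (simp add: nn_integral_multc emQ)
  also have "\<dots> \<le> (\<integral>\<^sup>+h. indicator Q h * ennreal D + R h \<partial>lborel)"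
    using PR by (intro nn_integral_mono) (auto split: split_indicator)
  also have "\<dots> = ennreal (\<delta> ^ CARD('n)) * ennreal D + (\<integral>\<^sup>+h. R h \<partial>lborel)"
    by (subst nn_integral_add) (auto simp: nn_integral_multc emQ)
  also have "(\<integral>\<^sup>+h. R h \<partial>lborel) = (\<integral>\<^sup>+x. \<integral>\<^sup>+h. indicator A x * ennreal \<bar>w (x + h)\<bar> \<partial>lborel \<partial>lborel)"
    unfolding R_def by (intro lborel_pair.Fubini') measurable
  also have "\<dots> = (\<integral>\<^sup>+x. indicator A x * (\<integral>\<^sup>+h. ennreal \<bar>w (h + x)\<bar> \<partial>lborel) \<partial>lborel)"
    by (simp add: nn_integral_cmult add.commute)
  also have "(\<lambda>x. \<integral>\<^sup>+h. ennreal \<bar>w (h + x)\<bar> \<partial>lborel) = (\<lambda>x. ennreal (\<integral>x. \<bar>w x\<bar> \<partial>lborel))"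
  proof
    fix x
    have "(\<integral>\<^sup>+h. ennreal \<bar>w (h + x)\<bar> \<partial>lborel) = ennreal (\<integral>h. \<bar>w (h + x)\<bar> \<partial>lborel)"
      using integrable_shift[of x] by (intro nn_integral_eq_integral) auto
    then show "(\<integral>\<^sup>+h. ennreal \<bar>w (h + x)\<bar> \<partial>lborel) = ennreal (\<integral>x. \<bar>w x\<bar> \<partial>lborel)"
      using lborel_translation(2)[of "\<lambda>x. \<bar>w x\<bar>" x] by simp
  qed
  also have "(\<integral>\<^sup>+x. indicator A x * ennreal (\<integral>x. \<bar>w x\<bar> \<partial>lborel) \<partial>lborel)
      = ennreal (measure lborel A) * ennreal (\<integral>x. \<bar>w x\<bar> \<partial>lborel)"
    using A by (simp add: nn_integral_multc emeasure_eq_ennreal_measure less_top)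
  finally have "ennreal (\<delta> ^ CARD('n)) * P
      \<le> ennreal (\<delta> ^ CARD('n)) * ennreal D + ennreal (measure lborel A) * ennreal (\<integral>x. \<bar>w x\<bar> \<partial>lborel)" .
  moreover have "P = ennreal (\<integral>x. indicator A x * \<bar>w x\<bar> \<partial>lborel)"
  proof -
    have "integrable lborel (\<lambda>x. indicator A x * \<bar>w x\<bar>)"
      using integrable_mult_indicator[of A lborel "\<lambda>x. \<bar>w x\<bar>"] A(1) integrable_w by auto
    then have "(\<integral>\<^sup>+x. ennreal (indicator A x * \<bar>w x\<bar>) \<partial>lborel) = ennreal (\<integral>x. indicator A x * \<bar>w x\<bar> \<partial>lborel)"
      by (intro nn_integral_eq_integral) auto
    moreover have "ennreal (indicator A x * \<bar>w x\<bar>) = indicator A x * ennreal \<bar>w x\<bar>" for x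
      by (simp split: split_indicator)
    ultimately show ?thesis by (simp add: P_def)
  qed
  moreover have "0 \<le> (\<integral>x. indicator A x * \<bar>w x\<bar> \<partial>lborel)" "0 \<le> (\<integral>x. \<bar>w x\<bar> \<partial>lborel)"
    by (simp_all add: integral_nonneg)
  ultimately show ?thesis
    using \<delta> D0 unfolding D_def[symmetric]
    by (simp add: ennreal_mult[symmetric] ennreal_plus[symmetric] del: ennreal_plus)
qed

context anisotropic_space
begin

lemma W1p_0_gradient_integral_over_set_le:
  assumes W: "W1p_0_gradient \<Omega> p v G" and A: "A \<in> sets M" and \<delta>: "0 < \<delta>"
  shows "\<delta> ^ CARD('n) * (\<integral>x. \<bar>v x\<bar> * indicator A x \<partial>M)
     \<le> \<delta> ^ CARD('n) * (\<delta> * (\<Sum>i\<in>UNIV. \<integral>x. \<bar>G x $ i\<bar> \<partial>M)) + measure M A * (\<integral>x. \<bar>v x\<bar> \<partial>M)"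
proof -
  have A': "A \<in> sets lebesgue" "A \<subseteq> \<Omega>"
    using A sets_restrict_space_iff[of \<Omega> lebesgue A] sets_\<Omega> by auto
  \<comment> \<open>Tonelli's theorem was used for Borel sets; \<open>A\<close> is one up to a null set.\<close>
  obtain S N N' where S: "A = S \<union> N" "N \<subseteq> N'" "N' \<in> null_sets lborel" "S \<in> sets lborel"
    using A'(1) by (rule sets_completionE)
  have "AE x in lebesgue. x \<notin> N'"
    using S(3) by (intro AE_not_in null_sets_completionI)
  then have ae: "AE x in lebesgue. x \<in> A \<longleftrightarrow> x \<in> S"
    by (rule AE_mp) (use S in auto)
  then have aeM: "AE x in M. x \<in> A \<longleftrightarrow> x \<in> S"
    using sets_\<Omega> by (auto simp: AE_restrict_space_iff elim!: AE_mp)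
  have "emeasure lebesgue A = emeasure lebesgue S"
    using ae A' S(4) by (intro emeasure_eq_AE) auto
  then have em: "emeasure lborel S = emeasure M A"
    using S(4) A' sets_\<Omega> by (simp add: emeasure_restrict_space)
  then have meas: "measure lborel S = measure M A" by (simp add: measure_def)
  obtain \<phi> where \<phi>: "\<And>n. \<phi> n \<in> test_functions \<Omega>"
    "(\<lambda>n. \<integral>x. \<bar>\<phi> n x - v x\<bar> \<partial>M) \<longlonglongrightarrow> 0"
    "\<And>i. (\<lambda>n. \<integral>x. \<bar>partial_deriv i (\<phi> n) x - G x $ i\<bar> \<partial>M) \<longlonglongrightarrow> 0"
    using W by (rule W1p_0_gradientE) blast
  note Wi = W1p_0_gradient_integrable[OF W]
  have main: "\<delta> ^ CARD('n) * (\<integral>x. \<bar>\<phi> n x\<bar> * indicator A x \<partial>M)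
     \<le> \<delta> ^ CARD('n) * (\<delta> * (\<Sum>i\<in>UNIV. \<integral>x. \<bar>partial_deriv i (\<phi> n) x\<bar> * 1 \<partial>M))
       + measure M A * (\<integral>x. \<bar>\<phi> n x\<bar> * 1 \<partial>M)" for n
  proof -
    obtain L K where "lipschitz_compact_support (\<phi> n) L K"
      using test_functions_lipschitz_compact_support[OF \<phi>(1)] by blast
    then interpret lipschitz_compact_support "\<phi> n" L K .
    note v0 = test_functions_vanish[OF \<phi>(1)[of n]] and [measurable] = test_functions_borel[OF \<phi>(1)[of n]]
    have "(\<integral>x. \<bar>\<phi> n x\<bar> * indicator A x \<partial>M) = (\<integral>x. indicator S x * \<bar>\<phi> n x\<bar> \<partial>M)"
      by (rule integrable_integral_cong_AE_lebesgue_on(2)[OF sets_\<Omega>])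
        (use aeM in \<open>auto simp: indicator_def elim!: AE_mp\<close>)
    also have "\<dots> = (\<integral>x. indicator S x * \<bar>\<phi> n x\<bar> \<partial>lborel)"
      by (rule lebesgue_on_vanishing_outside(2)[OF sets_\<Omega>]) (use v0 S(4) in auto)
    finally have 1: "(\<integral>x. \<bar>\<phi> n x\<bar> * indicator A x \<partial>M) = (\<integral>x. indicator S x * \<bar>\<phi> n x\<bar> \<partial>lborel)" .
    have 2: "(\<integral>x. \<bar>partial_deriv i (\<phi> n) x\<bar> \<partial>M) = (\<integral>x. \<bar>partial_deriv i (\<phi> n) x\<bar> \<partial>lborel)" for i
      by (rule lebesgue_on_vanishing_outside(2)[OF sets_\<Omega>]) (use v0 in auto)
    have 3: "(\<integral>x. \<bar>\<phi> n x\<bar> \<partial>M) = (\<integral>x. \<bar>\<phi> n x\<bar> \<partial>lborel)"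
      by (rule lebesgue_on_vanishing_outside(2)[OF sets_\<Omega>]) (use v0 in auto)
    have "emeasure lborel S < \<infinity>"
      unfolding em using emeasure_finite[of A] by (simp add: less_top[symmetric])
    from integral_over_set_le[OF _ this \<delta>] S(4) show ?thesis
      by (simp add: 1 2 3 meas)
  qed
  have abs: "(\<lambda>n. \<integral>x. \<bar>f n x\<bar> * h x \<partial>M) \<longlonglongrightarrow> (\<integral>x. \<bar>g x\<bar> * h x \<partial>M)"
    if f: "\<And>n. integrable M (f n)" "integrable M g" "(\<lambda>n. \<integral>x. \<bar>f n x - g x\<bar> \<partial>M) \<longlonglongrightarrow> 0"
      and h: "h \<in> borel_measurable M" "\<And>x. \<bar>h x\<bar> \<le> 1"
    for f :: "nat \<Rightarrow> real ^ 'n \<Rightarrow> real" and g h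
  proof (rule integral_mult_tendsto[where C = 1])
    show "(\<lambda>n. \<integral>x. \<bar>\<bar>f n x\<bar> - \<bar>g x\<bar>\<bar> \<partial>M) \<longlonglongrightarrow> 0"
    proof (rule tendsto_0_le[OF _ _ f(3)])
      show "0 \<le> (\<integral>x. \<bar>\<bar>f n x\<bar> - \<bar>g x\<bar>\<bar> \<partial>M)" for n
        by (simp add: integral_nonneg)
      show "(\<integral>x. \<bar>\<bar>f n x\<bar> - \<bar>g x\<bar>\<bar> \<partial>M) \<le> (\<integral>x. \<bar>f n x - g x\<bar> \<partial>M)" for n
        using f by (intro integral_mono) (auto simp: abs_triangle_ineq3)
    qed
  qed (use f h in auto)
  have "(\<lambda>n. \<delta> ^ CARD('n) * (\<integral>x. \<bar>\<phi> n x\<bar> * indicator A x \<partial>M))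
      \<longlonglongrightarrow> \<delta> ^ CARD('n) * (\<integral>x. \<bar>v x\<bar> * indicator A x \<partial>M)"
    using A by (intro tendsto_mult tendsto_const abs Wi \<phi> test_functions_integrable[OF sets_\<Omega>]) auto
  moreover have "(\<lambda>n. \<delta> ^ CARD('n) * (\<delta> * (\<Sum>i\<in>UNIV. \<integral>x. \<bar>partial_deriv i (\<phi> n) x\<bar> * 1 \<partial>M))
       + measure M A * (\<integral>x. \<bar>\<phi> n x\<bar> * 1 \<partial>M))
      \<longlonglongrightarrow> \<delta> ^ CARD('n) * (\<delta> * (\<Sum>i\<in>UNIV. \<integral>x. \<bar>G x $ i\<bar> * 1 \<partial>M)) + measure M A * (\<integral>x. \<bar>v x\<bar> * 1 \<partial>M)"
    by (intro tendsto_add tendsto_mult tendsto_sum tendsto_const abs Wi \<phi>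
        test_functions_integrable[OF sets_\<Omega>]) auto
  ultimately have "\<delta> ^ CARD('n) * (\<integral>x. \<bar>v x\<bar> * indicator A x \<partial>M)
      \<le> \<delta> ^ CARD('n) * (\<delta> * (\<Sum>i\<in>UNIV. \<integral>x. \<bar>G x $ i\<bar> * 1 \<partial>M)) + measure M A * (\<integral>x. \<bar>v x\<bar> * 1 \<partial>M)"
    using main by (intro LIMSEQ_le) auto
  then show ?thesis by simp
qed

text \<open>
  In dimension \<open>N\<close> the constant \<open>\<delta>\<close> may be of the order of the \<open>N\<close>-th root of the measure of the
  support. This gain over the usual Poincare inequality makes the iteration over levels converge. It
  comes from absorbing the last term of \<open>W1p_0_gradient_integral_over_set_le\<close>.
\<close>

lemma W1p_0_gradient_poincare_small_support:
  assumes W: "W1p_0_gradient \<Omega> p v G" and A: "A \<in> sets M"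
    and v: "AE x in M. x \<notin> A \<longrightarrow> v x = 0"
    and \<delta>: "0 < \<delta>" "2 * measure M A \<le> \<delta> ^ CARD('n)"
  shows "(\<integral>x. \<bar>v x\<bar> \<partial>M) \<le> 2 * \<delta> * (\<Sum>i\<in>UNIV. \<integral>x. \<bar>G x $ i\<bar> \<partial>M)"
proof -
  let ?I = "\<integral>x. \<bar>v x\<bar> \<partial>M" and ?D = "\<delta> * (\<Sum>i\<in>UNIV. \<integral>x. \<bar>G x $ i\<bar> \<partial>M)"
  have "(\<integral>x. \<bar>v x\<bar> * indicator A x \<partial>M) = ?I"
    by (rule integrable_integral_cong_AE_lebesgue_on(2)[OF sets_\<Omega>])
      (use v in \<open>auto simp: indicator_def elim!: AE_mp\<close>)
  then have "\<delta> ^ CARD('n) * ?I \<le> \<delta> ^ CARD('n) * ?D + measure M A * ?I"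
    using W1p_0_gradient_integral_over_set_le[OF W A \<delta>(1)] by simp
  also have "measure M A * ?I \<le> (\<delta> ^ CARD('n) / 2) * ?I"
    using \<delta>(2) by (intro mult_right_mono) (auto simp: integral_nonneg)
  finally have "\<delta> ^ CARD('n) * ?I \<le> \<delta> ^ CARD('n) * (2 * ?D)" by simp
  then show ?thesis using \<delta>(1) by simp
qed

section \<open>Functions of a function with zero boundary values\<close>

text \<open>
  As \<open>\<psi>\<close> is smooth and \<open>\<psi> 0 = 0\<close>, composition with \<open>\<psi>\<close> maps test functions to test functions, and an
  approximating sequence of \<open>v\<close> is mapped to one of \<open>\<psi> \<circ> v\<close>.
\<close>

lemma W1p_0_gradient_compose:
  assumes W: "W1p_0_gradient \<Omega> p v G" and \<psi>: "smooth_real \<psi>" "\<psi> 0 = 0"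
    and \<psi>': "\<And>r. (\<psi> has_real_derivative \<psi>' r) (at r)" "\<And>r. \<bar>\<psi>' r\<bar> \<le> C"
  shows "W1p_0_gradient \<Omega> p (\<lambda>x. \<psi> (v x)) (\<lambda>x. \<psi>' (v x) *\<^sub>R G x)"
proof -
  have C0: "0 \<le> C" using \<psi>'(2)[of 0] by linarith
  have lip: "\<bar>\<psi> r - \<psi> s\<bar> \<le> C * \<bar>r - s\<bar>" for r s
    using field_differentiable_bound[of UNIV \<psi> \<psi>' C r s] \<psi>' by auto
  have cont': "continuous_on UNIV \<psi>'"
    by (rule smooth_real_continuous[OF smooth_real_deriv[OF \<psi>(1) \<psi>'(1)]])
  have cont: "continuous_on UNIV \<psi>" by (rule smooth_real_continuous[OF \<psi>(1)])
  have [measurable]: "\<psi> \<in> borel_measurable borel" "\<psi>' \<in> borel_measurable borel"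
    using cont cont' by (auto intro: borel_measurable_continuous_onI)
  have [measurable]: "v \<in> borel_measurable M" and Gm[measurable]: "(\<lambda>x. G x $ i) \<in> borel_measurable M" for i
    using W by (auto simp: W1p_0_gradient_def L_space_def)
  have LG: "(\<lambda>x. G x $ i) \<in> L_space \<Omega> (p i)" for i
    using W by (auto simp: W1p_0_gradient_def)
  have p0: "0 \<le> p i" "0 < p i" for i using exponent[of i] by auto
  obtain \<phi> where \<phi>: "\<And>n. \<phi> n \<in> test_functions \<Omega>"
    "AE x in M. (\<lambda>n. \<phi> n x) \<longlonglongrightarrow> v x"
    "(\<lambda>n. \<integral>x. \<bar>\<phi> n x - v x\<bar> \<partial>M) \<longlonglongrightarrow> 0"
    "\<And>i. (\<lambda>n. \<integral>x. \<bar>partial_deriv i (\<phi> n) x - G x $ i\<bar> powr p i \<partial>M) \<longlonglongrightarrow> 0"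
    using W by (rule W1p_0_gradientE) blast
  have [measurable]: "\<phi> n \<in> borel_measurable M" "partial_deriv i (\<phi> n) \<in> borel_measurable M" for n i
    using test_functions_borel[OF \<phi>(1)] by (auto intro: borel_measurable_lebesgue_on)
  have pd: "partial_deriv i (\<lambda>x. \<psi> (\<phi> n x)) x = \<psi>' (\<phi> n x) * partial_deriv i (\<phi> n) x" for i n x
    by (intro partial_deriv_compose differentiable_on_UNIV_smooth test_functions_smooth[OF \<phi>(1)] \<psi>'(1))
  show ?thesis
    unfolding W1p_0_gradient_def
  proof (intro conjI allI exI[of _ "\<lambda>n x. \<psi> (\<phi> n x)"])
    show "(\<lambda>x. \<psi> (v x)) \<in> L_space \<Omega> 1"
    proof (rule L_space_bound[where g = v and C = C])
      show "AE x in M. \<bar>\<psi> (v x)\<bar> \<le> C * \<bar>v x\<bar>"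
        using lip[of _ 0] \<psi>(2) by simp
    qed (use W C0 in \<open>auto simp: W1p_0_gradient_def\<close>)
    show "(\<lambda>x. (\<psi>' (v x) *\<^sub>R G x) $ i) \<in> L_space \<Omega> (p i)" for i
    proof (rule L_space_bound[OF LG, where C = C])
      show "AE x in M. \<bar>(\<psi>' (v x) *\<^sub>R G x) $ i\<bar> \<le> C * \<bar>G x $ i\<bar>"
        using \<psi>'(2) by (simp add: abs_mult mult_right_mono)
    qed (use p0 C0 in auto)
    show "(\<lambda>x. \<psi> (\<phi> n x)) \<in> test_functions \<Omega>" for n
      by (rule test_functions_compose[OF \<phi>(1) \<psi>])
    show "AE x in M. (\<lambda>n. \<psi> (\<phi> n x)) \<longlonglongrightarrow> \<psi> (v x)"
      using \<phi>(2)
    proof (rule AE_mp, intro AE_I2 impI)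
      fix x assume "(\<lambda>n. \<phi> n x) \<longlonglongrightarrow> v x"
      then show "(\<lambda>n. \<psi> (\<phi> n x)) \<longlonglongrightarrow> \<psi> (v x)"
        by (intro continuous_on_tendsto_compose[OF cont]) auto
    qed
    show "(\<lambda>n. \<integral>x. \<bar>\<psi> (\<phi> n x) - \<psi> (v x)\<bar> \<partial>M) \<longlonglongrightarrow> 0"
    proof (rule tendsto_0_le)
      show "0 \<le> (\<integral>x. \<bar>\<psi> (\<phi> n x) - \<psi> (v x)\<bar> \<partial>M)" for n
        by (simp add: integral_nonneg)
      show "(\<integral>x. \<bar>\<psi> (\<phi> n x) - \<psi> (v x)\<bar> \<partial>M) \<le> (\<integral>x. C * \<bar>\<phi> n x - v x\<bar> \<partial>M)" for n
        using W1p_0_gradient_integrable[OF W] test_functions_integrable[OF sets_\<Omega> \<phi>(1)] C0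
        by (intro integral_mono_AE') (auto simp: lip)
      show "(\<lambda>n. \<integral>x. C * \<bar>\<phi> n x - v x\<bar> \<partial>M) \<longlonglongrightarrow> 0"
        using tendsto_mult[OF tendsto_const \<phi>(3), of C] by simp
    qed
    fix i
    let ?d = "\<lambda>n x. \<bar>partial_deriv i (\<phi> n) x - G x $ i\<bar> powr p i"
    let ?e = "\<lambda>n x. \<bar>(\<psi>' (\<phi> n x) - \<psi>' (v x)) * G x $ i\<bar> powr p i"
    have di: "integrable M (?d n)" for n
      using L_space_diff[OF test_functions_L_space(2)[OF \<phi>(1) p0(1)] LG p0(1)] by (simp add: L_space_def)
    have dom: "integrable M (\<lambda>x. (2 * C) powr p i * \<bar>G x $ i\<bar> powr p i)"
      using LG by (simp add: L_space_def)
    have le: "?e n x \<le> (2 * C) powr p i * \<bar>G x $ i\<bar> powr p i" for n x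
    proof -
      have "\<bar>\<psi>' (\<phi> n x) - \<psi>' (v x)\<bar> \<le> 2 * C"
        using \<psi>'(2)[of "\<phi> n x"] \<psi>'(2)[of "v x"] by linarith
      then have "\<bar>(\<psi>' (\<phi> n x) - \<psi>' (v x)) * G x $ i\<bar> \<le> 2 * C * \<bar>G x $ i\<bar>"
        by (simp add: abs_mult mult_right_mono)
      then have "?e n x \<le> (2 * C * \<bar>G x $ i\<bar>) powr p i"
        using p0 by (intro powr_mono2) auto
      then show ?thesis using C0 by (simp add: powr_mult)
    qed
    have ei: "integrable M (?e n)" for n
      by (rule Bochner_Integration.integrable_bound[OF dom]) (auto simp: le)
    have e0: "(\<lambda>n. \<integral>x. ?e n x \<partial>M) \<longlonglongrightarrow> (\<integral>x. 0 \<partial>M)"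
    proof (rule integral_dominated_convergence[OF _ _ dom])
      show "AE x in M. (\<lambda>n. ?e n x) \<longlonglongrightarrow> 0"
        using \<phi>(2)
      proof (rule AE_mp, intro AE_I2 impI)
        fix x assume "(\<lambda>n. \<phi> n x) \<longlonglongrightarrow> v x"
        then have "(\<lambda>n. \<psi>' (\<phi> n x)) \<longlonglongrightarrow> \<psi>' (v x)"
          by (intro continuous_on_tendsto_compose[OF cont']) auto
        then have "(\<lambda>n. \<bar>(\<psi>' (\<phi> n x) - \<psi>' (v x)) * G x $ i\<bar>) \<longlonglongrightarrow> \<bar>(\<psi>' (v x) - \<psi>' (v x)) * G x $ i\<bar>"
          by (intro tendsto_intros)
        then show "(\<lambda>n. ?e n x) \<longlonglongrightarrow> 0"
          using p0 by (intro tendsto_zero_powrI[OF _ tendsto_const]) auto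
      qed
    qed (auto simp: le)
    \<comment> \<open>The error splits into \<open>\<psi>' \<circ> \<phi> n\<close> times the error of the gradients, and an error of \<open>\<psi>' \<circ> \<phi> n\<close> that is treated by dominated convergence.\<close>
    have bound: "(\<integral>x. \<bar>\<psi>' (\<phi> n x) * partial_deriv i (\<phi> n) x - \<psi>' (v x) * G x $ i\<bar> powr p i \<partial>M)
        \<le> 2 powr p i * (C powr p i * (\<integral>x. ?d n x \<partial>M) + (\<integral>x. ?e n x \<partial>M))" for n
    proof -
      have "(\<integral>x. \<bar>\<psi>' (\<phi> n x) * partial_deriv i (\<phi> n) x - \<psi>' (v x) * G x $ i\<bar> powr p i \<partial>M)
          \<le> (\<integral>x. 2 powr p i * (C powr p i * ?d n x + ?e n x) \<partial>M)"
      proof (rule integral_mono_AE')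
        show "integrable M (\<lambda>x. 2 powr p i * (C powr p i * ?d n x + ?e n x))"
          using di ei by (intro integrable_mult_right Bochner_Integration.integrable_add)
        show "AE x in M. \<bar>\<psi>' (\<phi> n x) * partial_deriv i (\<phi> n) x - \<psi>' (v x) * G x $ i\<bar> powr p i
            \<le> 2 powr p i * (C powr p i * ?d n x + ?e n x)"
        proof (rule AE_I2)
          fix x
          let ?a = "\<psi>' (\<phi> n x) * (partial_deriv i (\<phi> n) x - G x $ i)"
          have "\<bar>?a\<bar> powr p i \<le> (C * \<bar>partial_deriv i (\<phi> n) x - G x $ i\<bar>) powr p i"
            using p0 \<psi>'(2) by (intro powr_mono2) (auto simp: abs_mult mult_right_mono)
          then have a: "\<bar>?a\<bar> powr p i \<le> C powr p i * ?d n x"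
            using C0 by (simp add: powr_mult)
          have "\<psi>' (\<phi> n x) * partial_deriv i (\<phi> n) x - \<psi>' (v x) * G x $ i
              = ?a + (\<psi>' (\<phi> n x) - \<psi>' (v x)) * G x $ i"
            by (simp add: algebra_simps)
          then have "\<bar>\<psi>' (\<phi> n x) * partial_deriv i (\<phi> n) x - \<psi>' (v x) * G x $ i\<bar> powr p i
              \<le> 2 powr p i * (\<bar>?a\<bar> powr p i + ?e n x)"
            using abs_add_powr_le[OF p0(1)] by simp
          also have "\<dots> \<le> 2 powr p i * (C powr p i * ?d n x + ?e n x)"
            using a by (intro mult_left_mono add_right_mono) auto
          finally show "\<bar>\<psi>' (\<phi> n x) * partial_deriv i (\<phi> n) x - \<psi>' (v x) * G x $ i\<bar> powr p i
              \<le> 2 powr p i * (C powr p i * ?d n x + ?e n x)" .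
        qed
      qed simp
      also have "\<dots> = 2 powr p i * (C powr p i * (\<integral>x. ?d n x \<partial>M) + (\<integral>x. ?e n x \<partial>M))"
        using di ei by (simp add: distrib_left)
      finally show ?thesis .
    qed
    show "(\<lambda>n. \<integral>x. \<bar>partial_deriv i (\<lambda>x. \<psi> (\<phi> n x)) x - (\<psi>' (v x) *\<^sub>R G x) $ i\<bar> powr p i \<partial>M) \<longlonglongrightarrow> 0"
      unfolding pd vector_scaleR_component real_scaleR_def
    proof (rule tendsto_0_le[OF _ bound])
      show "0 \<le> (\<integral>x. \<bar>\<psi>' (\<phi> n x) * partial_deriv i (\<phi> n) x - \<psi>' (v x) * G x $ i\<bar> powr p i \<partial>M)" for n
        by (simp add: integral_nonneg)
      have "(\<lambda>n. 2 powr p i * (C powr p i * (\<integral>x. ?d n x \<partial>M) + (\<integral>x. ?e n x \<partial>M)))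
          \<longlonglongrightarrow> 2 powr p i * (C powr p i * 0 + (\<integral>x. 0 \<partial>M))"
        by (intro tendsto_mult tendsto_add tendsto_const \<phi>(4) e0)
      then show "(\<lambda>n. 2 powr p i * (C powr p i * (\<integral>x. ?d n x \<partial>M) + (\<integral>x. ?e n x \<partial>M))) \<longlonglongrightarrow> 0" by simp
    qed
  qed
qed

text \<open>
  If \<open>Q\<close> is the antiderivative of \<open>q\<close> with \<open>Q 0 = 0\<close>, then \<open>q \<circ> v\<close> times the \<open>i\<close>-th component of the
  gradient is the \<open>i\<close>-th derivative of \<open>Q \<circ> v\<close>, a function that vanishes on the boundary. With a
  test function \<open>\<phi>\<close> in place of \<open>v\<close>, the function \<open>Q \<circ> \<phi>\<close> is Lipschitz and differentiable, and that
  suffices for its partial derivatives to integrate to 0.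
\<close>

lemma W1p_0_gradient_integral_compose_eq_0:
  assumes W: "W1p_0_gradient \<Omega> p v G" and q: "continuous_on UNIV q" "\<And>r. \<bar>q r\<bar> \<le> C"
  shows "integrable M (\<lambda>x. q (v x) * G x $ i)" "(\<integral>x. q (v x) * G x $ i \<partial>M) = 0"
proof -
  have C0: "0 \<le> C" using q(2)[of 0] by linarith
  have [measurable]: "q \<in> borel_measurable borel"
    using q(1) by (rule borel_measurable_continuous_onI)
  have [measurable]: "v \<in> borel_measurable M" "(\<lambda>x. G x $ i) \<in> borel_measurable M" for i
    using W by (auto simp: W1p_0_gradient_def L_space_def)
  note Wi = W1p_0_gradient_integrable[OF W]
  have mult: "integrable M (\<lambda>x. q (g x) * h x)" if "g \<in> borel_measurable M" "integrable M h" for g h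
  proof (rule Bochner_Integration.integrable_bound)
    show "integrable M (\<lambda>x. C * h x)" using that by simp
    show "AE x in M. norm (q (g x) * h x) \<le> norm (C * h x)"
      using q(2) C0 by (intro AE_I2) (auto simp: abs_mult intro!: mult_right_mono)
  qed (use that in measurable)
  show "integrable M (\<lambda>x. q (v x) * G x $ i)"
    by (intro mult Wi) measurable
  obtain \<phi> where \<phi>: "\<And>n. \<phi> n \<in> test_functions \<Omega>"
    "AE x in M. (\<lambda>n. \<phi> n x) \<longlonglongrightarrow> v x"
    "\<And>i. (\<lambda>n. \<integral>x. \<bar>partial_deriv i (\<phi> n) x - G x $ i\<bar> \<partial>M) \<longlonglongrightarrow> 0"
    using W by (rule W1p_0_gradientE) blast
  have [measurable]: "\<phi> n \<in> borel_measurable M" for n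
    using test_functions_borel[OF \<phi>(1)] by (auto intro: borel_measurable_lebesgue_on)
  note \<phi>i = test_functions_integrable[OF sets_\<Omega> \<phi>(1)]
  obtain Q where Q: "\<And>r. (Q has_real_derivative q r) (at r)" "Q 0 = 0"
    using smooth_real_antiderivative[of q] q(1) by (auto simp: continuous_on_eq_continuous_at)
  have zero: "(\<integral>x. q (\<phi> n x) * partial_deriv i (\<phi> n) x \<partial>M) = 0" for n
  proof -
    obtain L K where "lipschitz_compact_support (\<phi> n) L K"
      using test_functions_lipschitz_compact_support[OF \<phi>(1)] by blast
    then interpret F: lipschitz_compact_support "\<phi> n" L K .
    have lipQ: "C-lipschitz_on UNIV Q"
      using field_differentiable_bound[of UNIV Q q C] Q(1) q(2) C0
      by (intro lipschitz_onI) (auto simp: dist_norm)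
    interpret lipschitz_compact_support "\<lambda>x. Q (\<phi> n x)" "C * L" K
    proof
      show "(\<lambda>x. Q (\<phi> n x)) differentiable (at x)" for x
        using frechet_derivative_works[THEN iffD1, OF F.differentiable] Q(1)[unfolded has_field_derivative_def]
        by (intro differentiableI[OF has_derivative_compose])
      show "(C * L)-lipschitz_on UNIV (\<lambda>x. Q (\<phi> n x))"
        using lipschitz_on_compose[OF F.lipschitz, of C Q] lipschitz_on_subset[OF lipQ] by (simp add: o_def)
    qed (use F.compact F.vanish Q(2) in auto)
    have pd: "partial_deriv i (\<lambda>x. Q (\<phi> n x)) = (\<lambda>x. q (\<phi> n x) * partial_deriv i (\<phi> n) x)"
      using partial_deriv_compose[OF F.differentiable Q(1)] by blast
    have "(\<integral>x. q (\<phi> n x) * partial_deriv i (\<phi> n) x \<partial>M) = (\<integral>x. q (\<phi> n x) * partial_deriv i (\<phi> n) x \<partial>lborel)"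
      using test_functions_borel[OF \<phi>(1)] test_functions_vanish(2)[OF \<phi>(1)]
      by (intro lebesgue_on_vanishing_outside(2)[OF sets_\<Omega>]) auto
    then show ?thesis using integral_partial_deriv(2)[of i] by (simp add: pd)
  qed
  have "(\<lambda>n. \<integral>x. q (\<phi> n x) * (partial_deriv i (\<phi> n) x - G x $ i) \<partial>M) \<longlonglongrightarrow> 0"
  proof (rule Lim_null_comparison)
    have "norm (\<integral>x. q (\<phi> n x) * (partial_deriv i (\<phi> n) x - G x $ i) \<partial>M)
        \<le> C * (\<integral>x. \<bar>partial_deriv i (\<phi> n) x - G x $ i\<bar> \<partial>M)" for n
    proof -
      have "norm (\<integral>x. q (\<phi> n x) * (partial_deriv i (\<phi> n) x - G x $ i) \<partial>M)
          \<le> (\<integral>x. norm (q (\<phi> n x) * (partial_deriv i (\<phi> n) x - G x $ i)) \<partial>M)"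
        by (rule integral_norm_bound)
      also have "\<dots> \<le> (\<integral>x. C * \<bar>partial_deriv i (\<phi> n) x - G x $ i\<bar> \<partial>M)"
        using \<phi>i Wi q(2) C0 by (intro integral_mono_AE') (auto simp: abs_mult intro!: mult_right_mono)
      finally show ?thesis by simp
    qed
    then show "\<forall>\<^sub>F n in sequentially. norm (\<integral>x. q (\<phi> n x) * (partial_deriv i (\<phi> n) x - G x $ i) \<partial>M)
        \<le> C * (\<integral>x. \<bar>partial_deriv i (\<phi> n) x - G x $ i\<bar> \<partial>M)" by simp
    show "(\<lambda>n. C * (\<integral>x. \<bar>partial_deriv i (\<phi> n) x - G x $ i\<bar> \<partial>M)) \<longlonglongrightarrow> 0"
      using tendsto_mult[OF tendsto_const \<phi>(3), of C i] by simp
  qed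
  moreover have "(\<integral>x. q (\<phi> n x) * (partial_deriv i (\<phi> n) x - G x $ i) \<partial>M)
      = - (\<integral>x. q (\<phi> n x) * G x $ i \<partial>M)" for n
    using zero[of n] mult[OF _ \<phi>i(2)[of i n]] mult[OF _ Wi(2)[of i]]
    by (simp add: right_diff_distrib)
  ultimately have "(\<lambda>n. - (\<integral>x. q (\<phi> n x) * G x $ i \<partial>M)) \<longlonglongrightarrow> 0" by simp
  then have "(\<lambda>n. \<integral>x. q (\<phi> n x) * G x $ i \<partial>M) \<longlonglongrightarrow> 0"
    by (auto dest: tendsto_minus)
  moreover have "(\<lambda>n. \<integral>x. q (\<phi> n x) * G x $ i \<partial>M) \<longlonglongrightarrow> (\<integral>x. q (v x) * G x $ i \<partial>M)"
  proof (rule integral_dominated_convergence[where w = "\<lambda>x. C * \<bar>G x $ i\<bar>"])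
    show "AE x in M. (\<lambda>n. q (\<phi> n x) * G x $ i) \<longlonglongrightarrow> q (v x) * G x $ i"
      using \<phi>(2)
    proof (rule AE_mp, intro AE_I2 impI)
      fix x assume "(\<lambda>n. \<phi> n x) \<longlonglongrightarrow> v x"
      then show "(\<lambda>n. q (\<phi> n x) * G x $ i) \<longlonglongrightarrow> q (v x) * G x $ i"
        by (intro tendsto_mult tendsto_const continuous_on_tendsto_compose[OF q(1)]) auto
    qed
  qed (use Wi q(2) in \<open>auto simp: abs_mult intro!: mult_right_mono\<close>)
  ultimately show "(\<integral>x. q (v x) * G x $ i \<partial>M) = 0"
    using LIMSEQ_unique by blast
qed

end

section \<open>Cut-offs, truncations and generalized gradients\<close>

definition cutoff :: "real \<Rightarrow> real \<Rightarrow> (real \<Rightarrow> real) \<Rightarrow> (real \<Rightarrow> real) \<Rightarrow> bool" where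
  "cutoff C j h h' \<longleftrightarrow> smooth_real h \<and> (\<forall>r. (h has_real_derivative h' r) (at r)) \<and>
      (\<forall>r. 0 \<le> h r \<and> h r \<le> 1) \<and> (\<forall>r. \<bar>r\<bar> \<le> j \<longrightarrow> h r = 1) \<and> (\<forall>r. j + 1 \<le> \<bar>r\<bar> \<longrightarrow> h r = 0) \<and>
      (\<forall>r. \<bar>h' r\<bar> \<le> C) \<and> (\<forall>r. \<bar>r\<bar> \<le> j \<or> j + 1 \<le> \<bar>r\<bar> \<longrightarrow> h' r = 0)"

text \<open>
  \<open>h\<close> falls from 1 to 0 over unit length wherever \<open>j\<close> lies, which is why one bound \<open>Mh\<close> for the
  slope serves all \<open>j\<close>.
\<close>

lemma cutoff_exists:
  obtains Mh :: real where "0 \<le> Mh"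
    "\<And>j. 0 \<le> j \<Longrightarrow> \<exists>h h'. cutoff Mh j h h'"
proof -
  obtain S S' :: "real \<Rightarrow> real" and c where S: "smooth_real S" "\<And>x. (S has_real_derivative S' x) (at x)" "0 < c"
    "\<And>x. x \<le> 0 \<Longrightarrow> S x = 0" "\<And>x. 1 \<le> x \<Longrightarrow> S x = c" "\<And>x. 0 \<le> S x" "\<And>x. S x \<le> c"
    "\<And>x. 0 \<le> S' x" "\<And>x. S' x \<le> 1" "\<And>x. x \<le> 0 \<or> 1 \<le> x \<Longrightarrow> S' x = 0"
    by (rule smooth_step_exists) blast
  show ?thesis
  proof (rule that[of "inverse (c * c) * (2 * c)"])
    show "0 \<le> inverse (c * c) * (2 * c)" using S(3) by simp
    fix j :: real assume j: "0 \<le> j"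
    define h where "h r = inverse (c * c) * (S (j + 1 - r) * S (j + 1 + r))" for r
    define h' where "h' r = inverse (c * c) * (S' (j + 1 + r) * S (j + 1 - r) - S' (j + 1 - r) * S (j + 1 + r))" for r
    have "smooth_real h"
      unfolding h_def[abs_def]
      by (intro smooth_real_mult smooth_real_compose[OF S(1)] smooth_real_diff smooth_real_add
          smooth_real_const smooth_real_ident)
    moreover have "(h has_real_derivative h' r) (at r)" for r
    proof -
      have "((\<lambda>r. S (j + 1 - r)) has_real_derivative S' (j + 1 - r) * - 1) (at r)"
        by (rule DERIV_chain2[OF S(2)]) (auto intro!: derivative_eq_intros)
      moreover have "((\<lambda>r. S (j + 1 + r)) has_real_derivative S' (j + 1 + r) * 1) (at r)"
        by (rule DERIV_chain2[OF S(2)]) (auto intro!: derivative_eq_intros)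
      ultimately have "((\<lambda>r. S (j + 1 - r) * S (j + 1 + r)) has_real_derivative
          S' (j + 1 - r) * - 1 * S (j + 1 + r) + S' (j + 1 + r) * 1 * S (j + 1 - r)) (at r)"
        by (rule DERIV_mult)
      from DERIV_cmult[OF this, of "inverse (c * c)"] show ?thesis
        unfolding h_def[abs_def] h'_def by (simp add: algebra_simps)
    qed
    moreover have "0 \<le> h r \<and> h r \<le> 1" for r
    proof -
      have "S (j + 1 - r) * S (j + 1 + r) \<le> c * c"
        using S by (intro mult_mono) (auto intro: less_imp_le)
      then have "h r \<le> inverse (c * c) * (c * c)"
        unfolding h_def using S(3) by (intro mult_left_mono) auto
      moreover have "inverse (c * c) * (c * c) = 1"
        using S(3) by (intro left_inverse) simp
      ultimately show ?thesis using S(6) by (simp add: h_def)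
    qed
    moreover have "h r = 1" if "\<bar>r\<bar> \<le> j" for r
    proof -
      have "S (j + 1 - r) = c" "S (j + 1 + r) = c" using that by (auto intro!: S(5))
      moreover have "inverse (c * c) * (c * c) = 1"
        using S(3) by (intro left_inverse) simp
      ultimately show ?thesis by (simp add: h_def)
    qed
    moreover have "h r = 0" if "j + 1 \<le> \<bar>r\<bar>" for r
    proof -
      have "j + 1 - r \<le> 0 \<or> j + 1 + r \<le> 0" using that by linarith
      then show ?thesis using S(4) by (auto simp: h_def)
    qed
    moreover have "\<bar>h' r\<bar> \<le> inverse (c * c) * (2 * c)" for r
    proof -
      have "S' (j + 1 + r) * S (j + 1 - r) \<le> 1 * c" "S' (j + 1 - r) * S (j + 1 + r) \<le> 1 * c"
        using S by (intro mult_mono; simp)+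
      moreover have "0 \<le> S' (j + 1 + r) * S (j + 1 - r)" "0 \<le> S' (j + 1 - r) * S (j + 1 + r)"
        using S by auto
      ultimately have "\<bar>S' (j + 1 + r) * S (j + 1 - r) - S' (j + 1 - r) * S (j + 1 + r)\<bar> \<le> 2 * c"
        by linarith
      then show ?thesis
        unfolding h'_def abs_mult using S(3) by (intro mult_mono) auto
    qed
    moreover have "h' r = 0" if "\<bar>r\<bar> \<le> j \<or> j + 1 \<le> \<bar>r\<bar>" for r
    proof -
      have "j + 1 + r \<le> 0 \<or> 1 \<le> j + 1 + r \<or> j + 1 - r \<le> 0" "j + 1 - r \<le> 0 \<or> 1 \<le> j + 1 - r \<or> j + 1 + r \<le> 0"
        using that by linarith+
      then have "S' (j + 1 + r) * S (j + 1 - r) = 0" "S' (j + 1 - r) * S (j + 1 + r) = 0"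
        using S(4,10) by (metis mult_eq_0_iff)+
      then have "S' (j + 1 + r) * S (j + 1 - r) - S' (j + 1 - r) * S (j + 1 + r) = 0" by linarith
      then show ?thesis by (simp only: h'_def mult_zero_right)
    qed
    ultimately show "\<exists>h h'. cutoff (inverse (c * c) * (2 * c)) j h h'"
      unfolding cutoff_def by blast
  qed
qed

lemma trunc_approximation_error_nonneg:
  fixes \<psi> \<psi>' :: "real \<Rightarrow> real"
  assumes \<psi>: "\<And>r. (\<psi> has_real_derivative \<psi>' r) (at r)" "\<psi> 0 = 0"
    and \<psi>': "\<And>r. 0 \<le> \<psi>' r" "\<And>r. \<psi>' r \<le> 1"
      "\<And>r. \<bar>r\<bar> \<le> k - \<eta> \<Longrightarrow> \<psi>' r = 1" "\<And>r. k \<le> \<bar>r\<bar> \<Longrightarrow> \<psi>' r = 0"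
    and \<eta>: "0 \<le> \<eta>" "\<eta> \<le> k" and r: "0 \<le> r"
  shows "\<bar>\<psi> r - min r k\<bar> \<le> \<eta>"
proof -
  have mono: "\<psi> s \<le> \<psi> t" if "s \<le> t" for s t
    by (rule DERIV_nonneg_imp_nondecreasing[OF that]) (use \<psi>(1) \<psi>'(1) in blast)
  have le: "\<psi> t \<le> t" if "0 \<le> t" for t
  proof -
    have "0 - \<psi> 0 \<le> t - \<psi> t"
    proof (rule DERIV_nonneg_imp_nondecreasing[OF that])
      fix x show "\<exists>y. ((\<lambda>t. t - \<psi> t) has_real_derivative y) (at x) \<and> 0 \<le> y"
        using \<psi>'(2)[of x] by (intro exI[of _ "1 - \<psi>' x"]) (auto intro!: derivative_intros \<psi>(1))
    qed
    then show ?thesis using \<psi>(2) by simp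
  qed
  have ge: "t \<le> \<psi> t" if t: "0 \<le> t" "t \<le> k - \<eta>" for t
  proof -
    have "\<psi> 0 - 0 \<le> \<psi> t - t"
    proof (rule DERIV_nonneg_imp_nondecreasing[OF t(1)])
      fix x assume "0 \<le> x" "x \<le> t"
      then have "\<psi>' x = 1" using t by (intro \<psi>'(3)) auto
      then show "\<exists>y. ((\<lambda>t. \<psi> t - t) has_real_derivative y) (at x) \<and> 0 \<le> y"
        using DERIV_diff[OF \<psi>(1)[of x] DERIV_ident] by (intro exI[of _ "\<psi>' x - 1"]) simp
    qed
    then show ?thesis using \<psi>(2) by simp
  qed
  have flat: "\<psi> t \<le> \<psi> k" if "k \<le> t" for t
  proof (rule DERIV_nonpos_imp_nonincreasing[OF that])
    fix x assume "k \<le> x"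
    then have "\<psi>' x = 0" by (intro \<psi>'(4)) auto
    then show "\<exists>y. (\<psi> has_real_derivative y) (at x) \<and> y \<le> 0" using \<psi>(1)[of x] by auto
  qed
  have "\<psi> r \<le> min r k"
    using le[of r] le[of k] flat[of r] r \<eta> by (cases "r \<le> k") auto
  moreover have "min r k - \<eta> \<le> \<psi> r"
    using ge[of r] ge[of "k - \<eta>"] mono[of "k - \<eta>" r] r \<eta> by (cases "r \<le> k - \<eta>") auto
  ultimately show ?thesis using \<eta> by linarith
qed

lemma trunc_approximation_error:
  fixes \<psi> \<psi>' :: "real \<Rightarrow> real"
  assumes \<psi>: "\<And>r. (\<psi> has_real_derivative \<psi>' r) (at r)" "\<psi> 0 = 0"
    and \<psi>': "\<And>r. 0 \<le> \<psi>' r" "\<And>r. \<psi>' r \<le> 1"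
      "\<And>r. \<bar>r\<bar> \<le> k - \<eta> \<Longrightarrow> \<psi>' r = 1" "\<And>r. k \<le> \<bar>r\<bar> \<Longrightarrow> \<psi>' r = 0"
    and \<eta>: "0 \<le> \<eta>" "\<eta> \<le> k"
  shows "\<bar>\<psi> r - trunc k r\<bar> \<le> \<eta>"
proof (cases "0 \<le> r")
  case True
  then have "trunc k r = min r k" using \<eta> by (simp add: trunc_def)
  then show ?thesis
    using trunc_approximation_error_nonneg[OF assms True] by simp
next
  case False
  have "((\<lambda>r. - \<psi> (- r)) has_real_derivative \<psi>' (- s)) (at s)" for s
    using DERIV_minus[OF DERIV_chain2[where f = \<psi> and g = uminus and x = s, OF \<psi>(1)
        DERIV_minus[OF DERIV_ident]]] by simp
  then have "\<bar>- \<psi> (- (- r)) - min (- r) k\<bar> \<le> \<eta>"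
    by (rule trunc_approximation_error_nonneg) (use assms False in auto)
  moreover have "trunc k r = - min (- r) k" using \<eta> False by (auto simp: trunc_def)
  ultimately show ?thesis by simp
qed

text \<open>
  The derivatives converge at every point to the indicator function of the open interval
  \<open>(- k, k)\<close>, and not merely up to null sets of \<open>\<real>\<close>: the composition with an arbitrary \<open>v\<close> may well
  take the values \<open>k\<close> and \<open>- k\<close> on sets of positive measure.
\<close>

lemma trunc_smooth_approximation:
  assumes k: "0 < k"
  obtains \<psi> \<psi>' :: "nat \<Rightarrow> real \<Rightarrow> real" where
    "\<And>n. smooth_real (\<psi> n)" "\<And>n. \<psi> n 0 = 0" "\<And>n r. (\<psi> n has_real_derivative \<psi>' n r) (at r)"
    "\<And>n r. 0 \<le> \<psi>' n r" "\<And>n r. \<psi>' n r \<le> 1"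
    "\<And>r. (\<lambda>n. \<psi>' n r) \<longlonglongrightarrow> (if \<bar>r\<bar> < k then 1 else 0)"
    "\<And>n r. \<bar>\<psi> n r - trunc k r\<bar> \<le> k / Suc n"
proof -
  obtain C where "\<And>j. 0 \<le> j \<Longrightarrow> \<exists>h h'. cutoff C j h h'"
    by (rule cutoff_exists) blast
  then have "\<forall>n. \<exists>h h'. cutoff C (real n) h h'" by simp
  then obtain h h' where cut: "\<And>n. cutoff C (real n) (h n) (h' n)" by metis
  have h: "smooth_real (h n)" "0 \<le> h n r" "h n r \<le> 1" "\<bar>r\<bar> \<le> real n \<Longrightarrow> h n r = 1"
    "real n + 1 \<le> \<bar>r\<bar> \<Longrightarrow> h n r = 0" for n r
    using cut[of n] by (auto simp: cutoff_def)
  \<comment> \<open>After this dilation the cut-off falls from 1 to 0 between \<open>k - k / (n + 1)\<close> and \<open>k\<close>.\<close>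
  define \<psi>' where "\<psi>' n r = h n (r * (real (Suc n) / k))" for n r
  have sm': "smooth_real (\<psi>' n)" for n
    unfolding \<psi>'_def [abs_def]
    by (intro smooth_real_compose[OF h(1)] smooth_real_mult smooth_real_const smooth_real_ident)
  have "\<exists>\<psi>. (\<forall>r. (\<psi> has_real_derivative \<psi>' n r) (at r)) \<and> \<psi> 0 = 0" for n
  proof -
    have "isCont (\<psi>' n) x" for x
      using smooth_real_continuous[OF sm', of UNIV] by (simp add: continuous_on_eq_continuous_at)
    then show ?thesis using smooth_real_antiderivative[of "\<psi>' n"] by metis
  qed
  then obtain \<psi> where \<psi>: "\<And>n r. (\<psi> n has_real_derivative \<psi>' n r) (at r)" "\<And>n. \<psi> n 0 = 0"
    by metis
  have b: "0 \<le> \<psi>' n r" "\<psi>' n r \<le> 1" for n r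
    using h(2,3) by (auto simp: \<psi>'_def)
  have dil: "\<bar>r * (real (Suc n) / k)\<bar> = \<bar>r\<bar> * (real (Suc n) / k)" for n r
    using k by (simp add: abs_mult)
  have one: "\<psi>' n r = 1" if r: "\<bar>r\<bar> \<le> k - k / Suc n" for n r
  proof -
    have "\<bar>r\<bar> * (real (Suc n) / k) \<le> (k - k / Suc n) * (real (Suc n) / k)"
      using r k by (intro mult_right_mono) auto
    moreover have "(k - k / a) * (a / k) = a - 1" if "0 < a" for a :: real
      using k that by (simp add: field_simps)
    from this[of "real (Suc n)"] have "(k - k / Suc n) * (real (Suc n) / k) = real n" by simp
    ultimately have "\<bar>r\<bar> * (real (Suc n) / k) \<le> real n" by linarith
    then show ?thesis unfolding \<psi>'_def by (intro h(4)) (simp only: dil)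
  qed
  have zero: "\<psi>' n r = 0" if r: "k \<le> \<bar>r\<bar>" for n r
  proof -
    have "k * (real (Suc n) / k) \<le> \<bar>r\<bar> * (real (Suc n) / k)"
      using r k by (intro mult_right_mono) auto
    moreover have "k * (real (Suc n) / k) = real n + 1" using k by simp
    ultimately show ?thesis unfolding \<psi>'_def by (intro h(5)) (simp only: dil)
  qed
  have lim: "(\<lambda>n. \<psi>' n r) \<longlonglongrightarrow> (if \<bar>r\<bar> < k then 1 else 0)" for r
  proof (cases "\<bar>r\<bar> < k")
    case True
    have "(\<lambda>n. k / Suc n) \<longlonglongrightarrow> 0" by (rule LIMSEQ_Suc[OF lim_const_over_n])
    then have "\<forall>\<^sub>F n in sequentially. k / Suc n < k - \<bar>r\<bar>"
      using True by (intro order_tendstoD(2)) auto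
    then have "\<forall>\<^sub>F n in sequentially. \<psi>' n r = 1"
      by eventually_elim (auto intro!: one)
    then show ?thesis using True by (simp add: tendsto_eventually)
  qed (simp add: zero)
  have err: "\<bar>\<psi> n r - trunc k r\<bar> \<le> k / Suc n" for n r
    using k by (intro trunc_approximation_error[OF \<psi> b one zero]) (auto simp: divide_le_eq)
  show ?thesis
    by (rule that[of \<psi> \<psi>']) (use smooth_realI[OF \<psi>(1) sm'] \<psi> b lim err in blast)+
qed

context anisotropic_space
begin

lemma W1p_0_gradient_cong_AE:
  assumes W: "W1p_0_gradient \<Omega> p v G" and v: "AE x in M. v x = w x" and G: "AE x in M. G x = H x"
  shows "W1p_0_gradient \<Omega> p w H"
proof -
  have Gi: "AE x in M. G x $ i = H x $ i" for i
    using G by (rule AE_mp) auto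
  obtain \<phi> where \<phi>: "\<And>n. \<phi> n \<in> test_functions \<Omega>"
    "AE x in M. (\<lambda>n. \<phi> n x) \<longlonglongrightarrow> v x"
    "(\<lambda>n. \<integral>x. \<bar>\<phi> n x - v x\<bar> \<partial>M) \<longlonglongrightarrow> 0"
    "\<And>i. (\<lambda>n. \<integral>x. \<bar>partial_deriv i (\<phi> n) x - G x $ i\<bar> powr p i \<partial>M) \<longlonglongrightarrow> 0"
    using W by (rule W1p_0_gradientE) blast
  show ?thesis
    unfolding W1p_0_gradient_def
  proof (intro conjI allI exI[of _ \<phi>] \<phi>(1))
    show "w \<in> L_space \<Omega> 1"
      using W by (intro L_space_cong_AE[OF v]) (simp add: W1p_0_gradient_def)
    show "(\<lambda>x. H x $ i) \<in> L_space \<Omega> (p i)" for i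
      using W by (intro L_space_cong_AE[OF Gi]) (simp add: W1p_0_gradient_def)
    show "AE x in M. (\<lambda>n. \<phi> n x) \<longlonglongrightarrow> w x"
      using \<phi>(2) v by eventually_elim auto
    have "(\<integral>x. \<bar>\<phi> n x - v x\<bar> \<partial>M) = (\<integral>x. \<bar>\<phi> n x - w x\<bar> \<partial>M)" for n
      by (rule integrable_integral_cong_AE_lebesgue_on(2)[OF sets_\<Omega>])
        (use v in eventually_elim, simp)
    then show "(\<lambda>n. \<integral>x. \<bar>\<phi> n x - w x\<bar> \<partial>M) \<longlonglongrightarrow> 0" using \<phi>(3) by simp
    fix i
    have "(\<integral>x. \<bar>partial_deriv i (\<phi> n) x - G x $ i\<bar> powr p i \<partial>M)
        = (\<integral>x. \<bar>partial_deriv i (\<phi> n) x - H x $ i\<bar> powr p i \<partial>M)" for n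
      by (rule integrable_integral_cong_AE_lebesgue_on(2)[OF sets_\<Omega>])
        (use G in eventually_elim, simp)
    then show "(\<lambda>n. \<integral>x. \<bar>partial_deriv i (\<phi> n) x - H x $ i\<bar> powr p i \<partial>M) \<longlonglongrightarrow> 0"
      using \<phi>(4)[of i] by simp
  qed
qed

text \<open>
  The chain rule for the smooth approximations of \<open>trunc k\<close>, in the limit.
\<close>

lemma trunc_weak_gradient:
  assumes W: "W1p_0_gradient \<Omega> p v G" and k: "0 < k"
  shows "is_weak_gradient \<Omega> (\<lambda>x. trunc k (v x)) (\<lambda>x. if \<bar>v x\<bar> < k then G x else 0)"
proof -
  obtain \<psi> \<psi>' :: "nat \<Rightarrow> real \<Rightarrow> real" where \<psi>:
    "\<And>n. smooth_real (\<psi> n)" "\<And>n. \<psi> n 0 = 0" "\<And>n r. (\<psi> n has_real_derivative \<psi>' n r) (at r)"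
    and \<psi>': "\<And>n r. 0 \<le> \<psi>' n r" "\<And>n r. \<psi>' n r \<le> 1"
    "\<And>r. (\<lambda>n. \<psi>' n r) \<longlonglongrightarrow> (if \<bar>r\<bar> < k then 1 else 0)"
    and err: "\<And>n r. \<bar>\<psi> n r - trunc k r\<bar> \<le> k / Suc n"
    using trunc_smooth_approximation[OF k] by metis
  have W\<psi>: "W1p_0_gradient \<Omega> p (\<lambda>x. \<psi> n (v x)) (\<lambda>x. \<psi>' n (v x) *\<^sub>R G x)" for n
    by (rule W1p_0_gradient_compose[OF W \<psi>(1,2,3), where C = 1]) (use \<psi>' in auto)
  note Wi = W1p_0_gradient_integrable[OF W] and W\<psi>i = W1p_0_gradient_integrable[OF W\<psi>]
  have [measurable]: "v \<in> borel_measurable M" "(\<lambda>x. G x $ i) \<in> borel_measurable M" for i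
    using Wi by auto
  have Hi: "(if \<bar>v x\<bar> < k then G x else 0) $ i = (if \<bar>v x\<bar> < k then G x $ i else 0)" for x i
    by simp
  have int: "integrable M (\<lambda>x. if \<bar>v x\<bar> < k then G x $ i else 0)" for i
    by (rule Bochner_Integration.integrable_bound[OF Wi(2)[of i]]) auto
  have tm[measurable]: "(\<lambda>x. trunc k (v x)) \<in> borel_measurable M"
    unfolding trunc_def by measurable
  have tint: "integrable M (\<lambda>x. trunc k (v x))"
    by (rule Bochner_Integration.integrable_bound[OF Wi(1)]) (use k in \<open>auto simp: trunc_def\<close>)
  show ?thesis
  proof (rule is_weak_gradient_limit[OF W1p_0_gradient_weak_gradient(1)[OF W\<psi>] W\<psi>i])
    show "integrable M (\<lambda>x. trunc k (v x))" by (rule tint)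
    show "integrable M (\<lambda>x. (if \<bar>v x\<bar> < k then G x else 0) $ i)" for i
      unfolding Hi by (rule int)
    show "(\<lambda>n. \<integral>x. \<bar>\<psi> n (v x) - trunc k (v x)\<bar> \<partial>M) \<longlonglongrightarrow> 0"
    proof (rule tendsto_0_le)
      show "0 \<le> (\<integral>x. \<bar>\<psi> n (v x) - trunc k (v x)\<bar> \<partial>M)" for n
        by (simp add: integral_nonneg)
      have "(\<integral>x. \<bar>\<psi> n (v x) - trunc k (v x)\<bar> \<partial>M) \<le> (\<integral>x. k / Suc n \<partial>M)" for n
        using W\<psi>i(1) tint err by (intro integral_mono) auto
      then show "(\<integral>x. \<bar>\<psi> n (v x) - trunc k (v x)\<bar> \<partial>M) \<le> k / Suc n * measure M (space M)" for n
        by (simp add: mult.commute)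
      have "(\<lambda>n. k / Suc n * measure M (space M)) \<longlonglongrightarrow> 0 * measure M (space M)"
        by (intro tendsto_mult tendsto_const LIMSEQ_Suc[OF lim_const_over_n])
      then show "(\<lambda>n. k / Suc n * measure M (space M)) \<longlonglongrightarrow> 0" by simp
    qed
    fix i
    have "(\<lambda>n. \<integral>x. \<bar>\<psi>' n (v x) * G x $ i - (if \<bar>v x\<bar> < k then G x $ i else 0)\<bar> \<partial>M) \<longlonglongrightarrow> (\<integral>x. 0 \<partial>M)"
    proof (rule integral_dominated_convergence[where w = "\<lambda>x. \<bar>G x $ i\<bar>"])
      show "AE x in M. (\<lambda>n. \<bar>\<psi>' n (v x) * G x $ i - (if \<bar>v x\<bar> < k then G x $ i else 0)\<bar>) \<longlonglongrightarrow> 0"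
      proof (rule AE_I2)
        fix x
        have "(\<lambda>n. \<bar>\<psi>' n (v x) * G x $ i - (if \<bar>v x\<bar> < k then G x $ i else 0)\<bar>)
          \<longlonglongrightarrow> \<bar>(if \<bar>v x\<bar> < k then 1 else 0) * G x $ i - (if \<bar>v x\<bar> < k then G x $ i else 0)\<bar>"
          by (intro tendsto_intros \<psi>'(3))
        then show "(\<lambda>n. \<bar>\<psi>' n (v x) * G x $ i - (if \<bar>v x\<bar> < k then G x $ i else 0)\<bar>) \<longlonglongrightarrow> 0"
          by (simp split: if_splits)
      qed
      show "AE x in M. norm \<bar>\<psi>' n (v x) * G x $ i - (if \<bar>v x\<bar> < k then G x $ i else 0)\<bar> \<le> \<bar>G x $ i\<bar>" for n
      proof (rule AE_I2)
        fix x
        have "\<bar>(\<psi>' n (v x) - (if \<bar>v x\<bar> < k then 1 else 0)) * G x $ i\<bar> \<le> 1 * \<bar>G x $ i\<bar>"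
          unfolding abs_mult using \<psi>'(1,2)[of n "v x"] by (intro mult_right_mono) auto
        then show "norm \<bar>\<psi>' n (v x) * G x $ i - (if \<bar>v x\<bar> < k then G x $ i else 0)\<bar> \<le> \<bar>G x $ i\<bar>"
          by (auto simp: left_diff_distrib split: if_splits)
      qed
      show "(\<lambda>x. \<bar>\<psi>' n (v x) * G x $ i - (if \<bar>v x\<bar> < k then G x $ i else 0)\<bar>) \<in> borel_measurable M" for n
        using W\<psi>i(2)[of n i] by (auto intro!: borel_measurable_abs borel_measurable_diff simp: int[THEN borel_measurable_integrable])
    qed (use Wi in auto)
    then show "(\<lambda>n. \<integral>x. \<bar>(\<psi>' n (v x) *\<^sub>R G x) $ i - (if \<bar>v x\<bar> < k then G x else 0) $ i\<bar> \<partial>M) \<longlonglongrightarrow> 0"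
      unfolding Hi by simp
  qed
qed

end

lemma deriv_zero_const:
  fixes \<Phi> \<Phi>' :: "real \<Rightarrow> real"
  assumes "\<And>r. (\<Phi> has_real_derivative \<Phi>' r) (at r)" "s \<le> t" "\<And>r. s \<le> r \<Longrightarrow> r \<le> t \<Longrightarrow> \<Phi>' r = 0"
  shows "\<Phi> s = \<Phi> t"
proof (rule antisym)
  show "\<Phi> s \<le> \<Phi> t"
    by (rule DERIV_nonneg_imp_nondecreasing[OF assms(2)]) (use assms(1,3) in force)
  show "\<Phi> t \<le> \<Phi> s"
    by (rule DERIV_nonpos_imp_nonincreasing[OF assms(2)]) (use assms(1,3) in force)
qed

lemma borel_measurable_vecI:
  fixes f :: "'a \<Rightarrow> real ^ 'm"
  assumes "\<And>i. (\<lambda>x. f x $ i) \<in> borel_measurable N"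
  shows "f \<in> borel_measurable N"
proof (subst borel_measurable_euclidean_space, rule ballI)
  fix b :: "real ^ 'm" assume "b \<in> Basis"
  then obtain i where "b = axis i 1" by (auto simp: Basis_vec_def)
  then show "(\<lambda>x. f x \<bullet> b) \<in> borel_measurable N"
    using assms[of i] by (simp add: inner_axis)
qed

locale truncations_in_W1p_0 = anisotropic_space \<Omega> p
  for \<Omega> :: "(real ^ 'n) set" and p :: "'n \<Rightarrow> real" +
  fixes u :: "real ^ 'n \<Rightarrow> real"
  assumes u_measurable [measurable]: "u \<in> borel_measurable (lebesgue_on \<Omega>)"
    and trunc_u: "\<And>k. 0 < k \<Longrightarrow> (\<lambda>x. trunc k (u x)) \<in> W1p_0 \<Omega> p"
begin

lemma weak_gradient_trunc_trunc:
  assumes "0 < k" "k \<le> l"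
  shows "AE x in M. weak_gradient \<Omega> (\<lambda>y. trunc k (u y)) x
    = (if \<bar>u x\<bar> < k then weak_gradient \<Omega> (\<lambda>y. trunc l (u y)) x else 0)"
proof -
  have "W1p_0_gradient \<Omega> p (\<lambda>y. trunc l (u y)) (weak_gradient \<Omega> (\<lambda>y. trunc l (u y)))"
    using assms by (intro W1p_0_imp_W1p_0_gradient trunc_u) auto
  from trunc_weak_gradient[OF this assms(1)] have "is_weak_gradient \<Omega> (\<lambda>x. trunc k (trunc l (u x)))
    (\<lambda>x. if \<bar>trunc l (u x)\<bar> < k then weak_gradient \<Omega> (\<lambda>y. trunc l (u y)) x else 0)" .
  also have "(\<lambda>x. trunc k (trunc l (u x))) = (\<lambda>x. trunc k (u x))"
    using assms by (auto simp: trunc_def)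
  also have "(\<lambda>x. if \<bar>trunc l (u x)\<bar> < k then weak_gradient \<Omega> (\<lambda>y. trunc l (u y)) x else 0)
    = (\<lambda>x. if \<bar>u x\<bar> < k then weak_gradient \<Omega> (\<lambda>y. trunc l (u y)) x else 0)"
  proof
    fix x
    have "\<bar>trunc l (u x)\<bar> < k \<longleftrightarrow> \<bar>u x\<bar> < k" using assms by (auto simp: trunc_def)
    then show "(if \<bar>trunc l (u x)\<bar> < k then weak_gradient \<Omega> (\<lambda>y. trunc l (u y)) x else 0)
      = (if \<bar>u x\<bar> < k then weak_gradient \<Omega> (\<lambda>y. trunc l (u y)) x else 0)" by simp
  qed
  finally show ?thesis by (rule weak_gradient_AE_eq[OF open_\<Omega>])
qed

abbreviation Du where "Du \<equiv> generalized_gradient \<Omega> u"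

text \<open>
  By \<open>weak_gradient_trunc_trunc\<close> the gradients of the truncations are compatible. They are glued
  by using, at \<open>x\<close>, the gradient of the truncation at the least positive integer above \<open>\<bar>u x\<bar>\<close>; integer
  levels keep the number of exceptional null sets countable.
\<close>

lemma generalized_gradient_spec:
  "Du \<in> borel_measurable M \<and> (\<forall>k>0. AE x in M.
     weak_gradient \<Omega> (\<lambda>y. trunc k (u y)) x = (if \<bar>u x\<bar> < k then Du x else 0))"
proof -
  define W where "W m = weak_gradient \<Omega> (\<lambda>y. trunc (real (Suc m)) (u y))" for m
  define m where "m x = nat \<lfloor>\<bar>u x\<bar>\<rfloor>" for x
  let ?G = "\<lambda>x. W (m x) x"
  have "?G \<in> borel_measurable M"
  proof (rule measurable_compose_countable)
    show "W j \<in> borel_measurable M" for j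
    proof (rule borel_measurable_vecI)
      fix i
      have "W1p_0_gradient \<Omega> p (\<lambda>y. trunc (real (Suc j)) (u y)) (W j)"
        unfolding W_def by (intro W1p_0_imp_W1p_0_gradient trunc_u) auto
      then show "(\<lambda>x. W j x $ i) \<in> borel_measurable M"
        by (auto simp: W1p_0_gradient_def L_space_def)
    qed
    show "m \<in> measurable M (count_space UNIV)"
      unfolding m_def[abs_def] by measurable
  qed
  moreover have "\<forall>k>0. AE x in M. weak_gradient \<Omega> (\<lambda>y. trunc k (u y)) x = (if \<bar>u x\<bar> < k then ?G x else 0)"
  proof (intro allI impI)
    fix k :: real assume k: "0 < k"
    let ?Wk = "weak_gradient \<Omega> (\<lambda>y. trunc k (u y))"
    have "AE x in M. \<forall>j. (k \<le> Suc j \<longrightarrow> ?Wk x = (if \<bar>u x\<bar> < k then W j x else 0)) \<and>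
        (Suc j \<le> k \<longrightarrow> W j x = (if \<bar>u x\<bar> < Suc j then ?Wk x else 0))"
    proof (subst AE_all_countable, rule allI)
      fix j
      have "AE x in M. ?Wk x = (if \<bar>u x\<bar> < k then W j x else 0)" if "k \<le> Suc j"
        using weak_gradient_trunc_trunc[OF k that] unfolding W_def .
      moreover have "AE x in M. W j x = (if \<bar>u x\<bar> < Suc j then ?Wk x else 0)" if "Suc j \<le> k"
        using weak_gradient_trunc_trunc[OF _ that] unfolding W_def by auto
      ultimately show "AE x in M. (k \<le> Suc j \<longrightarrow> ?Wk x = (if \<bar>u x\<bar> < k then W j x else 0)) \<and>
        (Suc j \<le> k \<longrightarrow> W j x = (if \<bar>u x\<bar> < Suc j then ?Wk x else 0))"
        by (cases "k \<le> Suc j"; cases "Suc j \<le> k") (auto elim: AE_mp)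
    qed
    then show "AE x in M. ?Wk x = (if \<bar>u x\<bar> < k then ?G x else 0)"
    proof (rule AE_mp, intro AE_I2 impI)
      fix x
      assume *: "\<forall>j. (k \<le> Suc j \<longrightarrow> ?Wk x = (if \<bar>u x\<bar> < k then W j x else 0)) \<and>
        (Suc j \<le> k \<longrightarrow> W j x = (if \<bar>u x\<bar> < Suc j then ?Wk x else 0))"
      have lt: "\<bar>u x\<bar> < Suc (m x)"
        unfolding m_def by linarith
      show "?Wk x = (if \<bar>u x\<bar> < k then ?G x else 0)"
      proof (cases "k \<le> Suc (m x)")
        case True
        then show ?thesis using * by blast
      next
        case False
        then have "?G x = ?Wk x" using *[rule_format, of "m x"] lt by simp
        then show ?thesis using False lt by simp
      qed
    qed
  qed
  ultimately have "\<exists>G. G \<in> borel_measurable M \<and> (\<forall>k>0. AE x in M.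
     weak_gradient \<Omega> (\<lambda>y. trunc k (u y)) x = (if \<bar>u x\<bar> < k then G x else 0))"
    by blast
  from someI_ex[OF this] show ?thesis
    unfolding generalized_gradient_def .
qed

lemma Du_measurable [measurable]: "Du \<in> borel_measurable M"
  using generalized_gradient_spec by blast

lemma Du_component_measurable [measurable]: "(\<lambda>x. Du x $ i) \<in> borel_measurable M"
  using borel_measurable_continuous_onI[of "\<lambda>y::real ^ 'n. y $ i"]
  by (intro measurable_compose[OF Du_measurable]) (auto intro!: continuous_intros)

lemma trunc_gradient:
  assumes "0 < k"
  shows "W1p_0_gradient \<Omega> p (\<lambda>x. trunc k (u x)) (\<lambda>x. if \<bar>u x\<bar> < k then Du x else 0)"
  by (rule W1p_0_gradient_cong_AE[OF W1p_0_imp_W1p_0_gradient[OF trunc_u[OF assms]]])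
    (use generalized_gradient_spec assms in auto)

text \<open>
  \<open>\<Phi>\<close> is constant beyond \<open>k\<close> and beyond \<open>- k\<close>, hence \<open>\<Phi> \<circ> u\<close> equals \<open>\<Phi> \<circ> trunc k \<circ> u\<close>.
\<close>

lemma compose_gradient:
  assumes \<Phi>: "smooth_real \<Phi>" "\<Phi> 0 = 0" "\<And>r. (\<Phi> has_real_derivative \<Phi>' r) (at r)"
    and \<Phi>': "\<And>r. \<bar>\<Phi>' r\<bar> \<le> C" "\<And>r. k \<le> \<bar>r\<bar> \<Longrightarrow> \<Phi>' r = 0" and k: "0 < k"
  shows "W1p_0_gradient \<Omega> p (\<lambda>x. \<Phi> (u x)) (\<lambda>x. \<Phi>' (u x) *\<^sub>R Du x)"
proof -
  have "\<Phi> (trunc k r) = \<Phi> r" for r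
  proof -
    consider "\<bar>r\<bar> \<le> k" | "k \<le> r" | "r \<le> - k" by linarith
    then show ?thesis
    proof cases
      case 1
      then show ?thesis by (auto simp: trunc_def)
    next
      case 2
      then have "\<Phi> k = \<Phi> r" by (intro deriv_zero_const[OF \<Phi>(3)]) (auto intro!: \<Phi>'(2))
      then show ?thesis using 2 k by (auto simp: trunc_def)
    next
      case 3
      then have "\<Phi> r = \<Phi> (- k)" by (intro deriv_zero_const[OF \<Phi>(3)]) (use k in \<open>auto intro!: \<Phi>'(2)\<close>)
      then show ?thesis using 3 k by (auto simp: trunc_def)
    qed
  qed
  moreover have "\<Phi>' (trunc k (u x)) *\<^sub>R (if \<bar>u x\<bar> < k then Du x else 0) = \<Phi>' (u x) *\<^sub>R Du x" for x
    using \<Phi>'(2)[of "u x"] by (auto simp: trunc_def not_less)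
  ultimately show ?thesis
    using W1p_0_gradient_compose[OF trunc_gradient[OF k] \<Phi> \<Phi>'(1)] by simp
qed

end

section \<open>Caratheodory functions\<close>

text \<open>
  For a simple function \<open>G\<close> the composition is a finite sum of functions \<open>a _ \<xi>\<close>, cut off to
  measurable sets. Continuity in the second argument allows the passage to the limit.
\<close>

lemma (in anisotropic_space) caratheodory_compose_measurable:
  assumes a: "caratheodory \<Omega> a" and G: "G \<in> borel_measurable M"
  shows "(\<lambda>x. a x (G x) $ i) \<in> borel_measurable M"
proof -
  obtain s where s: "\<And>n. simple_function M (s n)" "\<And>x. x \<in> space M \<Longrightarrow> (\<lambda>n. s n x) \<longlonglongrightarrow> G x"
    using borel_measurable_implies_sequence_metric[OF G, of 0] by metis
  have proj: "(\<lambda>y::real ^ 'n. y $ i) \<in> borel_measurable borel"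
    by (intro borel_measurable_continuous_onI continuous_intros)
  have am: "(\<lambda>x. a x \<xi> $ i) \<in> borel_measurable M" for \<xi>
    using a measurable_compose[OF _ proj] by (auto simp: caratheodory_def)
  have sm: "(\<lambda>x. a x (s n x) $ i) \<in> borel_measurable M" for n
  proof -
    have "(\<lambda>x. \<Sum>y\<in>s n ` space M. indicator (s n -` {y} \<inter> space M) x * a x y $ i) \<in> borel_measurable M"
      using simple_functionD(2)[OF s(1)] am
      by (intro borel_measurable_sum borel_measurable_times borel_measurable_indicator) auto
    also have "?this \<longleftrightarrow> ?thesis"
    proof (rule measurable_cong)
      fix x assume x: "x \<in> space M"
      have "(\<Sum>y\<in>s n ` space M. indicator (s n -` {y} \<inter> space M) x * a x y $ i)
          = (\<Sum>y\<in>s n ` space M. if s n x = y then a x y $ i else 0)"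
        using x by (intro sum.cong) (auto simp: indicator_def)
      also have "\<dots> = a x (s n x) $ i"
        using x simple_functionD(1)[OF s(1)] by (subst sum.delta') auto
      finally show "(\<Sum>y\<in>s n ` space M. indicator (s n -` {y} \<inter> space M) x * a x y $ i) = a x (s n x) $ i" .
    qed
    finally show ?thesis .
  qed
  have ae: "AE x in M. lim (\<lambda>n. a x (s n x) $ i) = a x (G x) $ i"
  proof -
    have "AE x in M. continuous_on UNIV (a x)" using a by (simp add: caratheodory_def)
    then show ?thesis
    proof (rule AE_mp, intro AE_I2 impI limI)
      fix x assume "x \<in> space M" and c: "continuous_on UNIV (a x)"
      then have "(\<lambda>n. a x (s n x)) \<longlonglongrightarrow> a x (G x)"
        by (intro continuous_on_tendsto_compose[OF c] s(2)) auto
      then show "(\<lambda>n. a x (s n x) $ i) \<longlonglongrightarrow> a x (G x) $ i" by (rule tendsto_vec_nth)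
    qed
  qed
  show ?thesis
    by (rule borel_measurable_cong_AE_lebesgue_on[OF sets_\<Omega> ae]) (intro borel_measurable_lim_metric sm)
qed

section \<open>The energy estimate\<close>

lemma compactly_supported_bounded:
  fixes q :: "real \<Rightarrow> real"
  assumes "continuous_on UNIV q" "\<And>r. J \<le> \<bar>r\<bar> \<Longrightarrow> q r = 0"
  obtains C where "0 \<le> C" "\<And>r. \<bar>q r\<bar> \<le> C"
proof -
  have "compact (q ` {-J..J})"
    by (intro compact_continuous_image continuous_on_subset[OF assms(1)]) auto
  then obtain C where C: "\<And>r. r \<in> {-J..J} \<Longrightarrow> \<bar>q r\<bar> \<le> C"
    by (meson compact_imp_bounded bounded_real imageI)
  have "\<bar>q r\<bar> \<le> max C 0" for r
  proof (cases "J \<le> \<bar>r\<bar>")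
    case False
    then have "r \<in> {-J..J}" by auto
    from C[OF this] show ?thesis by simp
  qed (simp add: assms(2))
  then show ?thesis using that[of "max C 0"] by simp
qed

lemma smooth_real_C1_compact:
  assumes "smooth_real h" "\<And>r. J \<le> \<bar>r\<bar> \<Longrightarrow> h r = 0"
  shows "h \<in> C1_compact"
proof -
  obtain h' where h': "\<And>r. (h has_real_derivative h' r) (at r)" "smooth_real h'"
    using assms(1) by (rule smooth_realE) blast
  have "h C1_differentiable_on UNIV"
    unfolding C1_differentiable_on_def
    using h'(1) smooth_real_continuous[OF h'(2)]
    by (auto simp: has_real_derivative_iff_has_vector_derivative)
  moreover have "compact (closure {r. h r \<noteq> 0})"
    using assms(2) by (intro compact_closure[THEN iffD2] bounded_subset[OF bounded_closed_interval[of "-J" J]])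
      (force simp: not_le)
  ultimately show ?thesis by (simp add: C1_compact_def)
qed

lemma locally_lipschitz_continuous:
  assumes "locally_lipschitz F"
  shows "continuous_on UNIV F"
proof (rule continuous_at_imp_continuous_on, rule ballI)
  fix r :: real
  obtain e L where e: "0 < e" "L-lipschitz_on (cball r e) F"
    using assms unfolding locally_lipschitz_def by blast
  have "continuous_on (ball r e) F"
    using lipschitz_on_continuous_on[OF e(2)] by (rule continuous_on_subset) auto
  then show "isCont F r"
    using e(1) by (simp add: continuous_on_eq_continuous_at)
qed

lemma mult_le_powr_conjugate:
  fixes s t q :: real
  assumes "0 \<le> s" "0 \<le> t" "1 < q"
  shows "s * t \<le> s powr (q / (q - 1)) + t powr q"
proof -
  have "s * t \<le> s powr (q / (q - 1)) / (q / (q - 1)) + t powr q / q"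
    using assms by (intro Youngs_inequality) (auto simp: field_simps)
  also have "\<dots> \<le> s powr (q / (q - 1)) + t powr q"
  proof (rule add_mono)
    have div_le: "x / r \<le> x" if "1 \<le> r" "0 \<le> x" for x r :: real
      using that by (simp add: divide_le_eq mult_left_mono[of 1 r x, simplified])
    have "1 \<le> q / (q - 1)" using assms by (simp add: le_divide_eq)
    then show "s powr (q / (q - 1)) / (q / (q - 1)) \<le> s powr (q / (q - 1))"
      by (rule div_le) simp
    show "t powr q / q \<le> t powr q"
      by (rule div_le) (use assms in auto)
  qed
  finally show ?thesis .
qed

locale renormalized = truncations_in_W1p_0 \<Omega> p u
  for \<Omega> :: "(real ^ 'n) set" and p :: "'n \<Rightarrow> real" and u :: "real ^ 'n \<Rightarrow> real" +
  fixes \<beta> :: "real \<Rightarrow> real set" and a :: "real ^ 'n \<Rightarrow> real ^ 'n \<Rightarrow> real ^ 'n"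
    and F :: "real \<Rightarrow> real ^ 'n" and f b :: "real ^ 'n \<Rightarrow> real"
    and lam gam Cf :: real and d :: "'n \<Rightarrow> real ^ 'n \<Rightarrow> real"
  assumes F: "locally_lipschitz F"
    and beta: "monotone_graph \<beta>" "0 \<in> \<beta> 0"
    and caratheodory: "caratheodory \<Omega> a"
    and lam: "0 < lam"
    and coercive: "AE x in lebesgue_on \<Omega>. \<forall>\<xi>.
      lam * (\<Sum>i\<in>UNIV. \<bar>\<xi> $ i\<bar> powr p i) \<le> (\<Sum>i\<in>UNIV. a x \<xi> $ i * \<xi> $ i)"
    and gam: "0 < gam"
    and d: "\<And>i. d i \<in> L_space \<Omega> (p i / (p i - 1))"
    and growth: "AE x in lebesgue_on \<Omega>. \<forall>\<xi> i.
      \<bar>a x \<xi> $ i\<bar> \<le> gam * (d i x + \<bar>\<xi> $ i\<bar> powr (p i - 1))"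
    and f_measurable [measurable]: "f \<in> borel_measurable (lebesgue_on \<Omega>)"
    and Cf: "0 \<le> Cf" "AE x in lebesgue_on \<Omega>. \<bar>f x\<bar> \<le> Cf"
    and solution: "renormalized_solution \<Omega> p \<beta> a F f u b"
begin

lemma solution_conditions: "AE x in M. u x \<in> dom_graph \<beta> \<and> b x \<in> \<beta> (u x)"
  "\<forall>h \<in> C1_compact. \<forall>\<phi> \<in> W1p_0 \<Omega> p \<inter> L_infinity \<Omega>.
      (\<integral>x. b x * h (u x) * \<phi> x \<partial>M)
      + (\<integral>x. (a x (Du x) + F (u x)) \<bullet> weak_gradient \<Omega> (\<lambda>y. h (u y) * \<phi> y) x \<partial>M)
      = (\<integral>x. f x * h (u x) * \<phi> x \<partial>M)"
  "((\<lambda>j. LINT x : {x \<in> \<Omega>. j < \<bar>u x\<bar> \<and> \<bar>u x\<bar> < j + 1} | M. a x (Du x) \<bullet> Du x) \<longlongrightarrow> 0) at_top"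
proof -
  note s = solution[unfolded renormalized_solution_def]
  show "AE x in M. u x \<in> dom_graph \<beta> \<and> b x \<in> \<beta> (u x)"
    using s by (elim conjE)
  show "\<forall>h \<in> C1_compact. \<forall>\<phi> \<in> W1p_0 \<Omega> p \<inter> L_infinity \<Omega>.
      (\<integral>x. b x * h (u x) * \<phi> x \<partial>M)
      + (\<integral>x. (a x (Du x) + F (u x)) \<bullet> weak_gradient \<Omega> (\<lambda>y. h (u y) * \<phi> y) x \<partial>M)
      = (\<integral>x. f x * h (u x) * \<phi> x \<partial>M)"
    using s by (elim conjE)
  show "((\<lambda>j. LINT x : {x \<in> \<Omega>. j < \<bar>u x\<bar> \<and> \<bar>u x\<bar> < j + 1} | M. a x (Du x) \<bullet> Du x) \<longlongrightarrow> 0) at_top"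
    using s by (elim conjE)
qed

definition energy where "energy x = (\<Sum>i\<in>UNIV. a x (Du x) $ i * Du x $ i)"

lemma flux_measurable [measurable]: "(\<lambda>x. a x (Du x) $ i) \<in> borel_measurable M"
  by (rule caratheodory_compose_measurable[OF caratheodory Du_measurable])

lemma energy_measurable [measurable]: "energy \<in> borel_measurable M"
  unfolding energy_def by measurable

lemma energy_ge: "AE x in M. lam * (\<Sum>i\<in>UNIV. \<bar>Du x $ i\<bar> powr p i) \<le> energy x"
  using coercive by eventually_elim (simp add: energy_def)

lemma energy_nonneg: "AE x in M. 0 \<le> energy x"
  using energy_ge
proof eventually_elim
  case (elim x)
  have "0 \<le> lam * (\<Sum>i\<in>UNIV. \<bar>Du x $ i\<bar> powr p i)"
    using lam by (intro mult_nonneg_nonneg sum_nonneg) auto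
  with elim show ?case by linarith
qed

lemma Du_powr_integrable:
  assumes "0 < k"
  shows "integrable M (\<lambda>x. if \<bar>u x\<bar> < k then \<bar>Du x $ i\<bar> powr p i else 0)"
proof -
  have "integrable M (\<lambda>x. \<bar>(if \<bar>u x\<bar> < k then Du x else 0) $ i\<bar> powr p i)"
    using trunc_gradient[OF assms] by (simp add: W1p_0_gradient_def L_space_def)
  also have "(\<lambda>x. \<bar>(if \<bar>u x\<bar> < k then Du x else 0) $ i\<bar> powr p i)
      = (\<lambda>x. if \<bar>u x\<bar> < k then \<bar>Du x $ i\<bar> powr p i else 0)"
    by auto
  finally show ?thesis .
qed

lemma flux_times_Du_integrable:
  assumes k: "0 < k"
  shows "integrable M (\<lambda>x. if \<bar>u x\<bar> < k then a x (Du x) $ i * Du x $ i else 0)"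
proof (rule Bochner_Integration.integrable_bound)
  let ?g = "\<lambda>x. gam * (\<bar>d i x\<bar> powr (p i / (p i - 1)) + 2 * (if \<bar>u x\<bar> < k then \<bar>Du x $ i\<bar> powr p i else 0))"
  show "integrable M ?g"
    using d[of i] Du_powr_integrable[OF k, of i]
    by (intro integrable_mult_right Bochner_Integration.integrable_add) (simp_all add: L_space_def)
  show "AE x in M. norm (if \<bar>u x\<bar> < k then a x (Du x) $ i * Du x $ i else 0) \<le> norm (?g x)"
    using growth
  proof eventually_elim
    case (elim x)
    show ?case
    proof (cases "\<bar>u x\<bar> < k")
      case True
      let ?t = "\<bar>Du x $ i\<bar>"
      have "\<bar>a x (Du x) $ i\<bar> * ?t \<le> gam * (d i x + ?t powr (p i - 1)) * ?t"
        using elim by (intro mult_right_mono) auto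
      also have "\<dots> \<le> gam * (\<bar>d i x\<bar> + ?t powr (p i - 1)) * ?t"
        using gam by (intro mult_right_mono mult_left_mono add_right_mono) auto
      also have "\<dots> = gam * (\<bar>d i x\<bar> * ?t + ?t * ?t powr (p i - 1))"
        by (simp add: algebra_simps)
      also have "?t * ?t powr (p i - 1) = ?t powr p i"
        using powr_mult_base[of ?t "p i - 1"] by simp
      also have "gam * (\<bar>d i x\<bar> * ?t + ?t powr p i)
          \<le> gam * (\<bar>d i x\<bar> powr (p i / (p i - 1)) + 2 * ?t powr p i)"
        using mult_le_powr_conjugate[of "\<bar>d i x\<bar>" ?t "p i"] exponent[of i] gam
        by (intro mult_left_mono) auto
      finally show ?thesis using True gam by (simp add: abs_mult)
    qed simp
  qed
qed measurable

lemma weighted_energy_integrable: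
  assumes w: "w \<in> borel_measurable borel" "\<And>r. \<bar>w r\<bar> \<le> C" "\<And>r. k \<le> \<bar>r\<bar> \<Longrightarrow> w r = 0" and k: "0 < k"
  shows "integrable M (\<lambda>x. w (u x) * energy x)"
proof (rule Bochner_Integration.integrable_bound)
  have "integrable M (\<lambda>x. \<Sum>i\<in>UNIV. if \<bar>u x\<bar> < k then a x (Du x) $ i * Du x $ i else 0)"
    by (intro Bochner_Integration.integrable_sum flux_times_Du_integrable k)
  then show "integrable M (\<lambda>x. C * (\<Sum>i\<in>UNIV. if \<bar>u x\<bar> < k then a x (Du x) $ i * Du x $ i else 0))"
    by simp
  show "AE x in M. norm (w (u x) * energy x)
      \<le> norm (C * (\<Sum>i\<in>UNIV. if \<bar>u x\<bar> < k then a x (Du x) $ i * Du x $ i else 0))"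
  proof (rule AE_I2)
    fix x
    have "0 \<le> C" using w(2)[of 0] by linarith
    show "norm (w (u x) * energy x)
      \<le> norm (C * (\<Sum>i\<in>UNIV. if \<bar>u x\<bar> < k then a x (Du x) $ i * Du x $ i else 0))"
    proof (cases "\<bar>u x\<bar> < k")
      case True
      then show ?thesis
        using w(2)[of "u x"] \<open>0 \<le> C\<close> by (auto simp: energy_def abs_mult intro!: mult_right_mono)
    qed (simp add: w(3))
  qed
  have [measurable]: "w \<in> borel_measurable borel" by (rule w)
  show "(\<lambda>x. w (u x) * energy x) \<in> borel_measurable M" by measurable
qed

text \<open>
  The convection term disappears: \<open>F \<circ> u\<close> times the gradient of \<open>(h * \<psi>) \<circ> u\<close> is a sum over \<open>i\<close> of
  terms \<open>(q \<circ> u) \<partial>\<^sub>i u\<close> with \<open>q = F\<^sub>i (h * \<psi>)'\<close>, and \<open>W1p_0_gradient_integral_compose_eq_0\<close> applies to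
  each of them.
\<close>

lemma equation_tested_with_function_of_u:
  assumes h: "smooth_real h" "\<And>r. (h has_real_derivative h' r) (at r)"
      "\<And>r. J \<le> \<bar>r\<bar> \<Longrightarrow> h r = 0" "\<And>r. J \<le> \<bar>r\<bar> \<Longrightarrow> h' r = 0"
    and \<psi>: "smooth_real \<psi>" "\<And>r. (\<psi> has_real_derivative \<psi>' r) (at r)" "\<psi> 0 = 0"
      "\<And>r. J \<le> \<bar>r\<bar> \<Longrightarrow> \<psi>' r = 0" "\<And>r. \<bar>\<psi> r\<bar> \<le> B"
    and J: "0 < J"
  shows "(\<integral>x. b x * h (u x) * \<psi> (u x) \<partial>M) + (\<integral>x. (h' (u x) * \<psi> (u x) + h (u x) * \<psi>' (u x)) * energy x \<partial>M)
    = (\<integral>x. f x * h (u x) * \<psi> (u x) \<partial>M)"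
proof -
  define \<Phi> where "\<Phi> r = h r * \<psi> r" for r
  define \<Phi>' where "\<Phi>' r = h' r * \<psi> r + h r * \<psi>' r" for r
  have \<Phi>s: "smooth_real \<Phi>" unfolding \<Phi>_def[abs_def] by (intro smooth_real_mult h \<psi>)
  have \<Phi>d: "(\<Phi> has_real_derivative \<Phi>' r) (at r)" for r
    unfolding \<Phi>_def[abs_def] \<Phi>'_def using DERIV_mult[OF h(2)[of r] \<psi>(2)[of r]] by (simp add: mult.commute)
  have \<Phi>'0: "\<Phi>' r = 0" if "J \<le> \<bar>r\<bar>" for r
    using that by (simp add: \<Phi>'_def h)
  have \<Phi>'c: "continuous_on UNIV \<Phi>'"
    by (rule smooth_real_continuous[OF smooth_real_deriv[OF \<Phi>s \<Phi>d]])
  obtain C where C: "\<And>r. \<bar>\<Phi>' r\<bar> \<le> C"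
    using compactly_supported_bounded[OF \<Phi>'c \<Phi>'0] by blast
  have \<psi>'c: "continuous_on UNIV \<psi>'"
    by (rule smooth_real_continuous[OF smooth_real_deriv[OF \<psi>(1,2)]])
  obtain C' where C': "\<And>r. \<bar>\<psi>' r\<bar> \<le> C'"
    using compactly_supported_bounded[OF \<psi>'c \<psi>(4)] by blast
  have [measurable]: "\<psi> \<in> borel_measurable borel" "\<Phi>' \<in> borel_measurable borel"
    using smooth_real_continuous[OF \<psi>(1)] \<Phi>'c by (auto intro: borel_measurable_continuous_onI)
  have \<psi>W: "(\<lambda>x. \<psi> (u x)) \<in> W1p_0 \<Omega> p"
    by (rule W1p_0_gradient_imp_W1p_0[OF compose_gradient[OF \<psi>(1,3,2) C' \<psi>(4) J]])
  have \<psi>L: "(\<lambda>x. \<psi> (u x)) \<in> L_infinity \<Omega>"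
    using \<psi>(5) by (auto simp: L_infinity_def)
  have hC: "h \<in> C1_compact"
    by (rule smooth_real_C1_compact[OF h(1,3)])
  have eq: "(\<integral>x. b x * h (u x) * \<psi> (u x) \<partial>M)
      + (\<integral>x. (a x (Du x) + F (u x)) \<bullet> weak_gradient \<Omega> (\<lambda>y. h (u y) * \<psi> (u y)) x \<partial>M)
      = (\<integral>x. f x * h (u x) * \<psi> (u x) \<partial>M)"
    using solution_conditions(2) hC \<psi>W \<psi>L by fast
  have "W1p_0_gradient \<Omega> p (\<lambda>x. \<Phi> (u x)) (\<lambda>x. \<Phi>' (u x) *\<^sub>R Du x)"
    using \<psi>(3) by (intro compose_gradient[OF \<Phi>s _ \<Phi>d C \<Phi>'0 J]) (auto simp: \<Phi>_def)
  from W1p_0_gradient_weak_gradient(2)[OF this]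
  have "AE x in M. weak_gradient \<Omega> (\<lambda>y. h (u y) * \<psi> (u y)) x = \<Phi>' (u x) *\<^sub>R Du x"
    unfolding \<Phi>_def .
  then have ae: "AE x in M. (a x (Du x) + F (u x)) \<bullet> weak_gradient \<Omega> (\<lambda>y. h (u y) * \<psi> (u y)) x
      = \<Phi>' (u x) * energy x + (\<Sum>i\<in>UNIV. F (u x) $ i * \<Phi>' (u x) * Du x $ i)"
  proof eventually_elim
    case (elim x)
    then show ?case
      by (simp add: energy_def inner_vec_def distrib_right sum.distrib sum_distrib_left algebra_simps)
  qed
  \<comment> \<open>Outside \<open>\<bar>u\<bar> < J\<close> the factor \<open>\<Phi>' \<circ> u\<close> is 0, so \<open>u\<close> may be replaced by its truncation at \<open>J\<close>.\<close>
  have conv: "integrable M (\<lambda>x. F (u x) $ i * \<Phi>' (u x) * Du x $ i)"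
    "(\<integral>x. F (u x) $ i * \<Phi>' (u x) * Du x $ i \<partial>M) = 0" for i
  proof -
    define q where "q r = F r $ i * \<Phi>' r" for r
    have qc: "continuous_on UNIV q"
      unfolding q_def[abs_def]
      by (intro continuous_intros locally_lipschitz_continuous[OF F] \<Phi>'c)
    have q0: "q r = 0" if "J \<le> \<bar>r\<bar>" for r using \<Phi>'0[OF that] by (simp add: q_def)
    obtain Cq where Cq: "\<And>r. \<bar>q r\<bar> \<le> Cq"
      using compactly_supported_bounded[OF qc q0] by blast
    have "(\<lambda>x. q (trunc J (u x)) * (if \<bar>u x\<bar> < J then Du x else 0) $ i)
        = (\<lambda>x. F (u x) $ i * \<Phi>' (u x) * Du x $ i)"
    proof
      fix x show "q (trunc J (u x)) * (if \<bar>u x\<bar> < J then Du x else 0) $ i = F (u x) $ i * \<Phi>' (u x) * Du x $ i"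
        using \<Phi>'0[of "u x"] J by (cases "\<bar>u x\<bar> < J") (auto simp: trunc_def q_def)
    qed
    then show "integrable M (\<lambda>x. F (u x) $ i * \<Phi>' (u x) * Du x $ i)"
      "(\<integral>x. F (u x) $ i * \<Phi>' (u x) * Du x $ i \<partial>M) = 0"
      using W1p_0_gradient_integral_compose_eq_0[OF trunc_gradient[OF J] qc Cq, of i] by simp_all
  qed
  have "(\<integral>x. (a x (Du x) + F (u x)) \<bullet> weak_gradient \<Omega> (\<lambda>y. h (u y) * \<psi> (u y)) x \<partial>M)
      = (\<integral>x. \<Phi>' (u x) * energy x + (\<Sum>i\<in>UNIV. F (u x) $ i * \<Phi>' (u x) * Du x $ i) \<partial>M)"
    by (rule integrable_integral_cong_AE_lebesgue_on(2)[OF sets_\<Omega> ae])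
  also have "\<dots> = (\<integral>x. \<Phi>' (u x) * energy x \<partial>M) + (\<integral>x. (\<Sum>i\<in>UNIV. F (u x) $ i * \<Phi>' (u x) * Du x $ i) \<partial>M)"
    using conv(1) by (intro Bochner_Integration.integral_add weighted_energy_integrable[OF _ C \<Phi>'0 J]
        Bochner_Integration.integrable_sum) auto
  also have "(\<integral>x. (\<Sum>i\<in>UNIV. F (u x) $ i * \<Phi>' (u x) * Du x $ i) \<partial>M) = 0"
    using conv by (subst Bochner_Integration.integral_sum) auto
  finally show ?thesis using eq by (simp add: \<Phi>'_def)
qed

text \<open>
  By monotonicity of \<open>\<beta>\<close> and \<open>0 \<in> \<beta> 0\<close>, the values of \<open>b\<close> and \<open>u\<close> never have opposite signs.
\<close>

lemma b_times_nonneg: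
  assumes "mono \<psi>" "\<psi> 0 = 0"
  shows "AE x in M. 0 \<le> b x * \<psi> (u x)"
proof -
  have "AE x in M. b x \<in> \<beta> (u x)"
    using solution_conditions(1) by eventually_elim simp
  then show ?thesis
  proof eventually_elim
    case (elim x)
    then have bu: "0 \<le> b x * u x"
      using beta unfolding monotone_graph_def by fastforce
    consider "u x = 0" | "0 < u x" | "u x < 0" by linarith
    then show ?case
    proof cases
      case 2
      then have "0 \<le> b x" using bu by (simp add: zero_le_mult_iff)
      moreover have "0 \<le> \<psi> (u x)" using monoD[OF assms(1), of 0 "u x"] assms(2) 2 by simp
      ultimately show ?thesis by simp
    next
      case 3
      then have "b x \<le> 0" using bu by (simp add: zero_le_mult_iff)
      moreover have "\<psi> (u x) \<le> 0" using monoD[OF assms(1), of "u x" 0] assms(2) 3 by simp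
      ultimately show ?thesis by (simp add: mult_nonpos_nonpos)
    qed (simp add: assms)
  qed
qed

definition band_energy where
  "band_energy j = (LINT x : {x \<in> \<Omega>. j < \<bar>u x\<bar> \<and> \<bar>u x\<bar> < j + 1} | M. a x (Du x) \<bullet> Du x)"

lemma band_energy_tendsto_0: "(band_energy \<longlongrightarrow> 0) at_top"
  using solution_conditions(3) unfolding band_energy_def[abs_def] .

lemma band_energy_eq: "band_energy j = (\<integral>x. (if j < \<bar>u x\<bar> \<and> \<bar>u x\<bar> < j + 1 then 1 else 0) * energy x \<partial>M)"
  unfolding band_energy_def set_lebesgue_integral_def
  by (intro Bochner_Integration.integral_cong) (auto simp: energy_def inner_vec_def indicator_def)

text \<open>
  The preceding equation with a cut-off \<open>h\<close> that is 1 up to the level \<open>j\<close>. The term with \<open>h'\<close> is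
  bounded by a multiple of the energy in the band between the levels \<open>j\<close> and \<open>j + 1\<close>, which
  tends to 0 as \<open>j \<rightarrow> \<infinity>\<close>; the term with \<open>b\<close> has the good sign.
\<close>

lemma energy_estimate:
  assumes \<psi>: "smooth_real \<psi>" "\<And>r. (\<psi> has_real_derivative \<psi>' r) (at r)" "\<psi> 0 = 0"
      "\<And>r. k \<le> \<bar>r\<bar> \<Longrightarrow> \<psi>' r = 0" "\<And>r. \<bar>\<psi> r\<bar> \<le> B" "\<And>r. 0 \<le> \<psi>' r"
    and k: "0 < k"
  shows "(\<integral>x. \<psi>' (u x) * energy x \<partial>M) \<le> Cf * (\<integral>x. \<bar>\<psi> (u x)\<bar> \<partial>M)"
proof -
  have \<psi>'c: "continuous_on UNIV \<psi>'"
    by (rule smooth_real_continuous[OF smooth_real_deriv[OF \<psi>(1,2)]])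
  obtain C' where C': "\<And>r. \<bar>\<psi>' r\<bar> \<le> C'"
    using compactly_supported_bounded[OF \<psi>'c \<psi>(4)] by blast
  have [measurable]: "\<psi> \<in> borel_measurable borel" "\<psi>' \<in> borel_measurable borel"
    using smooth_real_continuous[OF \<psi>(1)] \<psi>'c by (auto intro: borel_measurable_continuous_onI)
  have B: "0 \<le> B" using \<psi>(5)[of 0] by linarith
  have \<psi>i: "integrable M (\<lambda>x. \<bar>\<psi> (u x)\<bar>)"
    by (rule integrable_const_bound[where B = B]) (use \<psi>(5) in auto)
  have mono: "mono \<psi>"
    by (rule monoI, rule DERIV_nonneg_imp_nondecreasing) (use \<psi>(2,6) in auto)
  obtain Mh where Mh: "0 \<le> Mh" "\<And>j. 0 \<le> j \<Longrightarrow> \<exists>h h'. cutoff Mh j h h'"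
    by (rule cutoff_exists) blast
  have main: "(\<integral>x. \<psi>' (u x) * energy x \<partial>M) \<le> Cf * (\<integral>x. \<bar>\<psi> (u x)\<bar> \<partial>M) + Mh * B * band_energy j"
    if j: "k \<le> j" for j
  proof -
    have "0 \<le> j" using j k by simp
    from Mh(2)[OF this] obtain h h' where hh: "cutoff Mh j h h'"
      by (elim exE)
    have h: "smooth_real h" "\<And>r. (h has_real_derivative h' r) (at r)"
      "\<And>r. 0 \<le> h r" "\<And>r. h r \<le> 1" "\<And>r. \<bar>r\<bar> \<le> j \<Longrightarrow> h r = 1" "\<And>r. j + 1 \<le> \<bar>r\<bar> \<Longrightarrow> h r = 0"
      "\<And>r. \<bar>h' r\<bar> \<le> Mh" "\<And>r. \<bar>r\<bar> \<le> j \<or> j + 1 \<le> \<bar>r\<bar> \<Longrightarrow> h' r = 0"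
      using hh by (auto simp: cutoff_def)
    have [measurable]: "h \<in> borel_measurable borel" "h' \<in> borel_measurable borel"
      using smooth_real_continuous[OF h(1)] smooth_real_continuous[OF smooth_real_deriv[OF h(1,2)]]
      by (auto intro: borel_measurable_continuous_onI)
    have "(\<integral>x. b x * h (u x) * \<psi> (u x) \<partial>M)
        + (\<integral>x. (h' (u x) * \<psi> (u x) + h (u x) * \<psi>' (u x)) * energy x \<partial>M)
        = (\<integral>x. f x * h (u x) * \<psi> (u x) \<partial>M)"
      by (rule equation_tested_with_function_of_u[OF h(1,2) _ _ \<psi>(1-3) _ \<psi>(5), of "j + 1"])
        (use h j k \<psi>(4) in auto)
    moreover have "0 \<le> (\<integral>x. b x * h (u x) * \<psi> (u x) \<partial>M)"
    proof (rule integral_nonneg_AE)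
      show "AE x in M. 0 \<le> b x * h (u x) * \<psi> (u x)"
        using b_times_nonneg[OF mono \<psi>(3)]
      proof eventually_elim
        case (elim x)
        then have "0 \<le> h (u x) * (b x * \<psi> (u x))" using h(3) by simp
        then show ?case by (simp add: ac_simps)
      qed
    qed
    moreover have "(\<integral>x. f x * h (u x) * \<psi> (u x) \<partial>M) \<le> Cf * (\<integral>x. \<bar>\<psi> (u x)\<bar> \<partial>M)"
    proof -
      have "(\<integral>x. f x * h (u x) * \<psi> (u x) \<partial>M) \<le> (\<integral>x. Cf * \<bar>\<psi> (u x)\<bar> \<partial>M)"
      proof (rule integral_mono_AE')
        show "AE x in M. f x * h (u x) * \<psi> (u x) \<le> Cf * \<bar>\<psi> (u x)\<bar>"
          using Cf(2)
        proof eventually_elim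
          case (elim x)
          have "\<bar>f x * h (u x) * \<psi> (u x)\<bar> \<le> Cf * 1 * \<bar>\<psi> (u x)\<bar>"
            unfolding abs_mult using elim h(3,4) Cf(1) by (intro mult_mono) auto
          then show ?case by linarith
        qed
        show "AE x in M. 0 \<le> Cf * \<bar>\<psi> (u x)\<bar>" using Cf(1) by simp
      qed (use \<psi>i in simp)
      then show ?thesis by simp
    qed
    moreover have "(\<integral>x. \<psi>' (u x) * energy x \<partial>M) - Mh * B * band_energy j
        \<le> (\<integral>x. (h' (u x) * \<psi> (u x) + h (u x) * \<psi>' (u x)) * energy x \<partial>M)"
    proof -
      let ?c = "\<lambda>r. if j < \<bar>r\<bar> \<and> \<bar>r\<bar> < j + 1 then 1 else 0 :: real"
      have i1: "integrable M (\<lambda>x. \<psi>' (u x) * energy x)"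
        by (rule weighted_energy_integrable[OF _ C' \<psi>(4) k]) auto
      have i2: "integrable M (\<lambda>x. ?c (u x) * energy x)"
        by (rule weighted_energy_integrable[where C = 1 and k = "j + 1"]) (use j k in auto)
      have hb: "\<bar>h' r * \<psi> r + h r * \<psi>' r\<bar> \<le> Mh * B + C'" for r
      proof -
        have "\<bar>h' r * \<psi> r\<bar> \<le> Mh * B" unfolding abs_mult using h(7) \<psi>(5) Mh(1) by (intro mult_mono) auto
        moreover have "\<bar>h r * \<psi>' r\<bar> \<le> 1 * C'" unfolding abs_mult using h(3,4) C' by (intro mult_mono) auto
        ultimately show ?thesis by linarith
      qed
      have i3: "integrable M (\<lambda>x. (h' (u x) * \<psi> (u x) + h (u x) * \<psi>' (u x)) * energy x)"
        by (rule weighted_energy_integrable[where w = "\<lambda>r. h' r * \<psi> r + h r * \<psi>' r" and k = "j + 1", OF _ hb])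
          (use j k h in auto)
      have "(\<integral>x. \<psi>' (u x) * energy x \<partial>M) - Mh * B * band_energy j
          = (\<integral>x. \<psi>' (u x) * energy x - Mh * B * (?c (u x) * energy x) \<partial>M)"
        unfolding band_energy_eq using i1 i2 by simp
      also have "\<dots> \<le> (\<integral>x. (h' (u x) * \<psi> (u x) + h (u x) * \<psi>' (u x)) * energy x \<partial>M)"
      proof (rule integral_mono_AE)
        show "integrable M (\<lambda>x. \<psi>' (u x) * energy x - Mh * B * (?c (u x) * energy x))"
          using i1 i2 by (intro Bochner_Integration.integrable_diff integrable_mult_right)
        show "AE x in M. \<psi>' (u x) * energy x - Mh * B * (?c (u x) * energy x)
            \<le> (h' (u x) * \<psi> (u x) + h (u x) * \<psi>' (u x)) * energy x"
          using energy_nonneg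
        proof eventually_elim
          case (elim x)
          have "\<psi>' r - Mh * B * ?c r \<le> h' r * \<psi> r + h r * \<psi>' r" for r
          proof -
            \<comment> \<open>\<open>\<psi>'\<close> vanishes outside the interval where \<open>h = 1\<close>.\<close>
            have 1: "h r * \<psi>' r = \<psi>' r"
              using h(5)[of r] \<psi>(4)[of r] j by (cases "\<bar>r\<bar> \<le> j") auto
            have "\<bar>h' r * \<psi> r\<bar> \<le> Mh * B"
              unfolding abs_mult using h(7) \<psi>(5) Mh(1) by (intro mult_mono) auto
            moreover have "h' r * \<psi> r = 0" if "\<not> (j < \<bar>r\<bar> \<and> \<bar>r\<bar> < j + 1)"
              using h(8)[of r] that by (auto simp: not_less)
            ultimately have "- (Mh * B * ?c r) \<le> h' r * \<psi> r" by auto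
            then show ?thesis using 1 by linarith
          qed
          from mult_right_mono[OF this[of "u x"] elim] show ?case
            by (simp add: left_diff_distrib mult.assoc)
        qed
      qed (rule i3)
      finally show ?thesis .
    qed
    ultimately show ?thesis by linarith
  qed
  have "((\<lambda>j. Cf * (\<integral>x. \<bar>\<psi> (u x)\<bar> \<partial>M) + Mh * B * band_energy j)
      \<longlongrightarrow> Cf * (\<integral>x. \<bar>\<psi> (u x)\<bar> \<partial>M) + Mh * B * 0) at_top"
    by (intro tendsto_add tendsto_mult tendsto_const band_energy_tendsto_0)
  moreover have "\<forall>\<^sub>F j in at_top. (\<integral>x. \<psi>' (u x) * energy x \<partial>M)
      \<le> Cf * (\<integral>x. \<bar>\<psi> (u x)\<bar> \<partial>M) + Mh * B * band_energy j"
    using eventually_ge_at_top[of k] by eventually_elim (rule main)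
  ultimately have "(\<integral>x. \<psi>' (u x) * energy x \<partial>M) \<le> Cf * (\<integral>x. \<bar>\<psi> (u x)\<bar> \<partial>M) + Mh * B * 0"
    by (intro tendsto_lowerbound[of _ _ at_top]) auto
  then show ?thesis by simp
qed

text \<open>
  Coercivity. The factor \<open>\<psi>'\<close> may be raised to the power \<open>p i > 1\<close> because it lies between 0 and 1;
  this turns the left side into a power integral of the gradient of \<open>\<psi> \<circ> u\<close>.
\<close>

lemma gradient_estimate:
  assumes \<psi>: "smooth_real \<psi>" "\<And>r. (\<psi> has_real_derivative \<psi>' r) (at r)" "\<psi> 0 = 0"
      "\<And>r. k \<le> \<bar>r\<bar> \<Longrightarrow> \<psi>' r = 0" "\<And>r. \<bar>\<psi> r\<bar> \<le> B" "\<And>r. 0 \<le> \<psi>' r" "\<And>r. \<psi>' r \<le> 1"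
    and k: "0 < k"
  shows "(\<integral>x. \<bar>\<psi>' (u x) * Du x $ i\<bar> powr p i \<partial>M) \<le> Cf / lam * (\<integral>x. \<bar>\<psi> (u x)\<bar> \<partial>M)"
proof -
  have [measurable]: "\<psi>' \<in> borel_measurable borel"
    using smooth_real_continuous[OF smooth_real_deriv[OF \<psi>(1,2)]]
    by (auto intro: borel_measurable_continuous_onI)
  have i1: "integrable M (\<lambda>x. \<psi>' (u x) * energy x)"
    by (rule weighted_energy_integrable[where C = 1, OF _ _ \<psi>(4) k]) (use \<psi> in auto)
  have "(\<integral>x. \<bar>\<psi>' (u x) * Du x $ i\<bar> powr p i \<partial>M) \<le> (\<integral>x. \<psi>' (u x) * energy x / lam \<partial>M)"
  proof (rule integral_mono_AE')
    show "integrable M (\<lambda>x. \<psi>' (u x) * energy x / lam)" using i1 by simp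
    show "AE x in M. \<bar>\<psi>' (u x) * Du x $ i\<bar> powr p i \<le> \<psi>' (u x) * energy x / lam"
      using energy_ge
    proof eventually_elim
      case (elim x)
      have "\<bar>\<psi>' (u x) * Du x $ i\<bar> powr p i = \<psi>' (u x) powr p i * \<bar>Du x $ i\<bar> powr p i"
        using \<psi>(6) by (simp add: abs_mult powr_mult)
      also have "\<dots> \<le> \<psi>' (u x) * \<bar>Du x $ i\<bar> powr p i"
      proof (rule mult_right_mono)
        show "\<psi>' (u x) powr p i \<le> \<psi>' (u x)"
          using powr_mono'[of 1 "p i" "\<psi>' (u x)"] \<psi>(6,7) exponent[of i] by simp
      qed simp
      also have "\<dots> \<le> \<psi>' (u x) * (\<Sum>i\<in>UNIV. \<bar>Du x $ i\<bar> powr p i)"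
        using \<psi>(6) by (intro mult_left_mono member_le_sum) auto
      also have "\<dots> \<le> \<psi>' (u x) * (energy x / lam)"
        using \<psi>(6) elim lam by (intro mult_left_mono) (auto simp: le_divide_eq mult.commute)
      finally show ?case by simp
    qed
    show "AE x in M. 0 \<le> \<psi>' (u x) * energy x / lam"
      using energy_nonneg by eventually_elim (use \<psi>(6) lam in simp)
  qed
  also have "\<dots> = (\<integral>x. \<psi>' (u x) * energy x \<partial>M) / lam" by simp
  also have "\<dots> \<le> Cf * (\<integral>x. \<bar>\<psi> (u x)\<bar> \<partial>M) / lam"
    using energy_estimate[OF \<psi>(1-6) k] lam by (intro divide_right_mono) auto
  finally show ?thesis by simp
qed

end

section \<open>Boundedness\<close>

text \<open>
  A smooth substitute, with slope between 0 and 1, for \<open>trunc (l - k)\<close> applied to the excess of a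
  number over the level \<open>k\<close>. The price of smoothness is the factor \<open>c\<close> in the height.
\<close>

definition level_step :: "real \<Rightarrow> real \<Rightarrow> real \<Rightarrow> (real \<Rightarrow> real) \<Rightarrow> (real \<Rightarrow> real) \<Rightarrow> bool" where
  "level_step c k l \<psi> \<psi>' \<longleftrightarrow> smooth_real \<psi> \<and> (\<forall>r. (\<psi> has_real_derivative \<psi>' r) (at r)) \<and>
      (\<forall>r. 0 \<le> \<psi>' r \<and> \<psi>' r \<le> 1) \<and> (\<forall>r. \<bar>r\<bar> \<le> k \<or> l \<le> \<bar>r\<bar> \<longrightarrow> \<psi>' r = 0) \<and>
      (\<forall>r. \<bar>r\<bar> \<le> k \<longrightarrow> \<psi> r = 0) \<and> (\<forall>r. \<bar>\<psi> r\<bar> \<le> c * (l - k)) \<and>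
      (\<forall>r. l \<le> \<bar>r\<bar> \<longrightarrow> \<bar>\<psi> r\<bar> = c * (l - k))"

lemma level_step_exists:
  obtains c :: real where "0 < c"
    "\<And>k l. 0 \<le> k \<Longrightarrow> k < l \<Longrightarrow> \<exists>\<psi> \<psi>'. level_step c k l \<psi> \<psi>'"
proof -
  obtain S S' :: "real \<Rightarrow> real" and c where S: "smooth_real S" "\<And>x. (S has_real_derivative S' x) (at x)" "0 < c"
    "\<And>x. x \<le> 0 \<Longrightarrow> S x = 0" "\<And>x. 1 \<le> x \<Longrightarrow> S x = c" "\<And>x. 0 \<le> S x" "\<And>x. S x \<le> c"
    "\<And>x. 0 \<le> S' x" "\<And>x. S' x \<le> 1" "\<And>x. x \<le> 0 \<or> 1 \<le> x \<Longrightarrow> S' x = 0"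
    by (rule smooth_step_exists) blast
  show ?thesis
  proof (rule that[OF S(3)])
    fix k l :: real assume kl: "0 \<le> k" "k < l"
    define s where "s = l - k"
    have s: "0 < s" using kl by (simp add: s_def)
    define \<psi> where "\<psi> r = s * (S ((r - k) * inverse s) - S ((- r - k) * inverse s))" for r
    define \<psi>' where "\<psi>' r = S' ((r - k) * inverse s) + S' ((- r - k) * inverse s)" for r
    have arg0: "t * inverse s \<le> 0 \<longleftrightarrow> t \<le> 0" "1 \<le> t * inverse s \<longleftrightarrow> s \<le> t" for t
      using s by (auto simp: field_simps mult_le_0_iff)
    have sm: "smooth_real \<psi>"
      unfolding \<psi>_def[abs_def]
      by (intro smooth_real_mult smooth_real_compose[OF S(1)] smooth_real_diff smooth_real_minus
          smooth_real_const smooth_real_ident)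
    have der: "(\<psi> has_real_derivative \<psi>' r) (at r)" for r
    proof -
      have 1: "((\<lambda>r. S ((r - k) * inverse s)) has_real_derivative S' ((r - k) * inverse s) * inverse s) (at r)"
        by (rule DERIV_chain2[OF S(2)]) (auto intro!: derivative_eq_intros)
      have 2: "((\<lambda>r. S ((- r - k) * inverse s)) has_real_derivative S' ((- r - k) * inverse s) * - inverse s) (at r)"
        by (rule DERIV_chain2[OF S(2)]) (auto intro!: derivative_eq_intros)
      have "s * (S' ((r - k) * inverse s) * inverse s - S' ((- r - k) * inverse s) * - inverse s) = \<psi>' r"
      proof -
        have "s * (A * inverse s - B * - inverse s) = (s * inverse s) * (A + B)" for A B
          by (simp add: algebra_simps)
        moreover have "s * inverse s = 1" using s by simp
        ultimately show ?thesis by (simp add: \<psi>'_def)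
      qed
      with DERIV_cmult[OF DERIV_diff[OF 1 2], of s] show ?thesis
        unfolding \<psi>_def[abs_def] by simp
    qed
    have one_sided: "S ((- r - k) * inverse s) = 0 \<and> S' ((- r - k) * inverse s) = 0 \<or>
        S ((r - k) * inverse s) = 0 \<and> S' ((r - k) * inverse s) = 0" for r
    proof (cases "0 \<le> r")
      case True
      then have "(- r - k) * inverse s \<le> 0" using kl by (simp add: arg0)
      then show ?thesis using S(4,10) by blast
    next
      case False
      then have "(r - k) * inverse s \<le> 0" using kl by (simp add: arg0)
      then show ?thesis using S(4,10) by blast
    qed
    have b': "0 \<le> \<psi>' r \<and> \<psi>' r \<le> 1" for r
      using one_sided[of r] S(8,9) by (auto simp: \<psi>'_def)
    have z': "\<psi>' r = 0" if "\<bar>r\<bar> \<le> k \<or> l \<le> \<bar>r\<bar>" for r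
    proof -
      have "(r - k) * inverse s \<le> 0 \<or> 1 \<le> (r - k) * inverse s"
        "(- r - k) * inverse s \<le> 0 \<or> 1 \<le> (- r - k) * inverse s"
        unfolding arg0 unfolding s_def using that kl by linarith+
      then have "S' ((r - k) * inverse s) = 0" "S' ((- r - k) * inverse s) = 0"
        by (auto intro: S(10))
      then show ?thesis by (simp add: \<psi>'_def)
    qed
    have z: "\<psi> r = 0" if "\<bar>r\<bar> \<le> k" for r
    proof -
      have "(r - k) * inverse s \<le> 0" "(- r - k) * inverse s \<le> 0"
        unfolding arg0 using that by linarith+
      then have "S ((r - k) * inverse s) = 0" "S ((- r - k) * inverse s) = 0"
        by (auto intro: S(4))
      then show ?thesis by (simp add: \<psi>_def)
    qed
    have abs: "\<bar>\<psi> r\<bar> = s * (S ((r - k) * inverse s) + S ((- r - k) * inverse s))" for r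
      using one_sided[of r] S(6) s by (auto simp: \<psi>_def abs_mult)
    have bd: "\<bar>\<psi> r\<bar> \<le> c * s" for r
    proof -
      have "S ((r - k) * inverse s) + S ((- r - k) * inverse s) \<le> c"
        using one_sided[of r] S(7) by auto
      then show ?thesis unfolding abs using s by (simp add: mult.commute mult_right_mono)
    qed
    have top: "\<bar>\<psi> r\<bar> = c * s" if "l \<le> \<bar>r\<bar>" for r
    proof -
      have "1 \<le> (r - k) * inverse s \<or> 1 \<le> (- r - k) * inverse s"
        unfolding arg0 unfolding s_def using that by linarith
      then have "S ((r - k) * inverse s) = c \<or> S ((- r - k) * inverse s) = c"
        by (auto intro: S(5))
      then have "S ((r - k) * inverse s) + S ((- r - k) * inverse s) = c"
        using one_sided[of r] S(3) by auto
      then show ?thesis unfolding abs by (simp add: mult.commute)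
    qed
    show "\<exists>\<psi> \<psi>'. level_step c k l \<psi> \<psi>'"
      using sm der b' z' z bd top unfolding level_step_def s_def by blast
  qed
qed

context renormalized
begin

definition level where "level k = measure M {x \<in> \<Omega>. k < \<bar>u x\<bar>}"

lemma level_set_measurable [measurable]: "{x \<in> \<Omega>. k < \<bar>u x\<bar>} \<in> sets M"
proof -
  have "{x \<in> space M. k < \<bar>u x\<bar>} \<in> sets M" by measurable
  then show ?thesis by simp
qed

lemma level_nonneg: "0 \<le> level k"
  by (simp add: level_def)

lemma level_antimono: "k \<le> l \<Longrightarrow> level l \<le> level k"
  unfolding level_def by (intro finite_measure_mono) auto

lemma level_tendsto_0: "(\<lambda>n. level (real n)) \<longlonglongrightarrow> 0"
proof -
  have "(\<lambda>n. measure M {x \<in> \<Omega>. real n < \<bar>u x\<bar>}) \<longlonglongrightarrow> measure M (\<Inter>n. {x \<in> \<Omega>. real n < \<bar>u x\<bar>})"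
    by (rule finite_Lim_measure_decseq) (auto simp: decseq_def)
  also have "(\<Inter>n. {x \<in> \<Omega>. real n < \<bar>u x\<bar>}) = {}"
  proof (rule equals0I)
    fix x assume "x \<in> (\<Inter>n. {x \<in> \<Omega>. real n < \<bar>u x\<bar>})"
    moreover obtain n where "\<bar>u x\<bar> < real n" using reals_Archimedean2 by blast
    ultimately show False by (auto dest!: spec[of _ n])
  qed
  finally show ?thesis by (simp add: level_def)
qed

text \<open>
  Let \<open>y\<close> be the integral of \<open>\<bar>\<psi> \<circ> u\<bar>\<close> for the step \<open>\<psi>\<close> between \<open>k\<close> and \<open>l\<close>. The gradient of \<open>\<psi> \<circ> u\<close>
  vanishes where \<open>\<bar>u\<bar> \<le> k\<close>, so that the gradient estimate and \<open>\<bar>t\<bar> \<le> 1 + \<bar>t\<bar> powr p i\<close> bound the integral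
  of each of its components by \<open>level k + (Cf / lam) * y\<close>. The Poincare inequality with the small
  factor \<open>\<delta>\<close> then bounds \<open>y\<close>, and the multiple of \<open>y\<close> on the right is absorbed.
\<close>

lemma level_decay:
  obtains c where "0 < c"
    "\<And>k l \<delta>. 0 \<le> k \<Longrightarrow> k < l \<Longrightarrow> 0 < \<delta> \<Longrightarrow> 2 * level k \<le> \<delta> ^ CARD('n) \<Longrightarrow>
       4 * real CARD('n) * \<delta> * (Cf / lam) \<le> 1 \<Longrightarrow>
       c * (l - k) * level l \<le> 4 * real CARD('n) * \<delta> * level k"
proof -
  obtain c where c: "0 < c" and step: "\<And>k l. 0 \<le> k \<Longrightarrow> k < l \<Longrightarrow> \<exists>\<psi> \<psi>'. level_step c k l \<psi> \<psi>'"
    by (rule level_step_exists) blast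
  show ?thesis
  proof (rule that[OF c])
    fix k l \<delta> :: real
    assume k: "0 \<le> k" and kl: "k < l" and \<delta>: "0 < \<delta>"
      and small: "2 * level k \<le> \<delta> ^ CARD('n)" and abs: "4 * real CARD('n) * \<delta> * (Cf / lam) \<le> 1"
    obtain \<psi> \<psi>' where all: "level_step c k l \<psi> \<psi>'"
      using step[OF k kl] by (elim exE)
    then have \<psi>: "smooth_real \<psi>" "\<And>r. (\<psi> has_real_derivative \<psi>' r) (at r)"
      "\<And>r. 0 \<le> \<psi>' r" "\<And>r. \<psi>' r \<le> 1" "\<And>r. \<bar>r\<bar> \<le> k \<Longrightarrow> \<psi>' r = 0" "\<And>r. l \<le> \<bar>r\<bar> \<Longrightarrow> \<psi>' r = 0"
      "\<And>r. \<bar>r\<bar> \<le> k \<Longrightarrow> \<psi> r = 0" "\<And>r. \<bar>\<psi> r\<bar> \<le> c * (l - k)" "\<And>r. l \<le> \<bar>r\<bar> \<Longrightarrow> \<bar>\<psi> r\<bar> = c * (l - k)"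
      unfolding level_step_def by blast+
    have \<psi>0: "\<psi> 0 = 0" using \<psi>(7)[of 0] k by simp
    have l: "0 < l" using k kl by simp
    let ?A = "{x \<in> \<Omega>. k < \<bar>u x\<bar>}"
    define y where "y = (\<integral>x. \<bar>\<psi> (u x)\<bar> \<partial>M)"
    have W: "W1p_0_gradient \<Omega> p (\<lambda>x. \<psi> (u x)) (\<lambda>x. \<psi>' (u x) *\<^sub>R Du x)"
      by (rule compose_gradient[OF \<psi>(1) \<psi>0 \<psi>(2) _ \<psi>(6) l, where C = 1]) (use \<psi>(3,4) in auto)
    note Wi = W1p_0_gradient_integrable[OF W]
    have grad: "(\<integral>x. \<bar>(\<psi>' (u x) *\<^sub>R Du x) $ i\<bar> \<partial>M) \<le> level k + Cf / lam * y" for i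
    proof -
      let ?g = "\<lambda>x. (\<psi>' (u x) *\<^sub>R Du x) $ i"
      have gi: "integrable M (\<lambda>x. \<bar>?g x\<bar> powr p i)"
        using W by (simp add: W1p_0_gradient_def L_space_def)
      have Ai: "integrable M (indicator ?A :: _ \<Rightarrow> real)"
        by (rule integrable_real_indicator) (auto simp: less_top[symmetric])
      have "(\<integral>x. \<bar>?g x\<bar> \<partial>M) \<le> (\<integral>x. indicator ?A x + \<bar>?g x\<bar> powr p i \<partial>M)"
      proof (rule integral_mono)
        show "integrable M (\<lambda>x. \<bar>?g x\<bar>)" using Wi(2) by (rule integrable_abs)
        show "integrable M (\<lambda>x. indicator ?A x + \<bar>?g x\<bar> powr p i)"
          by (rule Bochner_Integration.integrable_add[OF Ai gi])
        fix x assume "x \<in> space M"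
        then show "\<bar>?g x\<bar> \<le> indicator ?A x + \<bar>?g x\<bar> powr p i"
          using \<psi>(5)[of "u x"] abs_le_add_powr[of 1 "p i" "?g x"] exponent[of i]
          by (cases "k < \<bar>u x\<bar>") auto
      qed
      also have "\<dots> = (\<integral>x. indicator ?A x \<partial>M) + (\<integral>x. \<bar>?g x\<bar> powr p i \<partial>M)"
        by (rule Bochner_Integration.integral_add[OF Ai gi])
      also have "(\<integral>x. indicator ?A x \<partial>M) = level k"
      proof -
        have "?A \<inter> \<Omega> = ?A" by auto
        then show ?thesis by (simp add: level_def)
      qed
      also have "(\<integral>x. \<bar>?g x\<bar> powr p i \<partial>M) \<le> Cf / lam * y"
        using gradient_estimate[OF \<psi>(1,2) \<psi>0 \<psi>(6,8,3,4) l, of i] by (simp add: y_def)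
      finally show ?thesis by simp
    qed
    have "y \<le> 2 * \<delta> * (\<Sum>i\<in>UNIV. \<integral>x. \<bar>(\<psi>' (u x) *\<^sub>R Du x) $ i\<bar> \<partial>M)"
      unfolding y_def
      by (rule W1p_0_gradient_poincare_small_support[OF W level_set_measurable[of k] _ \<delta>])
        (use small \<psi>(7) in \<open>auto simp: level_def intro!: AE_I2\<close>)
    also have "\<dots> \<le> 2 * \<delta> * (\<Sum>i\<in>(UNIV :: 'n set). level k + Cf / lam * y)"
      using \<delta> grad by (intro mult_left_mono sum_mono) auto
    also have "\<dots> = 2 * real CARD('n) * \<delta> * level k + (4 * real CARD('n) * \<delta> * (Cf / lam)) * y / 2"
      by (simp add: algebra_simps)
    also have "(4 * real CARD('n) * \<delta> * (Cf / lam)) * y \<le> 1 * y"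
      by (rule mult_right_mono[OF abs]) (simp add: y_def integral_nonneg)
    finally have "y \<le> 4 * real CARD('n) * \<delta> * level k" by simp
    moreover have "c * (l - k) * level l \<le> y"
    proof -
      let ?B = "{x \<in> \<Omega>. l < \<bar>u x\<bar>}"
      have Bi: "integrable M (indicator ?B :: _ \<Rightarrow> real)"
        by (rule integrable_real_indicator) (auto simp: less_top[symmetric])
      have "(\<integral>x. c * (l - k) * indicator ?B x \<partial>M) \<le> y"
        unfolding y_def
      proof (rule integral_mono)
        show "integrable M (\<lambda>x. c * (l - k) * indicator ?B x)" using Bi by simp
        show "integrable M (\<lambda>x. \<bar>\<psi> (u x)\<bar>)" using Wi(1) by (rule integrable_abs)
        show "c * (l - k) * indicator ?B x \<le> \<bar>\<psi> (u x)\<bar>" for x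
          using \<psi>(9)[of "u x"] by (auto simp: indicator_def)
      qed
      moreover have "?B \<inter> \<Omega> = ?B" by auto
      ultimately show ?thesis by (simp add: level_def)
    qed
    ultimately show "c * (l - k) * level l \<le> 4 * real CARD('n) * \<delta> * level k" by linarith
  qed
qed

text \<open>
  De Giorgi's iteration over the levels \<open>\<kappa> n = n0 + 1 - 2 powr - n\<close> with \<open>\<delta> n\<close> proportional to
  \<open>2 powr - n\<close>. The gap between consecutive levels and \<open>\<delta> n\<close> shrink at the same rate, so
  \<open>level_decay\<close> reduces the measure of the level set by the constant factor \<open>8 * N * \<delta>0 / c\<close> in each
  step. For small \<open>\<delta>0\<close> this factor is at most \<open>2 powr - N\<close>, which keeps the smallness condition
  \<open>2 * level (\<kappa> n) \<le> \<delta> n ^ N\<close> alive. In the limit the level set of \<open>n0 + 1\<close> has measure 0.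
\<close>

lemma u_bounded: "\<exists>K>0. AE x in M. \<bar>u x\<bar> \<le> K"
proof -
  define N where "N = CARD('n)"
  have N: "0 < N" "1 \<le> real N" by (auto simp: N_def Suc_le_eq)
  obtain c where c: "0 < c" and decay: "\<And>k l \<delta>. 0 \<le> k \<Longrightarrow> k < l \<Longrightarrow> 0 < \<delta> \<Longrightarrow> 2 * level k \<le> \<delta> ^ N \<Longrightarrow>
       4 * real N * \<delta> * (Cf / lam) \<le> 1 \<Longrightarrow> c * (l - k) * level l \<le> 4 * real N * \<delta> * level k"
    unfolding N_def by (rule level_decay) blast
  \<comment> \<open>The first bound absorbs the zero-order term in \<open>level_decay\<close>, the second gives the decay factor \<open>2 powr - N\<close>.\<close>
  define \<delta>0 where "\<delta>0 = min (inverse (4 * real N * (Cf / lam + 1))) (c / (8 * real N * 2 ^ N))"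
  have Cl: "0 \<le> Cf / lam" using Cf(1) lam by simp
  have \<delta>0: "0 < \<delta>0" using Cl c N by (simp add: \<delta>0_def)
  have \<delta>1: "4 * real N * \<delta>0 * (Cf / lam) \<le> 1"
  proof -
    have "4 * real N * \<delta>0 * (Cf / lam) \<le> 4 * real N * \<delta>0 * (Cf / lam + 1)"
      using N \<delta>0 by (intro mult_left_mono) auto
    also have "\<dots> = \<delta>0 * (4 * real N * (Cf / lam + 1))" by (simp add: ac_simps)
    also have "\<dots> \<le> inverse (4 * real N * (Cf / lam + 1)) * (4 * real N * (Cf / lam + 1))"
      using N Cl by (intro mult_right_mono) (auto simp: \<delta>0_def)
    also have "\<dots> = 1" using N Cl by (intro left_inverse) auto
    finally show ?thesis .
  qed
  have \<delta>2: "8 * real N * \<delta>0 * 2 ^ N \<le> c"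
  proof -
    have "\<delta>0 \<le> c / (8 * real N * 2 ^ N)" by (simp add: \<delta>0_def)
    then show ?thesis using N by (simp add: pos_le_divide_eq ac_simps)
  qed
  have "0 < \<delta>0 ^ N / 2" using \<delta>0 by simp
  then have "\<forall>\<^sub>F n in sequentially. level (real n) < \<delta>0 ^ N / 2"
    by (rule order_tendstoD(2)[OF level_tendsto_0])
  then obtain n0 where n0: "level (real n0) < \<delta>0 ^ N / 2"
    using eventually_happens'[OF sequentially_bot] by blast
  define \<kappa> where "\<kappa> n = real n0 + 1 - (1/2) ^ n" for n :: nat
  define \<delta> where "\<delta> n = \<delta>0 * (1/2) ^ n" for n :: nat
  have \<delta>pos: "0 < \<delta> n" "\<delta> n \<le> \<delta>0" for n
    using \<delta>0 by (auto simp: \<delta>_def mult_le_cancel_left1 power_le_one)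
  have claim: "2 * level (\<kappa> n) \<le> \<delta> n ^ N" for n
  proof (induction n)
    case 0
    then show ?case using n0 by (simp add: \<kappa>_def \<delta>_def)
  next
    case (Suc n)
    have half: "0 < (1/2::real) ^ n" "(1/2::real) ^ n \<le> 1" by (auto simp: power_le_one)
    have diff: "\<kappa> (Suc n) - \<kappa> n = (1/2) ^ n / 2" by (simp add: \<kappa>_def)
    have "c * (\<kappa> (Suc n) - \<kappa> n) * level (\<kappa> (Suc n)) \<le> 4 * real N * \<delta> n * level (\<kappa> n)"
    proof (rule decay[OF _ _ \<delta>pos(1) Suc])
      show "0 \<le> \<kappa> n" using half by (simp add: \<kappa>_def)
      show "\<kappa> n < \<kappa> (Suc n)" using diff half by linarith
      have "4 * real N * \<delta> n * (Cf / lam) \<le> 4 * real N * \<delta>0 * (Cf / lam)"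
        using \<delta>pos Cl by (intro mult_right_mono mult_left_mono) auto
      then show "4 * real N * \<delta> n * (Cf / lam) \<le> 1" using \<delta>1 by linarith
    qed
    then have "(1/2) ^ n * (c * level (\<kappa> (Suc n))) \<le> (1/2) ^ n * (8 * real N * \<delta>0 * level (\<kappa> n))"
      unfolding diff by (simp add: \<delta>_def algebra_simps)
    then have "c * level (\<kappa> (Suc n)) \<le> 8 * real N * \<delta>0 * level (\<kappa> n)"
      using half(1) by (rule mult_left_le_imp_le)
    then have "2 ^ N * (c * level (\<kappa> (Suc n))) \<le> 2 ^ N * (8 * real N * \<delta>0 * level (\<kappa> n))"
      by (rule mult_left_mono) simp
    also have "\<dots> = (8 * real N * \<delta>0 * 2 ^ N) * level (\<kappa> n)" by simp
    also have "\<dots> \<le> c * level (\<kappa> n)"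
      by (rule mult_right_mono[OF \<delta>2 level_nonneg])
    finally have "c * (2 ^ N * level (\<kappa> (Suc n))) \<le> c * level (\<kappa> n)" by (simp add: ac_simps)
    then have "2 ^ N * level (\<kappa> (Suc n)) \<le> level (\<kappa> n)"
      using c by (rule mult_left_le_imp_le)
    then have "2 ^ N * (2 * level (\<kappa> (Suc n))) \<le> \<delta> n ^ N" using Suc by simp
    also have "\<delta> n = 2 * \<delta> (Suc n)" by (simp add: \<delta>_def)
    also have "(2 * \<delta> (Suc n)) ^ N = 2 ^ N * \<delta> (Suc n) ^ N" by (rule power_mult_distrib)
    finally show ?case by simp
  qed
  have "level (real n0 + 1) \<le> 0"
  proof (rule LIMSEQ_le_const)
    have "(\<lambda>n. (1/2::real) ^ n) \<longlonglongrightarrow> 0" by (intro LIMSEQ_realpow_zero) auto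
    then have "(\<lambda>n. \<delta> n ^ N / 2) \<longlonglongrightarrow> (\<delta>0 * 0) ^ N / 2"
      unfolding \<delta>_def by (intro tendsto_intros) auto
    then show "(\<lambda>n. \<delta> n ^ N / 2) \<longlonglongrightarrow> 0" using N by (simp add: power_0_left)
    have "level (real n0 + 1) \<le> \<delta> n ^ N / 2" for n
      using claim[of n] level_antimono[of "\<kappa> n" "real n0 + 1"] by (simp add: \<kappa>_def)
    then show "\<exists>m. \<forall>n\<ge>m. level (real n0 + 1) \<le> \<delta> n ^ N / 2" by blast
  qed
  then have "measure M {x \<in> \<Omega>. real n0 + 1 < \<bar>u x\<bar>} = 0"
    using level_nonneg[of "real n0 + 1"] unfolding level_def by (rule antisym)
  then have "{x \<in> \<Omega>. real n0 + 1 < \<bar>u x\<bar>} \<in> null_sets M"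
    by (simp add: null_sets_def emeasure_eq_measure)
  then have "AE x in M. x \<notin> {x \<in> \<Omega>. real n0 + 1 < \<bar>u x\<bar>}" by (rule AE_not_in)
  then have "AE x in M. \<bar>u x\<bar> \<le> real n0 + 1"
    by (rule AE_mp) (auto intro!: AE_I2)
  then show ?thesis by (intro exI[of _ "real n0 + 1"]) auto
qed

lemma u_gradient: "W1p_0_gradient \<Omega> p u Du"
proof -
  obtain K where K: "0 < K" "AE x in M. \<bar>u x\<bar> \<le> K" using u_bounded by blast
  show ?thesis
  proof (rule W1p_0_gradient_cong_AE[OF trunc_gradient[of "K + 1"]])
    show "AE x in M. trunc (K + 1) (u x) = u x"
      using K(2) by eventually_elim (auto simp: trunc_def)
    show "AE x in M. (if \<bar>u x\<bar> < K + 1 then Du x else 0) = Du x"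
      using K(2) by eventually_elim auto
  qed (use K in simp)
qed

text \<open>
  With a cut-off \<open>h\<close> that is 1 on the range of \<open>u\<close>, the renormalized equation is the weak one.
\<close>

lemma is_weak_solution: "weak_solution \<Omega> p \<beta> a F f u b"
  unfolding weak_solution_def
proof (intro conjI allI ballI)
  obtain K where K: "0 < K" "AE x in M. \<bar>u x\<bar> \<le> K" using u_bounded by blast
  show "u \<in> W1p_0 \<Omega> p" by (rule W1p_0_gradient_imp_W1p_0[OF u_gradient])
  show b: "b \<in> L_space \<Omega> 1" using solution by (simp add: renormalized_solution_def)
  show "AE x in M. b x \<in> \<beta> (u x)" using solution_conditions(1) by eventually_elim simp
  have Fc: "continuous_on UNIV F" by (rule locally_lipschitz_continuous[OF F])
  have Fic: "continuous_on UNIV (\<lambda>r. F r $ i)" for i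
    by (intro continuous_intros Fc)
  show "(\<lambda>x. F (u x) $ i) \<in> L1_loc \<Omega>" for i
  proof (rule L1_locI[OF sets_\<Omega>])
    have "compact ((\<lambda>r. F r $ i) ` {-K..K})"
      by (intro compact_continuous_image continuous_on_subset[OF Fic]) auto
    then obtain C where C: "\<And>r. r \<in> {-K..K} \<Longrightarrow> \<bar>F r $ i\<bar> \<le> C"
      by (meson compact_imp_bounded bounded_real imageI)
    have [measurable]: "(\<lambda>r. F r $ i) \<in> borel_measurable borel"
      using Fic by (rule borel_measurable_continuous_onI)
    show "integrable M (\<lambda>x. F (u x) $ i)"
    proof (rule integrable_const_bound[where B = C])
      show "AE x in M. norm (F (u x) $ i) \<le> C"
        using K(2) by eventually_elim (auto intro!: C)
    qed measurable
  qed
  fix \<phi> assume \<phi>: "\<phi> \<in> test_functions \<Omega>"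
  obtain Mh where Mh: "0 \<le> Mh" "\<And>j. 0 \<le> j \<Longrightarrow> \<exists>h h'. cutoff Mh j h h'"
    by (rule cutoff_exists) blast
  obtain h where h: "smooth_real h" "\<And>r. \<bar>r\<bar> \<le> K \<Longrightarrow> h r = 1" "\<And>r. K + 1 \<le> \<bar>r\<bar> \<Longrightarrow> h r = 0"
    using Mh(2)[OF less_imp_le[OF K(1)]] unfolding cutoff_def by blast
  have h1: "AE x in M. h (u x) = 1" using K(2) by eventually_elim (rule h(2))
  have \<phi>W: "\<phi> \<in> W1p_0 \<Omega> p"
    by (rule W1p_0_gradient_imp_W1p_0[OF test_functions_W1p_0_gradient[OF \<phi>]])
  obtain C where "\<And>x. \<bar>\<phi> x\<bar> \<le> C" "\<And>x i. \<bar>partial_deriv i \<phi> x\<bar> \<le> C"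
    using test_functions_bounded[OF \<phi>] by blast
  then have \<phi>L: "\<phi> \<in> L_infinity \<Omega>"
    using borel_measurable_lebesgue_on[OF test_functions_borel(1)[OF \<phi>]] by (auto simp: L_infinity_def)
  have eq: "(\<integral>x. b x * h (u x) * \<phi> x \<partial>M)
      + (\<integral>x. (a x (Du x) + F (u x)) \<bullet> weak_gradient \<Omega> (\<lambda>y. h (u y) * \<phi> y) x \<partial>M)
      = (\<integral>x. f x * h (u x) * \<phi> x \<partial>M)"
    using solution_conditions(2) smooth_real_C1_compact[OF h(1,3)] \<phi>W \<phi>L by fast
  have "(\<integral>x. b x * h (u x) * \<phi> x \<partial>M) = (\<integral>x. b x * \<phi> x \<partial>M)"
    by (rule integrable_integral_cong_AE_lebesgue_on(2)[OF sets_\<Omega>])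
      (use h1 in eventually_elim, simp)
  moreover have "(\<integral>x. f x * h (u x) * \<phi> x \<partial>M) = (\<integral>x. f x * \<phi> x \<partial>M)"
    by (rule integrable_integral_cong_AE_lebesgue_on(2)[OF sets_\<Omega>])
      (use h1 in eventually_elim, simp)
  moreover have "(\<integral>x. (a x (Du x) + F (u x)) \<bullet> weak_gradient \<Omega> (\<lambda>y. h (u y) * \<phi> y) x \<partial>M)
      = (\<integral>x. (a x (weak_gradient \<Omega> u x) + F (u x)) \<bullet> gradient \<phi> x \<partial>M)"
  proof (rule integrable_integral_cong_AE_lebesgue_on(2)[OF sets_\<Omega>])
    have "is_weak_gradient \<Omega> (\<lambda>y. h (u y) * \<phi> y) (gradient \<phi>)"
    proof (rule is_weak_gradient_cong_AE[OF sets_\<Omega> _ _ test_functions_weak_gradient[OF sets_\<Omega> \<phi>]])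
      show "AE x in M. \<phi> x = h (u x) * \<phi> x" using h1 by eventually_elim simp
    qed simp
    from weak_gradient_AE_eq[OF open_\<Omega> this] W1p_0_gradient_weak_gradient(2)[OF u_gradient]
    show "AE x in M. (a x (Du x) + F (u x)) \<bullet> weak_gradient \<Omega> (\<lambda>y. h (u y) * \<phi> y) x
        = (a x (weak_gradient \<Omega> u x) + F (u x)) \<bullet> gradient \<phi> x"
      by eventually_elim simp
  qed
  ultimately show "(\<integral>x. b x * \<phi> x \<partial>M)
      + (\<integral>x. (a x (weak_gradient \<Omega> u x) + F (u x)) \<bullet> gradient \<phi> x \<partial>M) = (\<integral>x. f x * \<phi> x \<partial>M)"
    using eq by simp
qed

end

theorem proposition4p3:
  fixes \<Omega> :: "(real ^ 'n) set"
    and p :: "'n \<Rightarrow> real"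
    and F :: "real \<Rightarrow> real ^ 'n"
    and \<beta> :: "real \<Rightarrow> real set"
    and a :: "real ^ 'n \<Rightarrow> real ^ 'n \<Rightarrow> real ^ 'n"
    and lam gam :: real
    and d :: "'n \<Rightarrow> real ^ 'n \<Rightarrow> real"
    and f u b :: "real ^ 'n \<Rightarrow> real"
  assumes domain: "bounded_domain \<Omega>"
    and boundary: "2 \<le> CARD('n) \<Longrightarrow> lipschitz_boundary \<Omega>"
    and exponents: "\<And>i. 1 < p i"
    and F: "locally_lipschitz F"
    and beta: "maximal_monotone \<beta>" "0 \<in> \<beta> 0"
    and caratheodory: "caratheodory \<Omega> a"
    and coerciveness: "0 < lam"
      "AE x in lebesgue_on \<Omega>. \<forall>\<xi>.
         lam * (\<Sum>i\<in>UNIV. \<bar>\<xi> $ i\<bar> powr p i) \<le> (\<Sum>i\<in>UNIV. a x \<xi> $ i * \<xi> $ i)"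
    and growth: "0 < gam"
      "\<And>i. d i \<in> L_space \<Omega> (p i / (p i - 1))"
      "\<And>i. AE x in lebesgue_on \<Omega>. 0 < d i x"
      "AE x in lebesgue_on \<Omega>. \<forall>\<xi> i.
         \<bar>a x \<xi> $ i\<bar> \<le> gam * (d i x + \<bar>\<xi> $ i\<bar> powr (p i - 1))"
    and monotonicity:
      "AE x in lebesgue_on \<Omega>. \<forall>\<xi> \<eta>. 0 \<le> (a x \<xi> - a x \<eta>) \<bullet> (\<xi> - \<eta>)"
    and f: "f \<in> L_infinity \<Omega>"
    and solution: "renormalized_solution \<Omega> p \<beta> a F f u b"
  shows "u \<in> W1p \<Omega> p \<inter> L_infinity \<Omega> \<and> weak_solution \<Omega> p \<beta> a F f u b"
proof -
  obtain C where fm: "f \<in> borel_measurable (lebesgue_on \<Omega>)" and C: "AE x in lebesgue_on \<Omega>. \<bar>f x\<bar> \<le> C"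
    using f by (auto simp: L_infinity_def)
  have um: "u \<in> borel_measurable (lebesgue_on \<Omega>)"
    and tr: "\<And>k. 0 < k \<Longrightarrow> (\<lambda>x. trunc k (u x)) \<in> W1p_0 \<Omega> p"
    using solution unfolding renormalized_solution_def by blast+
  interpret renormalized \<Omega> p u \<beta> a F f b lam gam "\<bar>C\<bar>" d
  proof
    show "monotone_graph \<beta>" using beta(1) by (simp add: maximal_monotone_def)
    show "AE x in lebesgue_on \<Omega>. \<bar>f x\<bar> \<le> \<bar>C\<bar>" using C by eventually_elim simp
  qed (fact domain exponents um tr F beta caratheodory coerciveness growth fm solution | simp)+
  obtain K where "AE x in lebesgue_on \<Omega>. \<bar>u x\<bar> \<le> K" using u_bounded by blast
  then have "u \<in> L_infinity \<Omega>" using um by (auto simp: L_infinity_def)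
  moreover have "u \<in> W1p \<Omega> p"
    using is_weak_solution by (simp add: weak_solution_def W1p_0_def)
  ultimately show ?thesis using is_weak_solution by blast
qed

end
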